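(* Let $F:(M_1^{m_1},g_1,J_1)\to(M_2^{m_2},g_2)$ be a pointwise slant Riemannian submersion with slant function $\theta$ from a generalized complex space form $M_1(c_1,c_2)$ onto a Riemannian manifold, with horizontal space of dimension $s\ge3$. Then, at every point, $$\rho_{\mathcal H}^{\mathcal H}\le\delta_C^{\mathcal H}(s-1)+c_1+\frac{3c_2}{s-1}\cos^2\theta,$$ and similarly $$\rho_{\mathcal H}^{\mathcal H}\le\hat\delta_C^{\mathcal H}(s-1)+c_1+\frac{3c_2}{s-1}\cos^2\theta.$$ Equality holds (identically on $M_1$, in either inequality) if and only if the tensor $A$ vanishes identically, i.e. $A_XY=0$ for all $X,Y\in\Gamma((\ker F_* )^\perp)$, which is equivalent to the horizontal distribution being completely integrable.
   Context: All manifolds are smooth, connected, without boundary. A Riemannian submersion $F:(M_1^{m_1},g_1)\to(M_2^{m_2},g_2)$ has vertical distribution $\mathcal V=\ker F_*$ (of dimension $r$) and horizontal distribution $\mathcal H=(\ker F_* )^\perp$; $\mathcal V,\mathcal H$ also denote the orthogonal projections. $\nabla$ is the Levi-Civita connection of $g_1$. O'Neill's tensor $A$ is $A_EG=\mathcal V\nabla_{\mathcal HE}\mathcal HG+\mathcal H\nabla_{\mathcal HE}\mathcal VG$; for horizontal $X,Y$, $A_XY=\frac12\mathcal V[X,Y]$. Generalized complex space form $M_1(c_1,c_2)$: an almost Hermitian manifold $(M_1,g_1,J_1)$ ($J_1^2=-I$, $g_1(J_1X,J_1Y)=g_1(X,Y)$) whose curvature tensor $R^{M_1}$ satisfies, for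 smooth functions $c_1,c_2$, $$R^{M_1}(X,Y)Z=c_1\{g_1(Y,Z)X-g_1(X,Z)Y\}+c_2\{g_1(X,J_1Z)J_1Y-g_1(Y,J_1Z)J_1X+2g_1(X,J_1Y)J_1Z\}.$$ Pointwise slant: for vertical $U$ and horizontal $X$ write $J_1U=P^{\mathcal V}U+Q^{\mathcal V}U$ and $J_1X=P^{\mathcal H}X+Q^{\mathcal H}X$ with $P^{\mathcal V}U$, $Q^{\mathcal H}X$ vertical and $Q^{\mathcal V}U$, $P^{\mathcal H}X$ horizontal. $F$ is pointwise slant with slant function $\theta:M_1\to[0,\pi/2]$ if at each $p$ the angle between $J_1U$ and $\mathcal V_p$ equals $\theta(p)$ for every nonzero $U\in\mathcal V_p$, i.e. $(P^{\mathcal V})^2=-\cos^2\theta\,I$. The convention used for the horizontal results is that the analogous identities hold for $P^{\mathcal H}$ with the same $\theta$: $(P^{\mathcal H})^2=-\cos^2\theta\,I$ on $\mathcal H$, hence $\|P^{\mathcal H}\|^2=\sum_{i,j=1}^s g_1(X_i,P^{\mathcal H}X_j)^2=s\cos^2\theta$. Curvature $R^{\mathcal H}$ of the horizontal distribution: it is related to $R^{M_1}$, for horizontal $X,Y,Z,W$, by $$g_1(R^{M_1}(X,Y)Z,W)=g_1(R^{\mathcal H}(X,Y)Z,W)-2g_1(A_XY,A_ZW)+g_1(A_YZ,A_XW)-g_1(A_XZ,A_YW),$$ and this relation is taken as the definition of $R^{\mathcal H}$. For an orthonormal basis $\{X_1,\dots,X_s\}$ of $\mathcal H_p$, $\rho_{\mathcal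 H}^{\mathcal H}=\frac{1}{s(s-1)}\sum_{i,j=1}^s g_1(R^{\mathcal H}(X_i,X_j)X_j,X_i)$. Horizontal Casorati curvatures at $p$: with $\{U_1,\dots,U_r\}$ an orthonormal basis of $\mathcal V_p$, put $A_{ij}^k=g_1(A_{X_i}X_j,U_k)$ and $C^{\mathcal H}=\frac1s\sum_{k=1}^r\sum_{i,j=1}^s(A_{ij}^k)^2$. For a $q$-dimensional subspace $L\subset\mathcal H_p$ ($q\ge2$) with orthonormal basis $\{X_1,\dots,X_q\}$, $C(L)=\frac1q\sum_{k=1}^r\sum_{i,j=1}^q(A_{ij}^k)^2$. With $L$ ranging over hyperplanes ($(s-1)$-dimensional subspaces) of $\mathcal H_p$, $$\delta_C^{\mathcal H}(s-1)=\tfrac12C^{\mathcal H}+\tfrac{s+1}{2s}\inf_LC(L),\qquad\hat\delta_C^{\mathcal H}(s-1)=2C^{\mathcal H}-\tfrac{2s-1}{2s}\sup_LC(L).$$ *)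

theory Defs
  imports "HOL-Analysis.Analysis"
begin

section \<open>Smooth maps between open subsets of Euclidean spaces\<close>

text \<open>Only used on open sets. In finite dimension, a differentiable map all of whose directional
  derivatives are of class C^k is of class C^(k+1).\<close>

primrec Ck_on :: "nat \<Rightarrow> 'e::euclidean_space set \<Rightarrow> ('e \<Rightarrow> 'b::real_normed_vector) \<Rightarrow> bool" where
  "Ck_on 0 S f \<longleftrightarrow> continuous_on S f"
| "Ck_on (Suc k) S f \<longleftrightarrow> (\<forall>x\<in>S. f differentiable at x) \<and>
     (\<forall>v. Ck_on k S (\<lambda>x. frechet_derivative f (at x) v))"

definition smooth_on :: "'e::euclidean_space set \<Rightarrow> ('e \<Rightarrow> 'b::real_normed_vector) \<Rightarrow> bool" where
  "smooth_on S f \<longleftrightarrow> (\<forall>k. Ck_on k S f)"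

section \<open>Smooth manifolds\<close>

text \<open>The underlying space of a manifold is a whole type, Hausdorff and second countable by its
  sort; the model space is \<open>'e\<close>, so the dimension is \<open>DIM('e)\<close>. Besides the atlas, a manifold
  carries a choice of a chart around each point. The tangent space at \<open>p\<close> is
  the model space \<open>'e\<close>: a vector \<open>v :: 'e\<close> at \<open>p\<close> stands for the tangent vector whose components in
  the chosen chart at \<open>p\<close> are \<open>v\<close>. Hence vector fields are functions \<open>'a \<Rightarrow> 'e\<close>, and the linear
  structure of the tangent spaces is that of \<open>'e\<close>. The inner product
  and norm of \<open>'e\<close> play no geometric role. All notions involving different points are expressed in
  charts, using the derivatives of coordinate changes.\<close>

type_synonym ('a, 'e) chart = "'a set \<times> ('a \<Rightarrow> 'e)"

abbreviation chart_dom :: "('a, 'e) chart \<Rightarrow> 'a set" where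
  "chart_dom c \<equiv> fst c"

abbreviation chart_map :: "('a, 'e) chart \<Rightarrow> 'a \<Rightarrow> 'e" where
  "chart_map c \<equiv> snd c"

definition chart_inv :: "('a, 'e) chart \<Rightarrow> 'e \<Rightarrow> 'a" where
  "chart_inv c = inv_into (chart_dom c) (chart_map c)"

abbreviation chart_img :: "('a, 'e) chart \<Rightarrow> 'e set" where
  "chart_img c \<equiv> chart_map c ` chart_dom c"

record ('a, 'e) manifold =
  charts :: "('a, 'e) chart set"
  chart_at :: "'a \<Rightarrow> ('a, 'e) chart"

definition smooth_manifold ::
    "('a::{t2_space,second_countable_topology}, 'e::euclidean_space) manifold \<Rightarrow> bool" where
  "smooth_manifold M \<longleftrightarrow>
     connected (UNIV :: 'a set) \<and>
     (\<forall>c\<in>charts M. open (chart_dom c) \<and> open (chart_img c) \<and>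
        homeomorphism (chart_dom c) (chart_img c) (chart_map c) (chart_inv c)) \<and>
     (\<forall>c\<in>charts M. \<forall>d\<in>charts M.
        smooth_on (chart_map c ` (chart_dom c \<inter> chart_dom d)) (chart_map d \<circ> chart_inv c)) \<and>
     (\<forall>p. chart_at M p \<in> charts M \<and> p \<in> chart_dom (chart_at M p))"

definition base_coord :: "('a, 'e) manifold \<Rightarrow> 'a \<Rightarrow> 'e" where
  "base_coord M p = chart_map (chart_at M p) p"

definition smooth_fun :: "('a, 'e::euclidean_space) manifold \<Rightarrow> ('a \<Rightarrow> real) \<Rightarrow> bool" where
  "smooth_fun M f \<longleftrightarrow> (\<forall>c\<in>charts M. smooth_on (chart_img c) (f \<circ> chart_inv c))"

definition smooth_map ::
    "('a::topological_space, 'e::euclidean_space) manifold \<Rightarrow>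
     ('b::topological_space, 'f::euclidean_space) manifold \<Rightarrow> ('a \<Rightarrow> 'b) \<Rightarrow> bool" where
  "smooth_map M N F \<longleftrightarrow> continuous_on UNIV F \<and>
     (\<forall>c\<in>charts M. \<forall>d\<in>charts N.
        smooth_on (chart_map c ` (chart_dom c \<inter> F -` chart_dom d))
          (chart_map d \<circ> F \<circ> chart_inv c))"

definition tangent_map ::
    "('a, 'e::euclidean_space) manifold \<Rightarrow> ('b, 'f::euclidean_space) manifold \<Rightarrow>
     ('a \<Rightarrow> 'b) \<Rightarrow> 'a \<Rightarrow> 'e \<Rightarrow> 'f" where
  "tangent_map M N F p v =
     frechet_derivative (chart_map (chart_at N (F p)) \<circ> F \<circ> chart_inv (chart_at M p))
       (at (base_coord M p)) v"

text \<open>Components in the chart \<open>c\<close> of the tangent vector \<open>v\<close> at \<open>p\<close>, and conversely the tangent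
  vector at the point with coordinates \<open>x\<close> whose components in \<open>c\<close> are \<open>w\<close>.\<close>

definition vec_in_chart ::
    "('a, 'e::euclidean_space) manifold \<Rightarrow> ('a, 'e) chart \<Rightarrow> 'a \<Rightarrow> 'e \<Rightarrow> 'e" where
  "vec_in_chart M c p v =
     frechet_derivative (chart_map c \<circ> chart_inv (chart_at M p)) (at (base_coord M p)) v"

definition vec_of_chart ::
    "('a, 'e::euclidean_space) manifold \<Rightarrow> ('a, 'e) chart \<Rightarrow> 'e \<Rightarrow> 'e \<Rightarrow> 'e" where
  "vec_of_chart M c x w =
     frechet_derivative (chart_map (chart_at M (chart_inv c x)) \<circ> chart_inv c) (at x) w"

definition field_in_chart ::
    "('a, 'e::euclidean_space) manifold \<Rightarrow> ('a, 'e) chart \<Rightarrow> ('a \<Rightarrow> 'e) \<Rightarrow> 'e \<Rightarrow> 'e" where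
  "field_in_chart M c X x = vec_in_chart M c (chart_inv c x) (X (chart_inv c x))"

definition smooth_field :: "('a, 'e::euclidean_space) manifold \<Rightarrow> ('a \<Rightarrow> 'e) \<Rightarrow> bool" where
  "smooth_field M X \<longleftrightarrow> (\<forall>c\<in>charts M. smooth_on (chart_img c) (field_in_chart M c X))"

definition dir_deriv ::
    "('a, 'e::euclidean_space) manifold \<Rightarrow> ('a \<Rightarrow> 'e) \<Rightarrow> ('a \<Rightarrow> real) \<Rightarrow> 'a \<Rightarrow> real" where
  "dir_deriv M X f p =
     frechet_derivative (f \<circ> chart_inv (chart_at M p)) (at (base_coord M p)) (X p)"

definition lie_bracket ::
    "('a, 'e::euclidean_space) manifold \<Rightarrow> ('a \<Rightarrow> 'e) \<Rightarrow> ('a \<Rightarrow> 'e) \<Rightarrow> 'a \<Rightarrow> 'e" where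
  "lie_bracket M X Y p =
     frechet_derivative (field_in_chart M (chart_at M p) Y) (at (base_coord M p)) (X p) -
     frechet_derivative (field_in_chart M (chart_at M p) X) (at (base_coord M p)) (Y p)"

section \<open>Riemannian metrics, Levi-Civita connection, curvature\<close>

definition riemannian_metric ::
    "('a, 'e::euclidean_space) manifold \<Rightarrow> ('a \<Rightarrow> 'e \<Rightarrow> 'e \<Rightarrow> real) \<Rightarrow> bool" where
  "riemannian_metric M g \<longleftrightarrow>
     (\<forall>p. bilinear (g p) \<and> (\<forall>v w. g p v w = g p w v) \<and> (\<forall>v. v \<noteq> 0 \<longrightarrow> 0 < g p v v)) \<and>
     (\<forall>c\<in>charts M. \<forall>v w. smooth_on (chart_img c)
        (\<lambda>x. g (chart_inv c x) (vec_of_chart M c x v) (vec_of_chart M c x w)))"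

definition levi_civita ::
    "('a, 'e::euclidean_space) manifold \<Rightarrow> ('a \<Rightarrow> 'e \<Rightarrow> 'e \<Rightarrow> real) \<Rightarrow>
     (('a \<Rightarrow> 'e) \<Rightarrow> ('a \<Rightarrow> 'e) \<Rightarrow> 'a \<Rightarrow> 'e) \<Rightarrow> bool" where
  "levi_civita M g nab \<longleftrightarrow>
     (\<forall>X Y. smooth_field M X \<longrightarrow> smooth_field M Y \<longrightarrow>
        smooth_field M (nab X Y) \<and>
        (\<forall>p. nab X Y p - nab Y X p = lie_bracket M X Y p)) \<and>
     (\<forall>X Y f. smooth_field M X \<longrightarrow> smooth_field M Y \<longrightarrow> smooth_fun M f \<longrightarrow>
        (\<forall>p. nab (\<lambda>q. f q *\<^sub>R X q) Y p = f p *\<^sub>R nab X Y p) \<and>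
        (\<forall>p. nab X (\<lambda>q. f q *\<^sub>R Y q) p = dir_deriv M X f p *\<^sub>R Y p + f p *\<^sub>R nab X Y p)) \<and>
     (\<forall>X Y Z. smooth_field M X \<longrightarrow> smooth_field M Y \<longrightarrow> smooth_field M Z \<longrightarrow>
        (\<forall>p. nab (\<lambda>q. X q + Y q) Z p = nab X Z p + nab Y Z p) \<and>
        (\<forall>p. nab X (\<lambda>q. Y q + Z q) p = nab X Y p + nab X Z p) \<and>
        (\<forall>p. dir_deriv M X (\<lambda>q. g q (Y q) (Z q)) p =
              g p (nab X Y p) (Z p) + g p (Y p) (nab X Z p)))"

definition curvature ::
    "('a, 'e::euclidean_space) manifold \<Rightarrow> (('a \<Rightarrow> 'e) \<Rightarrow> ('a \<Rightarrow> 'e) \<Rightarrow> 'a \<Rightarrow> 'e) \<Rightarrow>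
     ('a \<Rightarrow> 'e) \<Rightarrow> ('a \<Rightarrow> 'e) \<Rightarrow> ('a \<Rightarrow> 'e) \<Rightarrow> 'a \<Rightarrow> 'e" where
  "curvature M nab X Y Z p =
     nab X (nab Y Z) p - nab Y (nab X Z) p - nab (lie_bracket M X Y) Z p"

text \<open>Value of the curvature tensor on vectors at a point, through arbitrary smooth extensions
  (by tensoriality the value does not depend on them).\<close>

definition curvature_at ::
    "('a, 'e::euclidean_space) manifold \<Rightarrow> (('a \<Rightarrow> 'e) \<Rightarrow> ('a \<Rightarrow> 'e) \<Rightarrow> 'a \<Rightarrow> 'e) \<Rightarrow>
     'a \<Rightarrow> 'e \<Rightarrow> 'e \<Rightarrow> 'e \<Rightarrow> 'e" where
  "curvature_at M nab p x y z = (THE r. \<exists>X Y Z.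
     smooth_field M X \<and> smooth_field M Y \<and> smooth_field M Z \<and>
     X p = x \<and> Y p = y \<and> Z p = z \<and> r = curvature M nab X Y Z p)"

section \<open>Generalized complex space forms\<close>

definition almost_hermitian ::
    "('a, 'e::euclidean_space) manifold \<Rightarrow> ('a \<Rightarrow> 'e \<Rightarrow> 'e \<Rightarrow> real) \<Rightarrow> ('a \<Rightarrow> 'e \<Rightarrow> 'e) \<Rightarrow> bool" where
  "almost_hermitian M g J \<longleftrightarrow>
     riemannian_metric M g \<and>
     (\<forall>p. linear (J p) \<and> (\<forall>v. J p (J p v) = - v) \<and> (\<forall>v w. g p (J p v) (J p w) = g p v w)) \<and>
     (\<forall>X. smooth_field M X \<longrightarrow> smooth_field M (\<lambda>q. J q (X q)))"

definition generalized_complex_space_form ::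
    "('a, 'e::euclidean_space) manifold \<Rightarrow> ('a \<Rightarrow> 'e \<Rightarrow> 'e \<Rightarrow> real) \<Rightarrow>
     (('a \<Rightarrow> 'e) \<Rightarrow> ('a \<Rightarrow> 'e) \<Rightarrow> 'a \<Rightarrow> 'e) \<Rightarrow> ('a \<Rightarrow> 'e \<Rightarrow> 'e) \<Rightarrow>
     ('a \<Rightarrow> real) \<Rightarrow> ('a \<Rightarrow> real) \<Rightarrow> bool" where
  "generalized_complex_space_form M g nab J c1 c2 \<longleftrightarrow>
     almost_hermitian M g J \<and> levi_civita M g nab \<and> smooth_fun M c1 \<and> smooth_fun M c2 \<and>
     (\<forall>X Y Z p. smooth_field M X \<longrightarrow> smooth_field M Y \<longrightarrow> smooth_field M Z \<longrightarrow>
        curvature M nab X Y Z p =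
          c1 p *\<^sub>R (g p (Y p) (Z p) *\<^sub>R X p - g p (X p) (Z p) *\<^sub>R Y p) +
          c2 p *\<^sub>R (g p (X p) (J p (Z p)) *\<^sub>R J p (Y p)
                  - g p (Y p) (J p (Z p)) *\<^sub>R J p (X p)
                  + (2 * g p (X p) (J p (Y p))) *\<^sub>R J p (Z p)))"

section \<open>Riemannian submersions and O'Neill's tensor\<close>

definition vertical ::
    "('a, 'e::euclidean_space) manifold \<Rightarrow> ('b, 'f::euclidean_space) manifold \<Rightarrow>
     ('a \<Rightarrow> 'b) \<Rightarrow> 'a \<Rightarrow> 'e set" where
  "vertical M N F p = {v. tangent_map M N F p v = 0}"

definition orth_compl :: "('a \<Rightarrow> 'e \<Rightarrow> 'e \<Rightarrow> real) \<Rightarrow> ('a \<Rightarrow> 'e set) \<Rightarrow> 'a \<Rightarrow> 'e set" where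
  "orth_compl g D p = {v. \<forall>u\<in>D p. g p v u = 0}"

definition horizontal ::
    "('a, 'e::euclidean_space) manifold \<Rightarrow> ('b, 'f::euclidean_space) manifold \<Rightarrow>
     ('a \<Rightarrow> 'e \<Rightarrow> 'e \<Rightarrow> real) \<Rightarrow> ('a \<Rightarrow> 'b) \<Rightarrow> 'a \<Rightarrow> 'e set" where
  "horizontal M N g F = orth_compl g (vertical M N F)"

definition orth_proj ::
    "('a \<Rightarrow> 'e::euclidean_space \<Rightarrow> 'e \<Rightarrow> real) \<Rightarrow> ('a \<Rightarrow> 'e set) \<Rightarrow> 'a \<Rightarrow> 'e \<Rightarrow> 'e" where
  "orth_proj g D p v = (THE w. w \<in> D p \<and> (\<forall>u\<in>D p. g p (v - w) u = 0))"

definition riemannian_submersion ::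
    "('a::{t2_space,second_countable_topology}, 'e::euclidean_space) manifold \<Rightarrow>
     ('b::{t2_space,second_countable_topology}, 'f::euclidean_space) manifold \<Rightarrow>
     ('a \<Rightarrow> 'e \<Rightarrow> 'e \<Rightarrow> real) \<Rightarrow> ('b \<Rightarrow> 'f \<Rightarrow> 'f \<Rightarrow> real) \<Rightarrow> ('a \<Rightarrow> 'b) \<Rightarrow> bool" where
  "riemannian_submersion M N g h F \<longleftrightarrow>
     smooth_manifold M \<and> smooth_manifold N \<and> riemannian_metric M g \<and> riemannian_metric N h \<and>
     smooth_map M N F \<and> surj F \<and> (\<forall>p. surj (tangent_map M N F p)) \<and>
     (\<forall>p. \<forall>x\<in>horizontal M N g F p. \<forall>y\<in>horizontal M N g F p.
        h (F p) (tangent_map M N F p x) (tangent_map M N F p y) = g p x y)"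

text \<open>In the following, \<open>V\<close> is the vertical distribution and \<open>orth_compl g V\<close> the horizontal one.\<close>

definition oneill_A ::
    "('a \<Rightarrow> 'e::euclidean_space \<Rightarrow> 'e \<Rightarrow> real) \<Rightarrow> (('a \<Rightarrow> 'e) \<Rightarrow> ('a \<Rightarrow> 'e) \<Rightarrow> 'a \<Rightarrow> 'e) \<Rightarrow>
     ('a \<Rightarrow> 'e set) \<Rightarrow> ('a \<Rightarrow> 'e) \<Rightarrow> ('a \<Rightarrow> 'e) \<Rightarrow> 'a \<Rightarrow> 'e" where
  "oneill_A g nab V E G p =
     (let H = orth_compl g V;
          hp = (\<lambda>X q. orth_proj g H q (X q));
          vp = (\<lambda>X q. orth_proj g V q (X q))
      in vp (nab (hp E) (hp G)) p + hp (nab (hp E) (vp G)) p)"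

text \<open>Value of the tensor \<open>A\<close> on vectors at a point, through arbitrary smooth extensions.\<close>

definition oneill_A_at ::
    "('a, 'e::euclidean_space) manifold \<Rightarrow> ('a \<Rightarrow> 'e \<Rightarrow> 'e \<Rightarrow> real) \<Rightarrow>
     (('a \<Rightarrow> 'e) \<Rightarrow> ('a \<Rightarrow> 'e) \<Rightarrow> 'a \<Rightarrow> 'e) \<Rightarrow> ('a \<Rightarrow> 'e set) \<Rightarrow> 'a \<Rightarrow> 'e \<Rightarrow> 'e \<Rightarrow> 'e" where
  "oneill_A_at M g nab V p x y = (THE a. \<exists>E G. smooth_field M E \<and> smooth_field M G \<and>
     E p = x \<and> G p = y \<and> a = oneill_A g nab V E G p)"

definition sections :: "('a, 'e::euclidean_space) manifold \<Rightarrow> ('a \<Rightarrow> 'e set) \<Rightarrow> ('a \<Rightarrow> 'e) set" where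
  "sections M D = {X. smooth_field M X \<and> (\<forall>p. X p \<in> D p)}"

text \<open>Complete integrability of a distribution is understood in the sense of Frobenius: its sections
  are closed under the Lie bracket.\<close>

definition completely_integrable ::
    "('a, 'e::euclidean_space) manifold \<Rightarrow> ('a \<Rightarrow> 'e set) \<Rightarrow> bool" where
  "completely_integrable M D \<longleftrightarrow>
     (\<forall>X\<in>sections M D. \<forall>Y\<in>sections M D. \<forall>p. lie_bracket M X Y p \<in> D p)"

section \<open>Pointwise slant condition\<close>

definition angle_to ::
    "('a \<Rightarrow> 'e::euclidean_space \<Rightarrow> 'e \<Rightarrow> real) \<Rightarrow> ('a \<Rightarrow> 'e set) \<Rightarrow> 'a \<Rightarrow> 'e \<Rightarrow> real" where
  "angle_to g D p v =
     arccos (sqrt (g p (orth_proj g D p v) (orth_proj g D p v)) / sqrt (g p v v))"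

text \<open>The first clause is the definition of the slant function through the angle between \<open>J U\<close> and the
  vertical space. The last clause is the convention that the slant identity \<open>P\<^sup>2 = - cos\<^sup>2 \<theta>\<close> also
  holds for the horizontal part \<open>P\<close> of \<open>J\<close> on horizontal vectors, with the same \<open>\<theta>\<close>.\<close>

definition pointwise_slant ::
    "('a \<Rightarrow> 'e::euclidean_space \<Rightarrow> 'e \<Rightarrow> real) \<Rightarrow> ('a \<Rightarrow> 'e \<Rightarrow> 'e) \<Rightarrow> ('a \<Rightarrow> 'e set) \<Rightarrow>
     ('a \<Rightarrow> real) \<Rightarrow> bool" where
  "pointwise_slant g J V \<theta> \<longleftrightarrow>
     (\<forall>p. 0 \<le> \<theta> p \<and> \<theta> p \<le> pi / 2) \<and>
     (\<forall>p. \<forall>u\<in>V p. u \<noteq> 0 \<longrightarrow> angle_to g V p (J p u) = \<theta> p) \<and>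
     (let H = orth_compl g V; P = (\<lambda>p x. orth_proj g H p (J p x))
      in \<forall>p. \<forall>x\<in>H p. P p (P p x) = - ((cos (\<theta> p))\<^sup>2 *\<^sub>R x))"

section \<open>Horizontal scalar curvature and Casorati curvatures\<close>

definition orthonormal_basis ::
    "('e::euclidean_space \<Rightarrow> 'e \<Rightarrow> real) \<Rightarrow> 'e set \<Rightarrow> 'e set \<Rightarrow> bool" where
  "orthonormal_basis b W B \<longleftrightarrow> finite B \<and> span B = W \<and>
     (\<forall>x\<in>B. \<forall>y\<in>B. b x y = (if x = y then 1 else 0))"

text \<open>The quantities below do not depend on which orthonormal basis is chosen.\<close>

definition onb :: "('e::euclidean_space \<Rightarrow> 'e \<Rightarrow> real) \<Rightarrow> 'e set \<Rightarrow> 'e set" where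
  "onb b W = (SOME B. orthonormal_basis b W B)"

text \<open>\<open>hor_curv M g nab V p x y z w\<close> is \<open>g (R\<^sup>H (x, y) z, w)\<close> for horizontal vectors at \<open>p\<close>, given by the
  relation to the curvature of \<open>M\<close> that defines \<open>R\<^sup>H\<close>.\<close>

definition hor_curv ::
    "('a, 'e::euclidean_space) manifold \<Rightarrow> ('a \<Rightarrow> 'e \<Rightarrow> 'e \<Rightarrow> real) \<Rightarrow>
     (('a \<Rightarrow> 'e) \<Rightarrow> ('a \<Rightarrow> 'e) \<Rightarrow> 'a \<Rightarrow> 'e) \<Rightarrow> ('a \<Rightarrow> 'e set) \<Rightarrow> 'a \<Rightarrow>
     'e \<Rightarrow> 'e \<Rightarrow> 'e \<Rightarrow> 'e \<Rightarrow> real" where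
  "hor_curv M g nab V p x y z w =
     (let A = oneill_A_at M g nab V p
      in g p (curvature_at M nab p x y z) w
         + 2 * g p (A x y) (A z w) - g p (A y z) (A x w) + g p (A x z) (A y w))"

definition hor_scalar ::
    "('a, 'e::euclidean_space) manifold \<Rightarrow> ('a \<Rightarrow> 'e \<Rightarrow> 'e \<Rightarrow> real) \<Rightarrow>
     (('a \<Rightarrow> 'e) \<Rightarrow> ('a \<Rightarrow> 'e) \<Rightarrow> 'a \<Rightarrow> 'e) \<Rightarrow> ('a \<Rightarrow> 'e set) \<Rightarrow> 'a \<Rightarrow> real" where
  "hor_scalar M g nab V p =
     (let H = orth_compl g V p; s = real (dim H); B = onb (g p) H
      in 1 / (s * (s - 1)) * (\<Sum>x\<in>B. \<Sum>y\<in>B. hor_curv M g nab V p x y y x))"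

text \<open>\<open>C(L)\<close> for a subspace \<open>L\<close> of the horizontal space; for \<open>L\<close> the whole horizontal space this
  is \<open>C\<^sup>H\<close>.\<close>

definition casorati ::
    "('a, 'e::euclidean_space) manifold \<Rightarrow> ('a \<Rightarrow> 'e \<Rightarrow> 'e \<Rightarrow> real) \<Rightarrow>
     (('a \<Rightarrow> 'e) \<Rightarrow> ('a \<Rightarrow> 'e) \<Rightarrow> 'a \<Rightarrow> 'e) \<Rightarrow> ('a \<Rightarrow> 'e set) \<Rightarrow> 'a \<Rightarrow> 'e set \<Rightarrow> real" where
  "casorati M g nab V p L =
     1 / real (dim L) * (\<Sum>u\<in>onb (g p) (V p). \<Sum>x\<in>onb (g p) L. \<Sum>y\<in>onb (g p) L.
        (g p (oneill_A_at M g nab V p x y) u)\<^sup>2)"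

definition hyperplanes :: "'e::euclidean_space set \<Rightarrow> 'e set set" where
  "hyperplanes W = {L. subspace L \<and> L \<subseteq> W \<and> dim L + 1 = dim W}"

definition delta_C ::
    "('a, 'e::euclidean_space) manifold \<Rightarrow> ('a \<Rightarrow> 'e \<Rightarrow> 'e \<Rightarrow> real) \<Rightarrow>
     (('a \<Rightarrow> 'e) \<Rightarrow> ('a \<Rightarrow> 'e) \<Rightarrow> 'a \<Rightarrow> 'e) \<Rightarrow> ('a \<Rightarrow> 'e set) \<Rightarrow> 'a \<Rightarrow> real" where
  "delta_C M g nab V p =
     (let H = orth_compl g V p; s = real (dim H)
      in 1 / 2 * casorati M g nab V p H
         + (s + 1) / (2 * s) * (INF L\<in>hyperplanes H. casorati M g nab V p L))"

definition delta_hat_C ::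
    "('a, 'e::euclidean_space) manifold \<Rightarrow> ('a \<Rightarrow> 'e \<Rightarrow> 'e \<Rightarrow> real) \<Rightarrow>
     (('a \<Rightarrow> 'e) \<Rightarrow> ('a \<Rightarrow> 'e) \<Rightarrow> 'a \<Rightarrow> 'e) \<Rightarrow> ('a \<Rightarrow> 'e set) \<Rightarrow> 'a \<Rightarrow> real" where
  "delta_hat_C M g nab V p =
     (let H = orth_compl g V p; s = real (dim H)
      in 2 * casorati M g nab V p H
         - (2 * s - 1) / (2 * s) * (SUP L\<in>hyperplanes H. casorati M g nab V p L))"

end

theory Submission
  imports Defs
begin

text \<open>
  Everything rests on O'Neill's tensor \<open>A\<close>, restricted to horizontal vectors, being a skew bilinear
  map with vertical values. Granting this, the result is algebra at a single point. The relation that defines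
  \<open>R\<^sup>H\<close> gives \<open>g(R\<^sup>H(x, y)y, x) = g(R(x, y)y, x) - 3 |A\<^sub>x y|\<^sup>2\<close>; summing over an orthonormal basis,
  with the curvature of the space form and \<open>|Py|\<^sup>2 = cos\<^sup>2 \<theta> |y|\<^sup>2\<close> for the horizontal part \<open>P\<close> of \<open>J\<close>,
  one finds \<open>\<rho> = c\<^sub>1 + 3 c\<^sub>2 cos\<^sup>2 \<theta> / (s - 1) - 3 C\<^sup>H / (s - 1)\<close> (\<open>hor_scalar_eq\<close>). On the other side,
  \<open>\<delta>\<^sub>C \<ge> C\<^sup>H / 2\<close> because \<open>C(L) \<ge> 0\<close>, and the hatted invariant is at least
  \<open>(2 - (2 s - 1) / (2 (s - 1))) C\<^sup>H\<close> because the squared norm of \<open>A\<close> on a hyperplane is at most that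
  on the whole horizontal space, so that \<open>(s - 1) C(L) \<le> s C\<^sup>H\<close>. In both inequalities the gap is
  at least a positive multiple of \<open>C\<^sup>H\<close>; hence equality at a point forces \<open>C\<^sup>H = 0\<close>, that is \<open>A = 0\<close>
  at this point, and conversely both Casorati invariants vanish with \<open>A\<close> (\<open>hor_scalar_bound\<close>).

  Skewness of \<open>A\<close> is the geometric input. For a horizontal field \<open>X\<close> and a vertical field \<open>U\<close> one has
  \<open>2 g(\<nabla>\<^sub>X X, U) = - 2 g(X, \<nabla>\<^sub>X U) = 2 g([U, X], X) - U g(X, X)\<close>, and the right-hand side vanishes because
  the metric on horizontal vectors is pulled back from the base
  (\<open>vertical_derivative_of_metric\<close>, a computation in charts that uses the symmetry of second
  derivatives). Polarised, this says that \<open>A\<^sub>X Y\<close> is the vertical part of \<open>[X, Y] / 2\<close>, whence the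
  equivalence with integrability. Together with \<open>g(\<nabla>\<^sub>X Y, U) = - g(Y, \<nabla>\<^sub>X U)\<close> it also shows that
  \<open>A\<^sub>X Y\<close> at \<open>p\<close> depends on the values of \<open>X\<close> and \<open>Y\<close> at \<open>p\<close> only (\<open>oneill_A_tensorial\<close>).

  Since the connection is characterised on globally smooth fields, two existence results are
  needed before any of this applies: every tangent vector extends to a smooth field (bump functions,
  \<open>smooth_extension_exists\<close>), and the horizontal and vertical parts of a smooth field are smooth
  (\<open>smooth_field_hor\<close>). The latter holds because \<open>g(hor X, w) = h(F\<^sub>*X, F\<^sub>*w)\<close> has a smooth right-hand
  side, and raising the index by means of a smooth orthogonal frame preserves smoothness.
\<close>

section \<open>Calculus of finitely often differentiable maps\<close>

lemma Ck_on_cong: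
  assumes "open S" "\<And>x. x \<in> S \<Longrightarrow> f x = g x"
  shows "Ck_on k S f \<longleftrightarrow> Ck_on k S g"
proof -
  have imp: "Ck_on k S g" if "Ck_on k S f" "\<And>x. x \<in> S \<Longrightarrow> f x = g x" for f g
    using that
  proof (induction k arbitrary: f g)
    case 0
    then show ?case using continuous_on_cong[OF refl] by fastforce
  next
    case (Suc k)
    have d: "g differentiable at x" if "x \<in> S" for x
      using Suc.prems that assms(1) unfolding differentiable_def Ck_on.simps
      by (meson has_derivative_transform_within_open)
    have e: "frechet_derivative f (at x) = frechet_derivative g (at x)" if "x \<in> S" for x
      by (rule frechet_derivative_transform_within_open[OF _ assms(1) that])
        (use Suc.prems that in auto)
    have "Ck_on k S (\<lambda>x. frechet_derivative g (at x) v)" for v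
      by (rule Suc.IH[of "\<lambda>x. frechet_derivative f (at x) v"]) (use Suc.prems e in auto)
    then show ?case using d by simp
  qed
  show ?thesis using imp assms(2) by metis
qed

lemma Ck_on_subset: "Ck_on k S f \<Longrightarrow> T \<subseteq> S \<Longrightarrow> Ck_on k T f"
  by (induction k arbitrary: f) (auto intro: continuous_on_subset)

lemma Ck_on_Suc_imp: "Ck_on (Suc k) S f \<Longrightarrow> Ck_on k S f"
proof (induction k arbitrary: f)
  case 0
  then show ?case
    by (auto intro!: continuous_at_imp_continuous_on differentiable_imp_continuous_within)
next
  case (Suc k)
  then show ?case by (metis Ck_on.simps(2))
qed

text \<open>A derivative at a point only sees a neighbourhood, so the recursion can be run on small open
  sets. Fields on a manifold will be treated on pieces where a suitable chart is available.\<close>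

lemma Ck_on_local:
  assumes "\<And>x. x \<in> S \<Longrightarrow> \<exists>T. open T \<and> x \<in> T \<and> Ck_on k T f"
  shows "Ck_on k S f"
  using assms
proof (induction k arbitrary: f)
  case 0
  have "isCont f x" if "x \<in> S" for x
    using 0 that by (metis Ck_on.simps(1) continuous_on_eq_continuous_at)
  then show ?case by (simp add: continuous_at_imp_continuous_on)
next
  case (Suc k)
  have "\<exists>T. open T \<and> x \<in> T \<and> Ck_on k T (\<lambda>x. frechet_derivative f (at x) v)" if "x \<in> S" for x v
    using Suc.prems[OF that] by auto
  then show ?case using Suc by (metis Ck_on.simps(2))
qed

lemma Ck_on_SucI:
  assumes "open S" "\<And>x. x \<in> S \<Longrightarrow> (f has_derivative f' x) (at x)"
    and "\<And>v. Ck_on k S (\<lambda>x. f' x v)"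
  shows "Ck_on (Suc k) S f"
proof -
  have "Ck_on k S (\<lambda>x. frechet_derivative f (at x) v)" for v
    using assms(3)[of v] Ck_on_cong[OF assms(1), of "\<lambda>x. f' x v"] assms(2) frechet_derivative_at
    by (metis (no_types, lifting))
  then show ?thesis using assms(2) by (auto simp: differentiable_def)
qed

lemma Ck_on_const: "open S \<Longrightarrow> Ck_on k S (\<lambda>x. c)"
  by (induction k arbitrary: c) auto

lemma Ck_on_Suc_has_derivative:
  "Ck_on (Suc k) S f \<Longrightarrow> x \<in> S \<Longrightarrow> (f has_derivative frechet_derivative f (at x)) (at x)"
  using frechet_derivative_works by auto

lemma Ck_on_Suc_deriv: "Ck_on (Suc k) S f \<Longrightarrow> Ck_on k S (\<lambda>x. frechet_derivative f (at x) v)"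
  by simp

lemma Ck_on_add:
  "open S \<Longrightarrow> Ck_on k S f \<Longrightarrow> Ck_on k S g \<Longrightarrow> Ck_on k S (\<lambda>x. f x + g x)"
proof (induction k arbitrary: f g)
  case 0
  then show ?case by (simp add: continuous_on_add)
next
  case (Suc k)
  note d = Ck_on_Suc_has_derivative[OF Suc.prems(2)] Ck_on_Suc_has_derivative[OF Suc.prems(3)]
  show ?case
    by (rule Ck_on_SucI[OF Suc.prems(1) has_derivative_add[OF d]], assumption, assumption)
      (rule Suc.IH[OF Suc.prems(1) Ck_on_Suc_deriv[OF Suc.prems(2)] Ck_on_Suc_deriv[OF Suc.prems(3)]])
qed

lemma Ck_on_sum:
  "open S \<Longrightarrow> (\<And>i. i \<in> I \<Longrightarrow> Ck_on k S (f i)) \<Longrightarrow> Ck_on k S (\<lambda>x. \<Sum>i\<in>I. f i x)"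
  by (induction I rule: infinite_finite_induct) (simp_all add: Ck_on_const Ck_on_add)

lemma (in bounded_bilinear) Ck_on_prod:
  "open S \<Longrightarrow> Ck_on k S f \<Longrightarrow> Ck_on k S g \<Longrightarrow> Ck_on k S (\<lambda>x. prod (f x) (g x))"
proof (induction k arbitrary: f g)
  case 0
  then show ?case by (simp add: continuous_on)
next
  case (Suc k)
  note d = Ck_on_Suc_has_derivative[OF Suc.prems(2)] Ck_on_Suc_has_derivative[OF Suc.prems(3)]
  show ?case
    by (rule Ck_on_SucI[OF Suc.prems(1) FDERIV[OF d]], assumption, assumption)
      (intro Ck_on_add[OF Suc.prems(1)] Suc.IH[OF Suc.prems(1)] Ck_on_Suc_imp[OF Suc.prems(2)]
        Ck_on_Suc_imp[OF Suc.prems(3)] Ck_on_Suc_deriv[OF Suc.prems(2)] Ck_on_Suc_deriv[OF Suc.prems(3)])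
qed

lemma Ck_on_linear:
  assumes "bounded_linear L" "open S" "Ck_on k S f"
  shows "Ck_on k S (\<lambda>x. L (f x))"
  using assms(3)
proof (induction k arbitrary: f)
  case 0
  then show ?case
    using bounded_linear.continuous_on[OF assms(1)] by simp
next
  case (Suc k)
  show ?case
    by (rule Ck_on_SucI[OF assms(2) bounded_linear.has_derivative[OF assms(1) Ck_on_Suc_has_derivative[OF Suc.prems]]],
        assumption) (rule Suc.IH[OF Ck_on_Suc_deriv[OF Suc.prems]])
qed

lemma linear_apply_basis:
  fixes f :: "'e::euclidean_space \<Rightarrow> 'b::real_vector"
  assumes "linear f"
  shows "f v = (\<Sum>b\<in>Basis. (v \<bullet> b) *\<^sub>R f b)"
proof -
  have "f v = f (\<Sum>b\<in>Basis. (v \<bullet> b) *\<^sub>R b)" by (simp add: euclidean_representation)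
  also have "\<dots> = (\<Sum>b\<in>Basis. (v \<bullet> b) *\<^sub>R f b)" using assms by (simp add: linear_sum linear_scale)
  finally show ?thesis .
qed

text \<open>Chain rule: the derivative of the composition is expanded in the basis, so that only
  directional derivatives of the outer map in fixed directions occur.\<close>

lemma Ck_on_compose:
  fixes g :: "'d::euclidean_space \<Rightarrow> 'e::euclidean_space" and f :: "'e \<Rightarrow> 'b::real_normed_vector"
  shows "open S \<Longrightarrow> open T \<Longrightarrow> g ` S \<subseteq> T \<Longrightarrow> Ck_on k T f \<Longrightarrow> Ck_on k S g \<Longrightarrow> Ck_on k S (\<lambda>x. f (g x))"
proof (induction k arbitrary: f g)
  case 0
  then show ?case by (auto intro: continuous_on_compose2)
next
  case (Suc k)
  have df: "(f has_derivative frechet_derivative f (at (g x))) (at (g x))" if "x \<in> S" for x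
    using Suc.prems that Ck_on_Suc_has_derivative by blast
  have dg: "(g has_derivative frechet_derivative g (at x)) (at x)" if "x \<in> S" for x
    using Suc.prems that Ck_on_Suc_has_derivative by blast
  show ?case
  proof (rule Ck_on_SucI[OF Suc.prems(1), where f' = "\<lambda>x v. \<Sum>b\<in>Basis.
        (frechet_derivative g (at x) v \<bullet> b) *\<^sub>R frechet_derivative f (at (g x)) b"])
    fix x assume x: "x \<in> S"
    show "((\<lambda>x. f (g x)) has_derivative (\<lambda>v. \<Sum>b\<in>Basis.
        (frechet_derivative g (at x) v \<bullet> b) *\<^sub>R frechet_derivative f (at (g x)) b)) (at x)"
      by (rule has_derivative_eq_rhs[OF has_derivative_compose[OF dg[OF x] df[OF x]]], rule ext,
          rule linear_apply_basis, rule has_derivative_linear, rule df[OF x])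
  next
    fix v
    have A: "Ck_on k S (\<lambda>x. frechet_derivative f (at (g x)) b)" for b
      by (rule Suc.IH[OF Suc.prems(1,2,3) _ Ck_on_Suc_imp[OF Suc.prems(5)]]) (use Suc.prems(4) in auto)
    have B: "Ck_on k S (\<lambda>x. frechet_derivative g (at x) v)" using Suc.prems(5) by simp
    show "Ck_on k S (\<lambda>x. \<Sum>b\<in>Basis.
        (frechet_derivative g (at x) v \<bullet> b) *\<^sub>R frechet_derivative f (at (g x)) b)"
      by (rule Ck_on_sum[OF Suc.prems(1)], rule bounded_bilinear.Ck_on_prod[OF bounded_bilinear_scaleR Suc.prems(1)],
          rule Ck_on_linear[OF bounded_linear_inner_left Suc.prems(1) B], rule A)
  qed
qed

text \<open>The derivative of \<open>1 / f\<close> is a polynomial in \<open>1 / f\<close> and \<open>f'\<close>, so one degree of smoothness less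
  for \<open>1 / f\<close> itself suffices in the induction.\<close>

lemma Ck_on_inverse:
  fixes f :: "'d::euclidean_space \<Rightarrow> real"
  shows "open S \<Longrightarrow> (\<And>x. x \<in> S \<Longrightarrow> f x \<noteq> 0) \<Longrightarrow> Ck_on k S f \<Longrightarrow> Ck_on k S (\<lambda>x. inverse (f x))"
proof (induction k)
  case 0
  then show ?case by (simp add: continuous_on_inverse)
next
  case (Suc k)
  have I: "Ck_on k S (\<lambda>x. inverse (f x))" using Suc.IH[OF Suc.prems(1,2) Ck_on_Suc_imp[OF Suc.prems(3)]] .
  have L: "bounded_linear (\<lambda>x::real. - x)" by (simp add: bounded_linear_minus bounded_linear_ident)
  show ?case
  proof (rule Ck_on_SucI[OF Suc.prems(1)])
    fix x assume x: "x \<in> S"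
    have "(f has_derivative frechet_derivative f (at x)) (at x)"
      using Suc.prems(3) x Ck_on_Suc_has_derivative by blast
    then show "((\<lambda>x. inverse (f x)) has_derivative
        (\<lambda>v. - (inverse (f x) * frechet_derivative f (at x) v * inverse (f x)))) (at x)"
      using Deriv.has_derivative_inverse[of f x, OF Suc.prems(2)[OF x]] by blast
  next
    fix v
    have "Ck_on k S (\<lambda>x. frechet_derivative f (at x) v)" using Suc.prems(3) by simp
    then show "Ck_on k S (\<lambda>x. - (inverse (f x) * frechet_derivative f (at x) v * inverse (f x)))"
      by (intro Ck_on_linear[OF L] bounded_bilinear.Ck_on_prod[OF bounded_bilinear_mult] Suc.prems(1) I)
  qed
qed

section \<open>Calculus of smooth maps\<close>

lemma smooth_on_cong:
  "open S \<Longrightarrow> (\<And>x. x \<in> S \<Longrightarrow> f x = g x) \<Longrightarrow> smooth_on S f \<longleftrightarrow> smooth_on S g"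
  unfolding smooth_on_def using Ck_on_cong by blast

lemma smooth_on_transform:
  "smooth_on S g \<Longrightarrow> open S \<Longrightarrow> (\<And>x. x \<in> S \<Longrightarrow> f x = g x) \<Longrightarrow> smooth_on S f"
  using smooth_on_cong[of S f g] by blast

lemma smooth_on_subset: "smooth_on S f \<Longrightarrow> T \<subseteq> S \<Longrightarrow> smooth_on T f"
  unfolding smooth_on_def using Ck_on_subset by blast

lemma smooth_on_local:
  assumes "\<And>x. x \<in> S \<Longrightarrow> \<exists>T. open T \<and> x \<in> T \<and> smooth_on T f"
  shows "smooth_on S f"
  unfolding smooth_on_def using assms by (meson Ck_on_local smooth_on_def)

lemma smooth_on_const: "open S \<Longrightarrow> smooth_on S (\<lambda>x. c)"
  by (simp add: smooth_on_def Ck_on_const)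

lemma smooth_on_add:
  "open S \<Longrightarrow> smooth_on S f \<Longrightarrow> smooth_on S g \<Longrightarrow> smooth_on S (\<lambda>x. f x + g x)"
  by (simp add: smooth_on_def Ck_on_add)

lemma smooth_on_sum:
  "open S \<Longrightarrow> (\<And>i. i \<in> I \<Longrightarrow> smooth_on S (f i)) \<Longrightarrow> smooth_on S (\<lambda>x. \<Sum>i\<in>I. f i x)"
  by (simp add: smooth_on_def Ck_on_sum)

lemma smooth_on_scaleR:
  "open S \<Longrightarrow> smooth_on S f \<Longrightarrow> smooth_on S g \<Longrightarrow> smooth_on S (\<lambda>x. f x *\<^sub>R g x)"
  by (simp add: smooth_on_def bounded_bilinear.Ck_on_prod[OF bounded_bilinear_scaleR])

lemma smooth_on_mult:
  fixes f :: "'d::euclidean_space \<Rightarrow> real"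
  shows "open S \<Longrightarrow> smooth_on S f \<Longrightarrow> smooth_on S g \<Longrightarrow> smooth_on S (\<lambda>x. f x * g x)"
  by (simp add: smooth_on_def bounded_bilinear.Ck_on_prod[OF bounded_bilinear_mult])

lemma smooth_on_linear:
  "bounded_linear L \<Longrightarrow> open S \<Longrightarrow> smooth_on S f \<Longrightarrow> smooth_on S (\<lambda>x. L (f x))"
  by (simp add: smooth_on_def Ck_on_linear)

lemma smooth_on_inner_left:
  "open S \<Longrightarrow> smooth_on S f \<Longrightarrow> smooth_on S (\<lambda>x. f x \<bullet> b)"
  by (rule smooth_on_linear[OF bounded_linear_inner_left])

lemma smooth_on_diff:
  assumes "open S" "smooth_on S f" "smooth_on S g"
  shows "smooth_on S (\<lambda>x. f x - g x)"
  using smooth_on_add[OF assms(1,2) smooth_on_linear[OF bounded_linear_minus[OF bounded_linear_ident] assms(1,3)]]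
  by simp

lemma smooth_on_compose:
  fixes g :: "'d::euclidean_space \<Rightarrow> 'e::euclidean_space" and f :: "'e \<Rightarrow> 'b::real_normed_vector"
  shows "open S \<Longrightarrow> open T \<Longrightarrow> g ` S \<subseteq> T \<Longrightarrow> smooth_on T f \<Longrightarrow> smooth_on S g \<Longrightarrow> smooth_on S (\<lambda>x. f (g x))"
  by (simp add: smooth_on_def Ck_on_compose)

lemma smooth_on_divide:
  fixes f :: "'d::euclidean_space \<Rightarrow> real"
  assumes "open S" "\<And>x. x \<in> S \<Longrightarrow> g x \<noteq> 0" "smooth_on S f" "smooth_on S g"
  shows "smooth_on S (\<lambda>x. f x / g x)"
  using smooth_on_mult[OF assms(1,3), of "\<lambda>x. inverse (g x)"] Ck_on_inverse[OF assms(1,2)] assms(4)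
  by (simp add: smooth_on_def divide_inverse)

lemma smooth_on_differentiable: "smooth_on S f \<Longrightarrow> x \<in> S \<Longrightarrow> f differentiable at x"
  unfolding smooth_on_def using Ck_on.simps(2)[of 0 S f] by blast

lemma smooth_on_has_derivative:
  "smooth_on S f \<Longrightarrow> x \<in> S \<Longrightarrow> (f has_derivative frechet_derivative f (at x)) (at x)"
  using smooth_on_differentiable frechet_derivative_works by blast

lemma smooth_on_frechet_linear: "smooth_on S f \<Longrightarrow> x \<in> S \<Longrightarrow> linear (frechet_derivative f (at x))"
  using smooth_on_differentiable linear_frechet_derivative by blast

lemma smooth_on_deriv: "smooth_on S f \<Longrightarrow> smooth_on S (\<lambda>x. frechet_derivative f (at x) v)"
  unfolding smooth_on_def using Ck_on_Suc_deriv by blast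

lemma smooth_on_ident: "open S \<Longrightarrow> smooth_on S (\<lambda>x::'e::euclidean_space. x)"
  unfolding smooth_on_def
proof
  fix k assume "open S"
  show "Ck_on k S (\<lambda>x. x)"
    by (cases k) (use \<open>open S\<close> in \<open>auto simp: Ck_on_const\<close>)
qed

text \<open>Smooth coefficients, that is smoothness on constant vectors, imply smoothness on moving vectors.
  Metrics and derivatives are given by their coefficients but applied to fields.\<close>

lemma smooth_on_linear_family:
  fixes f :: "'d::euclidean_space \<Rightarrow> 'e::euclidean_space \<Rightarrow> 'b::real_normed_vector"
  assumes "open S" "\<And>x. x \<in> S \<Longrightarrow> linear (f x)" "\<And>v. smooth_on S (\<lambda>x. f x v)" "smooth_on S X"
  shows "smooth_on S (\<lambda>x. f x (X x))"
proof -
  have "smooth_on S (\<lambda>x. \<Sum>b\<in>Basis. (X x \<bullet> b) *\<^sub>R f x b)"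
    by (intro smooth_on_sum smooth_on_scaleR smooth_on_inner_left assms)
  moreover have "(\<Sum>b\<in>Basis. (X x \<bullet> b) *\<^sub>R f x b) = f x (X x)" if "x \<in> S" for x
    using linear_apply_basis[OF assms(2)[OF that]] by metis
  ultimately show ?thesis
    using smooth_on_cong[OF assms(1), of "\<lambda>x. \<Sum>b\<in>Basis. (X x \<bullet> b) *\<^sub>R f x b" "\<lambda>x. f x (X x)"] by simp
qed

lemma smooth_on_deriv_field:
  fixes f :: "'e::euclidean_space \<Rightarrow> 'b::real_normed_vector"
  assumes "open S" "smooth_on S f" "smooth_on S X"
  shows "smooth_on S (\<lambda>x. frechet_derivative f (at x) (X x))"
  by (rule smooth_on_linear_family[OF assms(1) smooth_on_frechet_linear[OF assms(2)]
        smooth_on_deriv[OF assms(2)] assms(3)])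

lemma smooth_on_bilinear_family:
  fixes B :: "'d::euclidean_space \<Rightarrow> 'e::euclidean_space \<Rightarrow> 'f::euclidean_space \<Rightarrow> real"
  assumes "open S" "\<And>x. x \<in> S \<Longrightarrow> bilinear (B x)" "\<And>v w. smooth_on S (\<lambda>x. B x v w)"
    and "smooth_on S X" "smooth_on S Y"
  shows "smooth_on S (\<lambda>x. B x (X x) (Y x))"
proof -
  have BX: "smooth_on S (\<lambda>x. B x (X x) w)" for w
    by (rule smooth_on_linear_family[of S "\<lambda>x v. B x v w", OF assms(1) _ assms(3,4)])
      (use assms(2) in \<open>simp add: bilinear_def\<close>)
  show ?thesis
    by (rule smooth_on_linear_family[of S "\<lambda>x. B x (X x)", OF assms(1) _ BX assms(5)])
      (use assms(2) in \<open>simp add: bilinear_def\<close>)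
qed

section \<open>Symmetry of second derivatives\<close>

text \<open>Both mixed derivatives are limits of the same second difference quotient, by two applications
  of the mean value theorem.\<close>

lemma second_difference_mean_value:
  fixes f :: "'e::euclidean_space \<Rightarrow> real"
  assumes sm: "smooth_on S f" and t: "0 < t"
    and inS: "\<And>\<sigma> \<tau>. 0 \<le> \<sigma> \<Longrightarrow> \<sigma> \<le> t \<Longrightarrow> 0 \<le> \<tau> \<Longrightarrow> \<tau> \<le> t \<Longrightarrow> x + \<sigma> *\<^sub>R u + \<tau> *\<^sub>R v \<in> S"
  shows "\<exists>\<sigma> \<tau>. 0 < \<sigma> \<and> \<sigma> < t \<and> 0 < \<tau> \<and> \<tau> < t \<and>
    f (x + t *\<^sub>R u + t *\<^sub>R v) - f (x + t *\<^sub>R u) - f (x + t *\<^sub>R v) + f x =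
    t * t * frechet_derivative (\<lambda>y. frechet_derivative f (at y) u) (at (x + \<sigma> *\<^sub>R u + \<tau> *\<^sub>R v)) v"
proof -
  let ?d = "\<lambda>y. frechet_derivative f (at y) u"
  have D: "((\<lambda>\<sigma>. h (y + \<sigma> *\<^sub>R w)) has_real_derivative frechet_derivative h (at (y + \<sigma> *\<^sub>R w)) w) (at \<sigma>)"
    if "smooth_on S h" "y + \<sigma> *\<^sub>R w \<in> S" for h :: "'e \<Rightarrow> real" and y w \<sigma>
  proof -
    have l: "linear (frechet_derivative h (at (y + \<sigma> *\<^sub>R w)))"
      using that smooth_on_frechet_linear by blast
    have "((\<lambda>\<sigma>. y + \<sigma> *\<^sub>R w) has_derivative (\<lambda>\<tau>. \<tau> *\<^sub>R w)) (at \<sigma>)"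
      by (auto intro!: derivative_eq_intros)
    from has_derivative_compose[OF this smooth_on_has_derivative[OF that]]
    show ?thesis unfolding has_field_derivative_def
      by (rule has_derivative_eq_rhs) (simp add: fun_eq_iff linear_scale[OF l])
  qed
  have D1: "((\<lambda>\<sigma>. f (x + \<sigma> *\<^sub>R u + t *\<^sub>R v) - f (x + \<sigma> *\<^sub>R u)) has_real_derivative
      ?d (x + \<sigma> *\<^sub>R u + t *\<^sub>R v) - ?d (x + \<sigma> *\<^sub>R u)) (at \<sigma>)" if "0 \<le> \<sigma>" "\<sigma> \<le> t" for \<sigma>
    using D[OF sm, of "x + t *\<^sub>R v" \<sigma> u] D[OF sm, of x \<sigma> u] inS[of \<sigma> t] inS[of \<sigma> 0] that t
    by (auto intro!: derivative_intros simp: add.assoc add.left_commute add.commute)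
  obtain \<sigma> where \<sigma>: "0 < \<sigma>" "\<sigma> < t" and e1:
    "(f (x + t *\<^sub>R u + t *\<^sub>R v) - f (x + t *\<^sub>R u)) - (f (x + 0 *\<^sub>R u + t *\<^sub>R v) - f (x + 0 *\<^sub>R u)) =
      (t - 0) * (?d (x + \<sigma> *\<^sub>R u + t *\<^sub>R v) - ?d (x + \<sigma> *\<^sub>R u))"
    using MVT2[OF t D1] by blast
  have D2: "((\<lambda>\<tau>. ?d (x + \<sigma> *\<^sub>R u + \<tau> *\<^sub>R v)) has_real_derivative
      frechet_derivative ?d (at (x + \<sigma> *\<^sub>R u + \<tau> *\<^sub>R v)) v) (at \<tau>)" if "0 \<le> \<tau>" "\<tau> \<le> t" for \<tau>
    using D[OF smooth_on_deriv[OF sm]] inS \<sigma> that by auto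
  obtain \<tau> where \<tau>: "0 < \<tau>" "\<tau> < t" and e2:
    "?d (x + \<sigma> *\<^sub>R u + t *\<^sub>R v) - ?d (x + \<sigma> *\<^sub>R u + 0 *\<^sub>R v) =
      (t - 0) * frechet_derivative ?d (at (x + \<sigma> *\<^sub>R u + \<tau> *\<^sub>R v)) v"
    using MVT2[OF t D2] by blast
  show ?thesis using e1 e2 \<sigma> \<tau> by (intro exI[of _ \<sigma>] exI[of _ \<tau>]) (simp add: algebra_simps)
qed

lemma second_derivative_symmetric_real:
  fixes f :: "'e::euclidean_space \<Rightarrow> real"
  assumes S: "open S" "x \<in> S" and sm: "smooth_on S f"
  shows "frechet_derivative (\<lambda>y. frechet_derivative f (at y) u) (at x) v =
    frechet_derivative (\<lambda>y. frechet_derivative f (at y) v) (at x) u"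
proof -
  let ?D = "\<lambda>u v y. frechet_derivative (\<lambda>y. frechet_derivative f (at y) u) (at y) v"
  have cont: "isCont (?D u v) x" for u v
    using smooth_on_deriv[OF smooth_on_deriv[OF sm]] S
    by (meson differentiable_imp_continuous_within smooth_on_differentiable)
  have small: "dist (x + \<sigma> *\<^sub>R u + \<tau> *\<^sub>R v) x < \<epsilon>"
    if t: "t < \<epsilon> / (norm u + norm v + 1)" and a: "0 \<le> \<sigma>" "\<sigma> \<le> t" "0 \<le> \<tau>" "\<tau> \<le> t"
    for \<epsilon> t \<sigma> \<tau> u v
  proof -
    have "dist (x + \<sigma> *\<^sub>R u + \<tau> *\<^sub>R v) x = norm (\<sigma> *\<^sub>R u + \<tau> *\<^sub>R v)"
      by (simp add: dist_norm algebra_simps)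
    also have "\<dots> \<le> \<sigma> * norm u + \<tau> * norm v"
      using norm_triangle_ineq[of "\<sigma> *\<^sub>R u" "\<tau> *\<^sub>R v"] a by simp
    also have "\<dots> \<le> t * norm u + t * norm v"
      using a by (intro add_mono mult_right_mono) auto
    also have "\<dots> \<le> t * (norm u + norm v + 1)" using a by (simp add: algebra_simps)
    also have "\<dots> < \<epsilon>" using t by (simp add: pos_less_divide_eq add_nonneg_pos)
    finally show ?thesis .
  qed
  have close: "\<bar>?D u v x - ?D v u x\<bar> < 2 * \<epsilon>" if eps: "\<epsilon> > 0" for \<epsilon>
  proof -
    obtain \<rho> where \<rho>: "\<rho> > 0" "ball x \<rho> \<subseteq> S" using S open_contains_ball by blast
    obtain \<delta>1 where \<delta>1: "\<delta>1 > 0" "\<And>y. dist y x < \<delta>1 \<Longrightarrow> \<bar>?D u v y - ?D u v x\<bar> < \<epsilon>"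
      using cont[of u v] eps unfolding continuous_at_eps_delta dist_real_def by blast
    obtain \<delta>2 where \<delta>2: "\<delta>2 > 0" "\<And>y. dist y x < \<delta>2 \<Longrightarrow> \<bar>?D v u y - ?D v u x\<bar> < \<epsilon>"
      using cont[of v u] eps unfolding continuous_at_eps_delta dist_real_def by blast
    define r where "r = min \<rho> (min \<delta>1 \<delta>2)"
    have r: "r > 0" using \<rho> \<delta>1 \<delta>2 by (simp add: r_def)
    \<comment> \<open>for such a \<open>t\<close> the whole parallelogram spanned by \<open>t u\<close> and \<open>t v\<close> is within distance \<open>r\<close> of \<open>x\<close>\<close>
    have P: "norm u + norm v + 1 > 0" by (simp add: add_nonneg_pos)
    obtain t where t: "t > 0" and t': "t < r / (norm u + norm v + 1)"
      using dense[OF divide_pos_pos[OF r P]] by blast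
    have t'': "t < r / (norm v + norm u + 1)" using t' by (simp add: add.commute)
    note du = small[OF t'] and dv = small[OF t'']
    have inS: "y \<in> S" if "dist y x < r" for y using that \<rho> by (auto simp: r_def dist_commute)
    obtain a where a: "dist a x < r" "f (x + t *\<^sub>R u + t *\<^sub>R v) - f (x + t *\<^sub>R u) - f (x + t *\<^sub>R v) + f x = t * t * ?D u v a"
      using second_difference_mean_value[OF sm t, of x u v] du inS by (meson less_imp_le)
    obtain b where b: "dist b x < r" "f (x + t *\<^sub>R v + t *\<^sub>R u) - f (x + t *\<^sub>R v) - f (x + t *\<^sub>R u) + f x = t * t * ?D v u b"
      using second_difference_mean_value[OF sm t, of x v u] dv inS by (meson less_imp_le)
    have "t * t * ?D u v a = t * t * ?D v u b"
      using a(2) b(2) by (simp add: algebra_simps)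
    then have "?D u v a = ?D v u b" using t by simp
    moreover have "\<bar>?D u v a - ?D u v x\<bar> < \<epsilon>" "\<bar>?D v u b - ?D v u x\<bar> < \<epsilon>"
      using \<delta>1(2)[of a] \<delta>2(2)[of b] a b by (auto simp: r_def)
    ultimately show ?thesis by linarith
  qed
  show ?thesis
  proof (rule ccontr)
    assume "\<not> ?thesis"
    then show False using close[of "\<bar>?D u v x - ?D v u x\<bar> / 2"] by auto
  qed
qed

lemma second_derivative_symmetric:
  fixes f :: "'e::euclidean_space \<Rightarrow> 'b::euclidean_space"
  assumes S: "open S" "x \<in> S" and sm: "smooth_on S f"
  shows "frechet_derivative (\<lambda>y. frechet_derivative f (at y) u) (at x) v =
    frechet_derivative (\<lambda>y. frechet_derivative f (at y) v) (at x) u"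
proof (rule euclidean_eqI)
  fix b :: 'b
  have A: "frechet_derivative h (at y) w \<bullet> b = frechet_derivative (\<lambda>z. h z \<bullet> b) (at y) w"
    if "smooth_on S h" "y \<in> S" for h :: "'e \<Rightarrow> 'b" and y w
    using frechet_derivative_at[OF bounded_linear.has_derivative[OF bounded_linear_inner_left
          smooth_on_has_derivative[OF that]]] by metis
  have E: "frechet_derivative (\<lambda>y. frechet_derivative f (at y) u) (at x) v \<bullet> b =
     frechet_derivative (\<lambda>y. frechet_derivative (\<lambda>z. f z \<bullet> b) (at y) u) (at x) v" for u v
  proof -
    have "frechet_derivative (\<lambda>y. frechet_derivative f (at y) u) (at x) v \<bullet> b =
      frechet_derivative (\<lambda>y. frechet_derivative f (at y) u \<bullet> b) (at x) v"
      by (rule A[OF smooth_on_deriv[OF sm] S(2)])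
    also have "frechet_derivative (\<lambda>y. frechet_derivative f (at y) u \<bullet> b) (at x) =
       frechet_derivative (\<lambda>y. frechet_derivative (\<lambda>z. f z \<bullet> b) (at y) u) (at x)"
      by (rule frechet_derivative_transform_within_open[OF _ S])
        (use A[OF sm] smooth_on_differentiable[OF smooth_on_inner_left[OF S(1) smooth_on_deriv[OF sm]] S(2)] in auto)
    finally show ?thesis .
  qed
  show "frechet_derivative (\<lambda>y. frechet_derivative f (at y) u) (at x) v \<bullet> b =
    frechet_derivative (\<lambda>y. frechet_derivative f (at y) v) (at x) u \<bullet> b"
    unfolding E by (rule second_derivative_symmetric_real[OF S smooth_on_inner_left[OF S(1) sm]])
qed

section \<open>Inner products and smooth orthogonal frames\<close>

locale inner_form =
  fixes b :: "'e::euclidean_space \<Rightarrow> 'e \<Rightarrow> real"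
  assumes bilin: "bilinear b" and sym: "b v w = b w v" and pos: "v \<noteq> 0 \<Longrightarrow> 0 < b v v"
begin

lemmas add_l = bilinear_ladd[OF bilin] and add_r = bilinear_radd[OF bilin]
  and scale_l = bilinear_lmul[OF bilin] and scale_r = bilinear_rmul[OF bilin]
  and diff_l = bilinear_lsub[OF bilin] and diff_r = bilinear_rsub[OF bilin]
  and neg_l = bilinear_lneg[OF bilin] and neg_r = bilinear_rneg[OF bilin]
  and zero_l [simp] = bilinear_lzero[OF bilin] and zero_r [simp] = bilinear_rzero[OF bilin]

lemma lin_r: "linear (b v)" and lin_l: "linear (\<lambda>w. b w v)"
  using bilin by (auto simp: bilinear_def)

lemma sum_l: "b (\<Sum>i\<in>I. f i) w = (\<Sum>i\<in>I. b (f i) w)"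
  by (rule linear_sum[OF lin_l])

lemma sum_r: "b w (\<Sum>i\<in>I. f i) = (\<Sum>i\<in>I. b w (f i))"
  by (rule linear_sum[OF lin_r])

lemma nonneg: "0 \<le> b v v"
  using pos[of v] by (cases "v = 0") auto

lemma eq_0_iff: "b v v = 0 \<longleftrightarrow> v = 0"
  using pos[of v] by (cases "v = 0") auto

lemma zero_on_span: "(\<And>d. d \<in> D \<Longrightarrow> b v d = 0) \<Longrightarrow> w \<in> span D \<Longrightarrow> b v w = 0"
  using linear_eq_0_on_span[OF lin_r] by blast

end

text \<open>Gram--Schmidt orthogonalisation with parameters; it involves only rational operations on the
  coefficients of the form, so that it preserves smoothness. A constant family gives the usual
  process in a single inner product space.\<close>

lemma smooth_orthogonal_frame:
  fixes B :: "'d::euclidean_space \<Rightarrow> 'e::euclidean_space \<Rightarrow> 'e \<Rightarrow> real"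
  assumes S: "open S" and B: "\<And>x. x \<in> S \<Longrightarrow> inner_form (B x)"
    and sm: "\<And>v w. smooth_on S (\<lambda>x. B x v w)"
    and "finite D" "independent D"
  shows "\<exists>e :: 'e \<Rightarrow> 'd \<Rightarrow> 'e. (\<forall>d\<in>D. smooth_on S (e d)) \<and>
    (\<forall>x\<in>S. (\<forall>d\<in>D. e d x \<noteq> 0) \<and> (\<forall>d\<in>D. \<forall>d'\<in>D. d \<noteq> d' \<longrightarrow> B x (e d x) (e d' x) = 0) \<and>
      span ((\<lambda>d. e d x) ` D) = span D)"
  using assms(4,5)
proof (induction D rule: finite_induct)
  case empty
  then show ?case by simp
next
  case (insert v D)
  have ind: "independent D" "v \<notin> span D"
    using insert.prems insert.hyps by (auto simp: independent_insert)
  obtain e where e: "\<forall>d\<in>D. smooth_on S (e d)"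
    and e2: "\<And>x. x \<in> S \<Longrightarrow> (\<forall>d\<in>D. e d x \<noteq> 0) \<and> (\<forall>d\<in>D. \<forall>d'\<in>D. d \<noteq> d' \<longrightarrow> B x (e d x) (e d' x) = 0) \<and>
      span ((\<lambda>d. e d x) ` D) = span D"
    using insert.IH[OF ind(1)] by blast
  define c where "c d x = B x v (e d x) / B x (e d x) (e d x)" for d x
  define n where "n x = v - (\<Sum>d\<in>D. c d x *\<^sub>R e d x)" for x
  have bil: "bilinear (B x)" if "x \<in> S" for x using B[OF that] by (simp add: inner_form_def)
  have smB: "smooth_on S (\<lambda>x. B x (X x) (Y x))" if "smooth_on S X" "smooth_on S Y" for X Y
    by (rule smooth_on_bilinear_family[OF S bil sm that])
  have nz: "B x (e d x) (e d x) \<noteq> 0" if "x \<in> S" "d \<in> D" for x d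
    using e2[OF that(1)] that inner_form.pos[OF B[OF that(1)], of "e d x"] by fastforce
  have smc: "smooth_on S (c d)" if "d \<in> D" for d
    unfolding c_def[abs_def] using smooth_on_divide[OF S nz[OF _ that] smB smB] e that smooth_on_const[OF S]
    by blast
  have smn: "smooth_on S n"
    unfolding n_def[abs_def]
    by (intro smooth_on_diff[OF S smooth_on_const[OF S]] smooth_on_sum[OF S] smooth_on_scaleR[OF S] smc)
      (use e in auto)
  have orth: "B x (n x) (e d x) = 0" if "x \<in> S" "d \<in> D" for x d
  proof -
    interpret inner_form "B x" using B[OF that(1)] .
    have "B x (n x) (e d x) = B x v (e d x) - (\<Sum>d'\<in>D. c d' x * B x (e d' x) (e d x))"
      by (simp add: n_def diff_l sum_l scale_l)
    also have "(\<Sum>d'\<in>D. c d' x * B x (e d' x) (e d x)) = (\<Sum>d'\<in>D. if d' = d then c d x * B x (e d x) (e d x) else 0)"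
      using e2[OF that(1)] that(2) by (intro sum.cong) auto
    also have "\<dots> = B x v (e d x)"
      using insert.hyps(1) that nz[OF that] by (simp add: c_def)
    finally show ?thesis by simp
  qed
  have rest: "(\<Sum>d\<in>D. c d x *\<^sub>R e d x) \<in> span D" if "x \<in> S" for x
  proof -
    have "(\<Sum>d\<in>D. c d x *\<^sub>R e d x) \<in> span ((\<lambda>d. e d x) ` D)"
      by (intro span_sum span_scale span_base) auto
    then show ?thesis using e2[OF that] by simp
  qed
  have n0: "n x \<noteq> 0" if "x \<in> S" for x
    using rest[OF that] ind(2) by (auto simp: n_def)
  have sp: "span (insert (n x) ((\<lambda>d. e d x) ` D)) = span (insert v D)" if "x \<in> S" for x
  proof -
    have "span (insert (n x) ((\<lambda>d. e d x) ` D)) = {w. \<exists>k. w - k *\<^sub>R n x \<in> span D}"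
      using e2[OF that] by (simp add: span_insert)
    also have "\<dots> = {w. \<exists>k. w - k *\<^sub>R v \<in> span D}"
    proof -
      have "w - k *\<^sub>R n x \<in> span D \<longleftrightarrow> w - k *\<^sub>R v \<in> span D" for w k
      proof -
        have "w - k *\<^sub>R n x = (w - k *\<^sub>R v) + k *\<^sub>R (\<Sum>d\<in>D. c d x *\<^sub>R e d x)"
          by (simp add: n_def algebra_simps)
        then show ?thesis using span_scale[OF rest[OF that], of k] by (metis span_add_eq2 )
      qed
      then show ?thesis by simp
    qed
    finally show ?thesis by (simp add: span_insert)
  qed
  let ?e = "e(v := n)"
  have im: "(\<lambda>d. ?e d x) ` insert v D = insert (n x) ((\<lambda>d. e d x) ` D)" for x
    using insert.hyps(2) by (auto simp: image_iff)
  have "\<forall>d\<in>insert v D. smooth_on S (?e d)" using smn e by auto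
  moreover have "(\<forall>d\<in>insert v D. ?e d x \<noteq> 0) \<and> (\<forall>d\<in>insert v D. \<forall>d'\<in>insert v D. d \<noteq> d' \<longrightarrow> B x (?e d x) (?e d' x) = 0) \<and>
      span ((\<lambda>d. ?e d x) ` insert v D) = span (insert v D)" if x: "x \<in> S" for x
    unfolding im sp[OF x] using e2[OF x] n0[OF x] orth[OF x] insert.hyps(2) inner_form.sym[OF B[OF x]]
    by auto
  ultimately show ?case by blast
qed

text \<open>The Riesz representation of a smooth family of linear forms is smooth: expand it in a smooth
  orthogonal frame.\<close>

lemma smooth_riesz:
  fixes B :: "'d::euclidean_space \<Rightarrow> 'e::euclidean_space \<Rightarrow> 'e \<Rightarrow> real"
  assumes S: "open S" and B: "\<And>x. x \<in> S \<Longrightarrow> inner_form (B x)"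
    and sm: "\<And>v w. smooth_on S (\<lambda>x. B x v w)"
    and y: "\<And>w. smooth_on S (\<lambda>x. B x (y x) w)"
  shows "smooth_on S y"
proof -
  obtain e :: "'e \<Rightarrow> 'd \<Rightarrow> 'e" where e: "\<forall>d\<in>Basis. smooth_on S (e d)"
    and e2: "\<And>x. x \<in> S \<Longrightarrow> (\<forall>d\<in>Basis. e d x \<noteq> 0) \<and>
      (\<forall>d\<in>Basis. \<forall>d'\<in>Basis. d \<noteq> d' \<longrightarrow> B x (e d x) (e d' x) = 0) \<and>
      span ((\<lambda>d. e d x) ` Basis) = span Basis"
    using smooth_orthogonal_frame[OF S B sm finite_Basis independent_Basis] by blast
  have bil: "bilinear (B x)" if "x \<in> S" for x using B[OF that] by (simp add: inner_form_def)
  have nz: "B x (e d x) (e d x) \<noteq> 0" if "x \<in> S" "d \<in> Basis" for x d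
    using e2[OF that(1)] that inner_form.pos[OF B[OF that(1)], of "e d x"] by fastforce
  have num: "smooth_on S (\<lambda>x. B x (y x) (e d x))" if "d \<in> Basis" for d
    by (rule smooth_on_linear_family[OF S inner_form.lin_r[OF B] y]) (use e that in auto)
  have den: "smooth_on S (\<lambda>x. B x (e d x) (e d x))" if "d \<in> Basis" for d
    by (rule smooth_on_bilinear_family[OF S bil sm]) (use e that in auto)
  have "smooth_on S (\<lambda>x. \<Sum>d\<in>Basis. (B x (y x) (e d x) / B x (e d x) (e d x)) *\<^sub>R e d x)"
    by (intro smooth_on_sum[OF S] smooth_on_scaleR[OF S] smooth_on_divide[OF S nz] num den)
      (use e in auto)
  moreover have "(\<Sum>d\<in>Basis. (B x (y x) (e d x) / B x (e d x) (e d x)) *\<^sub>R e d x) = y x" (is "?r = _") if x: "x \<in> S" for x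
  proof -
    interpret inner_form "B x" using B[OF x] .
    have "B x (?r - y x) (e d x) = 0" if d: "d \<in> Basis" for d
    proof -
      have "B x ?r (e d x) = (\<Sum>d'\<in>Basis. (B x (y x) (e d' x) / B x (e d' x) (e d' x)) * B x (e d' x) (e d x))"
        by (simp add: sum_l scale_l)
      also have "\<dots> = (\<Sum>d'\<in>Basis. if d' = d then B x (y x) (e d x) else 0)"
        using e2[OF x] d nz[OF x] by (intro sum.cong) auto
      also have "\<dots> = B x (y x) (e d x)" using d by simp
      finally show ?thesis by (simp add: diff_l)
    qed
    then have "B x (?r - y x) w = 0" for w
      using zero_on_span[of "(\<lambda>d. e d x) ` Basis" "?r - y x" w] e2[OF x] by auto
    then show ?thesis using eq_0_iff[of "?r - y x"] by simp
  qed
  ultimately show ?thesis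
    using smooth_on_cong[OF S, of "\<lambda>x. \<Sum>d\<in>Basis. (B x (y x) (e d x) / B x (e d x) (e d x)) *\<^sub>R e d x" y] by simp
qed

section \<open>Orthonormal bases and orthogonal projections\<close>

context inner_form
begin

lemma orthonormal_basis_exists:
  assumes "subspace W"
  shows "\<exists>B. orthonormal_basis b W B"
proof -
  obtain D where D: "D \<subseteq> W" "independent D" "span D = W" "finite D"
    using basis_exists[of W] assms
    by (metis finiteI_independent span_minimal span_mono span_subspace subset_antisym)
  obtain e :: "'e \<Rightarrow> real \<Rightarrow> 'e" where e: "\<forall>d\<in>D. e d 0 \<noteq> 0" "\<forall>d\<in>D. \<forall>d'\<in>D. d \<noteq> d' \<longrightarrow> b (e d 0) (e d' 0) = 0"
      "span ((\<lambda>d. e d 0) ` D) = W"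
    using smooth_orthogonal_frame[where S = UNIV and B = "\<lambda>x::real. b", OF open_UNIV inner_form_axioms
        smooth_on_const[OF open_UNIV] D(4,2)] D(3) by (metis UNIV_I)
  define f where "f d = (1 / sqrt (b (e d 0) (e d 0))) *\<^sub>R e d 0" for d
  have p: "0 < b (e d 0) (e d 0)" if "d \<in> D" for d using e(1) that pos by auto
  have f1: "b (f d) (f d) = 1" if "d \<in> D" for d
    using p[OF that] by (simp add: f_def scale_l scale_r)
  have f0: "b (f d) (f d') = 0" if "d \<in> D" "d' \<in> D" "d \<noteq> d'" for d d'
    using e(2) that by (simp add: f_def scale_l scale_r)
  have "span (f ` D) = W"
  proof -
    have "f ` D \<subseteq> span ((\<lambda>d. e d 0) ` D)"
      by (auto simp: f_def intro: span_scale span_base)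
    moreover have "e d 0 \<in> span (f ` D)" if "d \<in> D" for d
    proof -
      have "e d 0 = sqrt (b (e d 0) (e d 0)) *\<^sub>R f d" using p[OF that] by (simp add: f_def)
      then show ?thesis using that by (metis imageI span_base span_scale)
    qed
    ultimately show ?thesis using e(3)
      by (metis (no_types, lifting) image_subsetI span_minimal subset_antisym subspace_span)
  qed
  moreover have "\<forall>x\<in>f ` D. \<forall>y\<in>f ` D. b x y = (if x = y then 1 else 0)"
    using f1 f0 by (metis (no_types, lifting) imageE)
  ultimately show ?thesis using D(4) by (auto simp: orthonormal_basis_def)
qed

lemma onb_orthonormal: "subspace W \<Longrightarrow> orthonormal_basis b W (onb b W)"
  unfolding onb_def by (rule someI_ex) (rule orthonormal_basis_exists)

context
  fixes W B assumes onb: "orthonormal_basis b W B"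
begin

lemma finite_onb: "finite B" and span_onb: "span B = W"
  and onb_b: "x \<in> B \<Longrightarrow> y \<in> B \<Longrightarrow> b x y = (if x = y then 1 else 0)"
  using onb by (auto simp: orthonormal_basis_def)

lemma onb_subset: "x \<in> B \<Longrightarrow> x \<in> W"
  using span_onb span_base by blast

lemma sum_onb_b: "x \<in> B \<Longrightarrow> (\<Sum>y\<in>B. f y * b y x) = f x"
proof -
  assume x: "x \<in> B"
  have "(\<Sum>y\<in>B. f y * b y x) = (\<Sum>y\<in>B. if y = x then f x else 0)"
    using onb_b x by (intro sum.cong) auto
  then show ?thesis using x finite_onb by simp
qed

lemma onb_projection:
  "w \<in> W \<Longrightarrow> b (v - (\<Sum>x\<in>B. b v x *\<^sub>R x)) w = 0"
proof (rule zero_on_span[of B])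
  show "b (v - (\<Sum>x\<in>B. b v x *\<^sub>R x)) d = 0" if "d \<in> B" for d
    using sum_onb_b[OF that, of "b v"] by (simp add: diff_l sum_l scale_l)
qed (simp add: span_onb)

lemma onb_sum_in: "(\<Sum>x\<in>B. f x *\<^sub>R x) \<in> W"
  unfolding span_onb[symmetric] by (intro span_sum span_scale span_base)

lemma onb_expansion:
  assumes "v \<in> W"
  shows "v = (\<Sum>x\<in>B. b v x *\<^sub>R x)"
proof -
  have "v - (\<Sum>x\<in>B. b v x *\<^sub>R x) \<in> W"
    using onb_sum_in[of "b v"] assms span_diff[of v B] span_onb by auto
  then have "b (v - (\<Sum>x\<in>B. b v x *\<^sub>R x)) (v - (\<Sum>x\<in>B. b v x *\<^sub>R x)) = 0" by (rule onb_projection)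
  then show ?thesis using eq_0_iff[of "v - (\<Sum>x\<in>B. b v x *\<^sub>R x)"] by simp
qed

lemma parseval:
  assumes "v \<in> W"
  shows "b v v = (\<Sum>x\<in>B. (b v x)\<^sup>2)"
proof -
  have "b v v = b v (\<Sum>x\<in>B. b v x *\<^sub>R x)" using onb_expansion[OF assms] by simp
  then show ?thesis by (simp add: sum_r scale_r power2_eq_square)
qed

lemma bessel: "(\<Sum>x\<in>B. (b v x)\<^sup>2) \<le> b v v"
proof -
  let ?p = "\<Sum>x\<in>B. b v x *\<^sub>R x"
  have 1: "b (v - ?p) ?p = 0" using onb_projection onb_sum_in by blast
  have 2: "b v ?p = (\<Sum>x\<in>B. (b v x)\<^sup>2)" by (simp add: sum_r scale_r power2_eq_square)
  have "0 \<le> b (v - ?p) (v - ?p)" by (rule nonneg)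
  also have "\<dots> = b (v - ?p) v" using 1 by (simp add: diff_r)
  also have "\<dots> = b v v - b v ?p" by (simp add: diff_l sym[of ?p v])
  finally show ?thesis using 2 by simp
qed

lemma card_onb: "card B = dim W"
proof -
  have "independent B"
    unfolding independent_explicit_module
  proof safe
    fix t u v assume t: "finite t" "t \<subseteq> B" "(\<Sum>v\<in>t. u v *\<^sub>R v) = 0" and v: "v \<in> t"
    have "b (\<Sum>v\<in>t. u v *\<^sub>R v) v = (\<Sum>w\<in>t. u w * b w v)" by (simp add: sum_l scale_l)
    also have "\<dots> = (\<Sum>w\<in>t. if w = v then u v else 0)"
    proof (intro sum.cong refl)
      show "u w * b w v = (if w = v then u v else 0)" if "w \<in> t" for w
        using onb_b[of w v] subsetD[OF t(2) that] subsetD[OF t(2) v] by auto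
    qed
    also have "\<dots> = u v" using t v by simp
    finally show "u v = 0" using t by simp
  qed
  then show ?thesis using span_onb by (metis dim_eq_card dim_span_eq_card_independent)
qed

end

text \<open>Restriction to a smaller subspace decreases the Hilbert--Schmidt norm: apply Bessel's inequality
  to one argument at a time. Linearity in the second argument comes from skew symmetry.\<close>

lemma bilinear_square_sum_mono:
  assumes L: "orthonormal_basis b L B" and W: "orthonormal_basis b W C" and "L \<subseteq> W"
    and lin: "\<And>x y z k. x \<in> W \<Longrightarrow> y \<in> W \<Longrightarrow> z \<in> W \<Longrightarrow> \<alpha> (x + k *\<^sub>R y) z = \<alpha> x z + k * \<alpha> y z"
    and skew: "\<And>x y. x \<in> W \<Longrightarrow> y \<in> W \<Longrightarrow> \<alpha> x y = - \<alpha> y x"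
  shows "(\<Sum>x\<in>B. \<Sum>y\<in>B. (\<alpha> x y)\<^sup>2) \<le> (\<Sum>x\<in>C. \<Sum>y\<in>C. (\<alpha> x y :: real)\<^sup>2)"
proof -
  have W0: "0 \<in> W" using span_onb[OF W] span_0 by blast
  have z: "\<alpha> 0 y = 0" if "y \<in> W" for y using lin[OF W0 W0 that, of 1] by simp
  have sumlin: "(\<Sum>x\<in>I. f x *\<^sub>R x) \<in> W \<and> \<alpha> (\<Sum>x\<in>I. f x *\<^sub>R x) y = (\<Sum>x\<in>I. f x * \<alpha> x y)"
    if "finite I" "I \<subseteq> W" "y \<in> W" for I f y
    using that
  proof (induction I)
    case empty
    then show ?case using W0 z by simp
  next
    case (insert i I)
    then have "f i *\<^sub>R i \<in> W" using span_scale[of i C] span_onb[OF W] by auto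
    moreover have "\<alpha> ((\<Sum>x\<in>I. f x *\<^sub>R x) + f i *\<^sub>R i) y = (\<Sum>x\<in>I. f x * \<alpha> x y) + f i * \<alpha> i y"
      using insert lin by auto
    moreover have "(\<Sum>x\<in>I. f x *\<^sub>R x) \<in> W" using insert by simp
    ultimately show ?case using insert.hyps span_add[of "f i *\<^sub>R i" C "\<Sum>x\<in>I. f x *\<^sub>R x"] span_onb[OF W]
      by (simp add: add.commute)
  qed
  have CW: "C \<subseteq> W" using onb_subset[OF W] by blast
  have BW: "B \<subseteq> W" using onb_subset[OF L] \<open>L \<subseteq> W\<close> by blast
  have one: "(\<Sum>x\<in>B. (\<alpha> x y)\<^sup>2) \<le> (\<Sum>x\<in>C. (\<alpha> x y)\<^sup>2)" if y: "y \<in> W" for y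
  proof -
    let ?a = "\<Sum>x\<in>C. \<alpha> x y *\<^sub>R x"
    have rep: "b ?a x = \<alpha> x y" if "x \<in> W" for x
    proof -
      have "\<alpha> x y = \<alpha> (\<Sum>z\<in>C. b x z *\<^sub>R z) y" using onb_expansion[OF W that] by simp
      also have "\<dots> = (\<Sum>z\<in>C. b x z * \<alpha> z y)" using sumlin[OF finite_onb[OF W] CW y] by simp
      finally show ?thesis by (subst sym) (simp add: sum_r scale_r mult.commute)
    qed
    have "(\<Sum>x\<in>B. (\<alpha> x y)\<^sup>2) = (\<Sum>x\<in>B. (b ?a x)\<^sup>2)" using rep BW by (intro sum.cong) auto
    also have "\<dots> \<le> b ?a ?a" by (rule bessel[OF L])
    also have "\<dots> = (\<Sum>x\<in>C. (b ?a x)\<^sup>2)" by (rule parseval[OF W onb_sum_in[OF W]])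
    also have "\<dots> = (\<Sum>x\<in>C. (\<alpha> x y)\<^sup>2)" using rep CW by (intro sum.cong) auto
    finally show ?thesis .
  qed
  have sw: "(\<alpha> x y)\<^sup>2 = (\<alpha> y x)\<^sup>2" if "x \<in> W" "y \<in> W" for x y
    using skew[OF that] by (metis power2_minus)
  have "(\<Sum>x\<in>B. \<Sum>y\<in>B. (\<alpha> x y)\<^sup>2) = (\<Sum>x\<in>B. \<Sum>y\<in>B. (\<alpha> y x)\<^sup>2)"
    by (intro sum.cong refl sw) (use BW in auto)
  also have "\<dots> \<le> (\<Sum>x\<in>B. \<Sum>y\<in>C. (\<alpha> y x)\<^sup>2)"
    using one BW by (intro sum_mono) auto
  also have "\<dots> = (\<Sum>y\<in>C. \<Sum>x\<in>B. (\<alpha> y x)\<^sup>2)" by (rule sum.swap)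
  also have "\<dots> = (\<Sum>y\<in>C. \<Sum>x\<in>B. (\<alpha> x y)\<^sup>2)"
    by (intro sum.cong refl sw) (use BW CW in auto)
  also have "\<dots> \<le> (\<Sum>y\<in>C. \<Sum>x\<in>C. (\<alpha> x y)\<^sup>2)"
    using one CW by (intro sum_mono) auto
  also have "\<dots> = (\<Sum>x\<in>C. \<Sum>y\<in>C. (\<alpha> x y)\<^sup>2)" by (rule sum.swap)
  finally show ?thesis .
qed

end

text \<open>Linear algebra at each point separately. The vertical and the horizontal spaces are both
  instances.\<close>

locale distribution =
  fixes g :: "'a \<Rightarrow> 'e::euclidean_space \<Rightarrow> 'e \<Rightarrow> real" and D :: "'a \<Rightarrow> 'e set"
  assumes inner: "inner_form (g p)" and sub: "subspace (D p)"
begin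

sublocale inner_form "g p" for p
  by (rule inner)

lemma orth_projI:
  assumes "w \<in> D p" "\<And>u. u \<in> D p \<Longrightarrow> g p (v - w) u = 0"
  shows "orth_proj g D p v = w"
  unfolding orth_proj_def
proof (rule the_equality)
  fix w' assume w': "w' \<in> D p \<and> (\<forall>u\<in>D p. g p (v - w') u = 0)"
  have d: "w' - w \<in> D p" using assms w' sub subspace_diff by blast
  have "g p (w' - w) (w' - w) = g p (v - w) (w' - w) - g p (v - w') (w' - w)"
    by (simp add: diff_l)
  then have "g p (w' - w) (w' - w) = 0" using d assms w' by simp
  then show "w' = w" using eq_0_iff by simp
qed (use assms in auto)

lemma orth_proj_in: "orth_proj g D p v \<in> D p"
  and orth_proj_orth: "u \<in> D p \<Longrightarrow> g p (v - orth_proj g D p v) u = 0"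
proof -
  obtain B where B: "orthonormal_basis (g p) (D p) B" using orthonormal_basis_exists[OF sub] by blast
  let ?w = "\<Sum>x\<in>B. g p v x *\<^sub>R x"
  have "orth_proj g D p v = ?w"
    by (rule orth_projI[OF onb_sum_in[OF B] onb_projection[OF B]])
  then show "orth_proj g D p v \<in> D p" "u \<in> D p \<Longrightarrow> g p (v - orth_proj g D p v) u = 0"
    using onb_sum_in[OF B] onb_projection[OF B] by auto
qed

lemma orth_proj_fixed: "v \<in> D p \<Longrightarrow> orth_proj g D p v = v"
  by (rule orth_projI) auto

lemma orth_proj_eq_0: "(\<And>u. u \<in> D p \<Longrightarrow> g p v u = 0) \<Longrightarrow> orth_proj g D p v = 0"
  by (rule orth_projI) (use sub subspace_0 in auto)

lemma g_orth_proj: "u \<in> D p \<Longrightarrow> g p (orth_proj g D p v) u = g p v u"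
  using orth_proj_orth[of u p v] by (simp add: diff_l)

lemma orth_proj_linear: "linear (orth_proj g D p)"
proof (rule linearI)
  show "orth_proj g D p (v + w) = orth_proj g D p v + orth_proj g D p w" for v w
    by (rule orth_projI) (auto simp: orth_proj_in g_orth_proj diff_l add_l intro: subspace_add[OF sub])
  show "orth_proj g D p (k *\<^sub>R v) = k *\<^sub>R orth_proj g D p v" for k v
    by (rule orth_projI) (auto simp: orth_proj_in g_orth_proj diff_l scale_l intro: subspace_scale[OF sub])
qed

lemma orth_compl_distribution: "distribution g (orth_compl g D)"
proof (rule distribution.intro)
  show "inner_form (g p)" for p by (rule inner)
  show "subspace (orth_compl g D p)" for p
    by (auto simp: subspace_def orth_compl_def add_l scale_l)
qed

lemma in_orth_compl: "v \<in> orth_compl g D p \<Longrightarrow> u \<in> D p \<Longrightarrow> g p v u = 0"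
  by (simp add: orth_compl_def)

lemma orth_proj_compl: "orth_proj g (orth_compl g D) p v = v - orth_proj g D p v"
proof -
  interpret C: distribution g "orth_compl g D" by (rule orth_compl_distribution)
  show ?thesis
    by (rule C.orth_projI) (auto simp: orth_compl_def orth_proj_orth orth_proj_in sym[of p "orth_proj g D p v"])
qed

end

section \<open>Tangent vectors and vector fields in charts\<close>

lemma frechet_derivative_chain_local:
  assumes "open S" "x \<in> S" "\<And>y. y \<in> S \<Longrightarrow> f (g y) = h y"
    and "g differentiable at x" "f differentiable at (g x)"
  shows "frechet_derivative h (at x) v = frechet_derivative f (at (g x)) (frechet_derivative g (at x) v)"
proof -
  have d: "(f \<circ> g) differentiable at x" using assms(4,5) by (rule differentiable_chain_at)
  have "frechet_derivative (f \<circ> g) (at x) = frechet_derivative h (at x)"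
    by (rule frechet_derivative_transform_within_open[OF d assms(1,2)]) (simp add: assms(3))
  then show ?thesis using frechet_derivative_compose[OF assms(4,5)] by (metis comp_apply)
qed

locale smooth_mfd =
  fixes M :: "('a::{t2_space,second_countable_topology}, 'e::euclidean_space) manifold"
  assumes smooth_manifold: "smooth_manifold M"
begin

lemma chart_at: "chart_at M p \<in> charts M" "p \<in> chart_dom (chart_at M p)"
  using smooth_manifold by (auto simp: smooth_manifold_def)

context
  fixes c assumes c: "c \<in> charts M"
begin

lemma open_dom: "open (chart_dom c)" and open_img: "open (chart_img c)"
  and homeo: "homeomorphism (chart_dom c) (chart_img c) (chart_map c) (chart_inv c)"
  using smooth_manifold c by (auto simp: smooth_manifold_def)

lemma chart_inv_map: "q \<in> chart_dom c \<Longrightarrow> chart_inv c (chart_map c q) = q"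
  using homeo by (simp add: homeomorphism_def)

lemma chart_map_inv: "x \<in> chart_img c \<Longrightarrow> chart_map c (chart_inv c x) = x"
  and chart_inv_dom: "x \<in> chart_img c \<Longrightarrow> chart_inv c x \<in> chart_dom c"
  using homeo by (auto simp: homeomorphism_def)

lemma open_chart_image:
  assumes "open U" "U \<subseteq> chart_dom c"
  shows "open (chart_map c ` U)"
proof -
  have "chart_map c ` U = chart_img c \<inter> chart_inv c -` U"
    using assms(2) chart_inv_map chart_map_inv by force
  moreover have "continuous_on (chart_img c) (chart_inv c)"
    using homeo by (simp add: homeomorphism_def)
  ultimately show ?thesis
    using continuous_open_preimage[OF _ open_img assms(1)] by simp
qed

lemma transition_smooth:
  "d \<in> charts M \<Longrightarrow> smooth_on (chart_map c ` (chart_dom c \<inter> chart_dom d)) (chart_map d \<circ> chart_inv c)"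
  using smooth_manifold c by (auto simp: smooth_manifold_def)

lemma transition_differentiable:
  "d \<in> charts M \<Longrightarrow> q \<in> chart_dom c \<Longrightarrow> q \<in> chart_dom d \<Longrightarrow>
    (chart_map d \<circ> chart_inv c) differentiable at (chart_map c q)"
  using transition_smooth smooth_on_differentiable by blast

end

text \<open>The cocycle property of coordinate changes. That components in a chart and tangent vectors
  determine each other is the special case where the first and the last chart agree.\<close>

lemma transition_chain:
  assumes c: "c \<in> charts M" "q \<in> chart_dom c" and d: "d \<in> charts M" "q \<in> chart_dom d"
    and e: "e \<in> charts M" "q \<in> chart_dom e"
  shows "frechet_derivative (chart_map e \<circ> chart_inv d) (at (chart_map d q))
      (frechet_derivative (chart_map d \<circ> chart_inv c) (at (chart_map c q)) v) =
    frechet_derivative (chart_map e \<circ> chart_inv c) (at (chart_map c q)) v"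
proof -
  let ?U = "chart_dom c \<inter> chart_dom d \<inter> chart_dom e"
  have g: "(chart_map d \<circ> chart_inv c) (chart_map c q) = chart_map d q"
    using c chart_inv_map by simp
  have "frechet_derivative (chart_map e \<circ> chart_inv c) (at (chart_map c q)) v =
    frechet_derivative (chart_map e \<circ> chart_inv d) (at ((chart_map d \<circ> chart_inv c) (chart_map c q)))
      (frechet_derivative (chart_map d \<circ> chart_inv c) (at (chart_map c q)) v)"
  proof (rule frechet_derivative_chain_local)
    show "open (chart_map c ` ?U)"
      by (rule open_chart_image[OF c(1)]) (use open_dom[OF c(1)] open_dom[OF d(1)] open_dom[OF e(1)] in auto)
    show "chart_map c q \<in> chart_map c ` ?U" using c d e by blast
    show "(chart_map e \<circ> chart_inv d) ((chart_map d \<circ> chart_inv c) y) = (chart_map e \<circ> chart_inv c) y"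
      if "y \<in> chart_map c ` ?U" for y
      using that chart_inv_map[OF c(1)] chart_inv_map[OF d(1)] by auto
    show "(chart_map d \<circ> chart_inv c) differentiable at (chart_map c q)"
      by (rule transition_differentiable[OF c(1) d(1) c(2) d(2)])
    show "(chart_map e \<circ> chart_inv d) differentiable at ((chart_map d \<circ> chart_inv c) (chart_map c q))"
      unfolding g by (rule transition_differentiable[OF d(1) e(1) d(2) e(2)])
  qed
  then show ?thesis by (simp only: g)
qed

lemma transition_self:
  assumes c: "c \<in> charts M" "q \<in> chart_dom c"
  shows "frechet_derivative (chart_map c \<circ> chart_inv c) (at (chart_map c q)) v = v"
proof -
  have "frechet_derivative (\<lambda>x. x) (at (chart_map c q)) = frechet_derivative (chart_map c \<circ> chart_inv c) (at (chart_map c q))"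
    by (rule frechet_derivative_transform_within_open[OF _ open_img[OF c(1)]])
      (use c chart_map_inv in auto)
  then show ?thesis by (metis frechet_derivative_ident)
qed

lemma vec_of_chart_eq:
  "c \<in> charts M \<Longrightarrow> q \<in> chart_dom c \<Longrightarrow> vec_of_chart M c (chart_map c q) w =
    frechet_derivative (chart_map (chart_at M q) \<circ> chart_inv c) (at (chart_map c q)) w"
  by (simp add: vec_of_chart_def chart_inv_map)

lemma vec_in_of_chart:
  "c \<in> charts M \<Longrightarrow> q \<in> chart_dom c \<Longrightarrow> vec_in_chart M c q (vec_of_chart M c (chart_map c q) w) = w"
  by (simp add: vec_of_chart_eq vec_in_chart_def base_coord_def transition_chain transition_self chart_at)

lemma vec_of_in_chart:
  "c \<in> charts M \<Longrightarrow> q \<in> chart_dom c \<Longrightarrow> vec_of_chart M c (chart_map c q) (vec_in_chart M c q v) = v"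
  by (simp add: vec_of_chart_eq vec_in_chart_def base_coord_def transition_chain transition_self chart_at)

lemma vec_in_chart_of_other:
  assumes "c \<in> charts M" "q \<in> chart_dom c" "d \<in> charts M" "q \<in> chart_dom d"
  shows "vec_in_chart M d q (vec_of_chart M c (chart_map c q) w) =
    frechet_derivative (chart_map d \<circ> chart_inv c) (at (chart_map c q)) w"
  using assms by (simp add: vec_of_chart_eq vec_in_chart_def base_coord_def transition_chain chart_at)

lemma vec_of_chart_linear: "c \<in> charts M \<Longrightarrow> q \<in> chart_dom c \<Longrightarrow> linear (vec_of_chart M c (chart_map c q))"
  using linear_frechet_derivative[OF transition_differentiable[of c "chart_at M q" q]] chart_at
  unfolding linear_iff by (simp add: vec_of_chart_eq)

lemma vec_in_chart_linear: "c \<in> charts M \<Longrightarrow> q \<in> chart_dom c \<Longrightarrow> linear (vec_in_chart M c q)"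
  using linear_frechet_derivative[OF transition_differentiable[of "chart_at M q" c q]] chart_at
  by (simp add: vec_in_chart_def[abs_def] base_coord_def)

lemma vec_in_chart_at: "vec_in_chart M (chart_at M p) p v = v"
  by (simp add: vec_in_chart_def base_coord_def transition_self chart_at)

lemma vec_of_chart_at: "vec_of_chart M (chart_at M p) (base_coord M p) v = v"
  by (simp add: vec_of_chart_eq base_coord_def transition_self chart_at)

lemma base_coord_img: "base_coord M p \<in> chart_img (chart_at M p)"
  using chart_at by (simp add: base_coord_def)

lemma chart_inv_base: "chart_inv (chart_at M p) (base_coord M p) = p"
  by (simp add: base_coord_def chart_inv_map chart_at)

lemma field_in_chart_at: "field_in_chart M (chart_at M p) X (base_coord M p) = X p"
  by (simp add: field_in_chart_def chart_inv_base vec_in_chart_at)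

lemma vec_of_field_in_chart:
  assumes "c \<in> charts M" "x \<in> chart_img c"
  shows "vec_of_chart M c x (field_in_chart M c X x) = X (chart_inv c x)"
  using vec_of_in_chart[OF assms(1) chart_inv_dom[OF assms], of "X (chart_inv c x)"]
  by (simp add: field_in_chart_def chart_map_inv[OF assms])

section \<open>Smooth functions and smooth vector fields\<close>

lemma smooth_fieldI:
  "(\<And>c. c \<in> charts M \<Longrightarrow> smooth_on (chart_img c) (field_in_chart M c X)) \<Longrightarrow> smooth_field M X"
  by (simp add: smooth_field_def)

lemma smooth_fieldD:
  "smooth_field M X \<Longrightarrow> c \<in> charts M \<Longrightarrow> smooth_on (chart_img c) (field_in_chart M c X)"
  by (simp add: smooth_field_def)

lemma smooth_fun_const: "smooth_fun M (\<lambda>q. k)"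
  by (auto simp: smooth_fun_def o_def intro!: smooth_on_const open_img)

lemma smooth_field_add:
  assumes "smooth_field M X" "smooth_field M Y"
  shows "smooth_field M (\<lambda>q. X q + Y q)"
proof (rule smooth_fieldI)
  fix c assume c: "c \<in> charts M"
  have "field_in_chart M c (\<lambda>q. X q + Y q) x = field_in_chart M c X x + field_in_chart M c Y x" if "x \<in> chart_img c" for x
    using linear_add[OF vec_in_chart_linear[OF c chart_inv_dom[OF c that]]] by (simp add: field_in_chart_def)
  with smooth_on_add[OF open_img[OF c] smooth_fieldD[OF assms(1) c] smooth_fieldD[OF assms(2) c]]
  show "smooth_on (chart_img c) (field_in_chart M c (\<lambda>q. X q + Y q))"
    by (rule smooth_on_transform[OF _ open_img[OF c]])
qed

lemma smooth_field_scale: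
  assumes "smooth_fun M f" "smooth_field M X"
  shows "smooth_field M (\<lambda>q. f q *\<^sub>R X q)"
proof (rule smooth_fieldI)
  fix c assume c: "c \<in> charts M"
  have f: "smooth_on (chart_img c) (f \<circ> chart_inv c)" using assms(1) c by (simp add: smooth_fun_def)
  have "field_in_chart M c (\<lambda>q. f q *\<^sub>R X q) x = (f \<circ> chart_inv c) x *\<^sub>R field_in_chart M c X x" if "x \<in> chart_img c" for x
    using linear_scale[OF vec_in_chart_linear[OF c chart_inv_dom[OF c that]]] by (simp add: field_in_chart_def)
  with smooth_on_scaleR[OF open_img[OF c] f smooth_fieldD[OF assms(2) c]]
  show "smooth_on (chart_img c) (field_in_chart M c (\<lambda>q. f q *\<^sub>R X q))"
    by (rule smooth_on_transform[OF _ open_img[OF c]])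
qed

lemma smooth_field_scale_const: "smooth_field M X \<Longrightarrow> smooth_field M (\<lambda>q. k *\<^sub>R X q)"
  by (rule smooth_field_scale[OF smooth_fun_const])

lemma smooth_field_diff:
  assumes "smooth_field M X" "smooth_field M Y"
  shows "smooth_field M (\<lambda>q. X q - Y q)"
  using smooth_field_add[OF assms(1) smooth_field_scale_const[OF assms(2), of "-1"]] by simp

end

section \<open>Riemannian metrics in charts\<close>

locale riemannian_mfd = smooth_mfd M
  for M :: "('a::{t2_space,second_countable_topology}, 'e::euclidean_space) manifold" +
  fixes g :: "'a \<Rightarrow> 'e \<Rightarrow> 'e \<Rightarrow> real"
  assumes metric: "riemannian_metric M g"
begin

lemma inner: "inner_form (g p)"
  using metric by unfold_locales (auto simp: riemannian_metric_def)

sublocale inner_form "g p" for p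
  by (rule inner)

definition chart_metric :: "('a, 'e) chart \<Rightarrow> 'e \<Rightarrow> 'e \<Rightarrow> 'e \<Rightarrow> real" where
  "chart_metric c x v w = g (chart_inv c x) (vec_of_chart M c x v) (vec_of_chart M c x w)"

lemma chart_metric_smooth: "c \<in> charts M \<Longrightarrow> smooth_on (chart_img c) (\<lambda>x. chart_metric c x v w)"
  unfolding chart_metric_def using metric by (auto simp: riemannian_metric_def)

lemma chart_metric_inner:
  assumes c: "c \<in> charts M" and x: "x \<in> chart_img c"
  shows "inner_form (chart_metric c x)"
proof -
  have l: "linear (vec_of_chart M c x)"
    using vec_of_chart_linear[OF c chart_inv_dom[OF c x]] chart_map_inv[OF c x] by simp
  have inj: "vec_of_chart M c x v \<noteq> 0" if "v \<noteq> 0" for v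
    using vec_in_of_chart[OF c chart_inv_dom[OF c x], of v] vec_in_chart_linear[OF c chart_inv_dom[OF c x]]
      linear_0 that by (fastforce simp: chart_map_inv[OF c x])
  show ?thesis
  proof
    show "bilinear (chart_metric c x)"
      by (auto simp: bilinear_def chart_metric_def linear_add[OF l] linear_scale[OF l] add_l add_r scale_l scale_r
          intro!: linearI)
  qed (use inj pos sym in \<open>auto simp: chart_metric_def\<close>)
qed

text \<open>Raising an index: a field is smooth as soon as its metric dual is.\<close>

lemma smooth_field_riesz:
  assumes "\<And>c w. c \<in> charts M \<Longrightarrow>
    smooth_on (chart_img c) (\<lambda>x. g (chart_inv c x) (X (chart_inv c x)) (vec_of_chart M c x w))"
  shows "smooth_field M X"
proof (rule smooth_fieldI)
  fix c assume c: "c \<in> charts M"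
  show "smooth_on (chart_img c) (field_in_chart M c X)"
  proof (rule smooth_riesz[OF open_img[OF c] chart_metric_inner[OF c] chart_metric_smooth[OF c]])
    fix w
    have e: "chart_metric c x (field_in_chart M c X x) w = g (chart_inv c x) (X (chart_inv c x)) (vec_of_chart M c x w)"
      if "x \<in> chart_img c" for x
      by (simp add: chart_metric_def vec_of_field_in_chart[OF c that])
    show "smooth_on (chart_img c) (\<lambda>x. chart_metric c x (field_in_chart M c X x) w)"
      by (rule smooth_on_transform[OF assms[OF c] open_img[OF c] e])
  qed
qed

end

section \<open>Smooth extensions of tangent vectors\<close>

text \<open>The functions \<open>t\<^sup>-\<^sup>n e\<^sup>-\<^sup>1\<^sup>/\<^sup>t\<close>, extended by zero; the powers make the family closed under
  differentiation.\<close>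

definition flat_fun :: "nat \<Rightarrow> real \<Rightarrow> real" where
  "flat_fun n t = (if t > 0 then exp (- inverse t) * inverse t ^ n else 0)"

lemma flat_fun_has_derivative:
  "(flat_fun n has_real_derivative flat_fun (n + 2) t - real n * flat_fun (n + 1) t) (at t)"
proof -
  consider "t > 0" | "t < 0" | "t = 0" by linarith
  then show ?thesis
  proof cases
    case 1
    have e: "((\<lambda>t. exp (- inverse t) * inverse t ^ n) has_real_derivative
        flat_fun (n + 2) t - real n * flat_fun (n + 1) t) (at t)"
      using 1 by (cases n) (auto intro!: derivative_eq_intros simp: flat_fun_def algebra_simps power2_eq_square,
          metis One_nat_def gr0I mult.commute power_minus_mult)
    show ?thesis
      by (rule DERIV_cong_ev[THEN iffD1, OF refl _ refl e])
        (use 1 in \<open>auto simp: flat_fun_def eventually_nhds intro!: exI[of _ "{0<..}"]\<close>)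
  next
    case 2
    show ?thesis
      by (rule DERIV_cong_ev[THEN iffD1, OF refl _ refl, of "\<lambda>_. 0"])
        (use 2 in \<open>auto simp: flat_fun_def eventually_nhds intro!: exI[of _ "{..<0}"]\<close>)
  next
    case 3
    \<comment> \<open>from the right, substitute \<open>x = 1 / h\<close> in \<open>x\<^sup>n\<^sup>+\<^sup>1 e\<^sup>-\<^sup>x \<longlongrightarrow> 0\<close>\<close>
    have r: "((\<lambda>h. flat_fun n h / h) \<longlongrightarrow> 0) (at_right 0)"
    proof -
      have "((\<lambda>h::real. inverse h ^ (n + 1) / exp (inverse h)) \<longlongrightarrow> 0) (at_right 0)"
        using filterlim_compose[OF tendsto_power_div_exp_0 filterlim_inverse_at_top_right] .
      then have "((\<lambda>h::real. exp (- inverse h) * inverse h ^ n / h) \<longlongrightarrow> 0) (at_right 0)"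
        by (simp add: exp_minus divide_inverse mult_ac)
      then show ?thesis
        by (rule Lim_transform_eventually) (auto simp: flat_fun_def eventually_at_filter)
    qed
    moreover have "((\<lambda>h. flat_fun n h / h) \<longlongrightarrow> 0) (at_left 0)"
      by (rule Lim_transform_eventually[OF tendsto_const]) (auto simp: flat_fun_def eventually_at_filter)
    ultimately have "((\<lambda>h. flat_fun n h / h) \<longlongrightarrow> 0) (at 0)" by (simp add: filterlim_split_at)
    then show ?thesis unfolding 3 by (simp add: has_field_derivative_iff flat_fun_def[of _ 0])
  qed
qed

lemma Ck_on_flat_fun: "Ck_on k UNIV (flat_fun n)"
proof (induction k arbitrary: n)
  case 0
  show ?case using flat_fun_has_derivative DERIV_isCont continuous_at_imp_continuous_on by (metis Ck_on.simps(1))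
next
  case (Suc k)
  have L: "Ck_on k UNIV (\<lambda>t. a * flat_fun m t)" for a m
    using Ck_on_linear[OF bounded_linear_mult_right open_UNIV Suc.IH] .
  have "Ck_on k UNIV (\<lambda>t. (1 * flat_fun (n + 2) t + (- real n) * flat_fun (n + 1) t))"
    by (intro Ck_on_add L open_UNIV)
  then have "Ck_on k UNIV (\<lambda>t. (flat_fun (n + 2) t - real n * flat_fun (n + 1) t))" by simp
  then have "Ck_on k UNIV (\<lambda>t. (flat_fun (n + 2) t - real n * flat_fun (n + 1) t) * v)" for v
    by (rule Ck_on_linear[OF bounded_linear_mult_left open_UNIV])
  then show ?case
    by (intro Ck_on_SucI[OF open_UNIV flat_fun_has_derivative[unfolded has_field_derivative_def]])
qed

lemma smooth_bump:
  fixes x0 :: "'e::euclidean_space"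
  assumes "r > 0"
  shows "\<exists>\<psi> :: 'e \<Rightarrow> real. smooth_on UNIV \<psi> \<and> \<psi> x0 = 1 \<and> (\<forall>x. x \<notin> cball x0 r \<longrightarrow> \<psi> x = 0)"
proof -
  \<comment> \<open>the factor normalises the value at the centre to 1\<close>
  define \<psi> where "\<psi> x = exp (1 / r\<^sup>2) * flat_fun 0 (r\<^sup>2 - (x - x0) \<bullet> (x - x0))" for x
  have c: "smooth_on UNIV (\<lambda>x. r\<^sup>2 - (x - x0) \<bullet> (x - x0))"
  proof -
    have "smooth_on UNIV (\<lambda>x. x - x0)"
      by (intro smooth_on_diff smooth_on_ident smooth_on_const open_UNIV)
    then have "smooth_on UNIV (\<lambda>x. (x - x0) \<bullet> (x - x0))"
      unfolding smooth_on_def using bounded_bilinear.Ck_on_prod[OF bounded_bilinear_inner open_UNIV] by blast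
    then show ?thesis by (intro smooth_on_diff smooth_on_const open_UNIV)
  qed
  have "smooth_on UNIV (\<lambda>x. flat_fun 0 (r\<^sup>2 - (x - x0) \<bullet> (x - x0)))"
    by (rule smooth_on_compose[OF open_UNIV open_UNIV _ _ c]) (auto simp: smooth_on_def Ck_on_flat_fun)
  then have "smooth_on UNIV \<psi>"
    unfolding \<psi>_def[abs_def] by (intro smooth_on_mult smooth_on_const open_UNIV)
  moreover have "\<psi> x0 = 1"
    using assms by (simp add: \<psi>_def flat_fun_def exp_minus inverse_eq_divide)
  moreover have "\<psi> x = 0" if "x \<notin> cball x0 r" for x
  proof -
    have "r \<le> norm (x - x0)" using that by (simp add: dist_norm norm_minus_commute)
    then have "r\<^sup>2 \<le> (x - x0) \<bullet> (x - x0)" using assms by (simp add: power_mono flip: power2_norm_eq_inner)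
    then show ?thesis by (simp add: \<psi>_def flat_fun_def)
  qed
  ultimately show ?thesis by blast
qed

context smooth_mfd
begin

text \<open>Cut off a constant field in a chart by a bump function. Its support is compact, hence closed in
  the manifold because the latter is Hausdorff, so that the extension by zero is smooth.\<close>

lemma smooth_extension_exists: "\<exists>X. smooth_field M X \<and> X p = v"
proof -
  let ?c = "chart_at M p" and ?x0 = "base_coord M p"
  note c = chart_at(1)[of p]
  obtain r where r: "r > 0" "cball ?x0 r \<subseteq> chart_img ?c"
    using open_img[OF c] base_coord_img open_contains_cball by blast
  obtain \<psi> :: "'e \<Rightarrow> real" where \<psi>: "smooth_on UNIV \<psi>" "\<psi> ?x0 = 1" "\<And>x. x \<notin> cball ?x0 r \<Longrightarrow> \<psi> x = 0"
    using smooth_bump[OF r(1)] by blast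
  define X where "X q = (if q \<in> chart_dom ?c then \<psi> (chart_map ?c q) *\<^sub>R vec_of_chart M ?c (chart_map ?c q) v else 0)" for q
  define K where "K = chart_inv ?c ` cball ?x0 r"
  have "compact K"
    unfolding K_def using homeo[OF c] r(2)
    by (intro compact_continuous_image) (auto simp: homeomorphism_def intro: continuous_on_subset)
  then have "closed K" by (rule compact_imp_closed)
  have X0: "X q = 0" if "q \<notin> K" for q
  proof (cases "q \<in> chart_dom ?c")
    case True
    then have "chart_map ?c q \<notin> cball ?x0 r"
      using that chart_inv_map[OF c True] unfolding K_def by (metis imageI)
    then show ?thesis using \<psi>(3) by (simp add: X_def)
  qed (simp add: X_def)
  have "smooth_field M X"
  proof (rule smooth_fieldI)
    fix d assume d: "d \<in> charts M"
    show "smooth_on (chart_img d) (field_in_chart M d X)"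
    proof (rule smooth_on_local)
      fix x assume x: "x \<in> chart_img d"
      let ?q = "chart_inv d x"
      note q = chart_inv_dom[OF d x]
      show "\<exists>T. open T \<and> x \<in> T \<and> smooth_on T (field_in_chart M d X)"
      proof (cases "?q \<in> chart_dom ?c")
        case True
        let ?T = "chart_map d ` (chart_dom d \<inter> chart_dom ?c)"
        let ?S = "chart_map ?c ` (chart_dom ?c \<inter> chart_dom d)"
        let ?t = "\<lambda>y. (chart_map ?c \<circ> chart_inv d) y"
        have T: "open ?T" by (rule open_chart_image[OF d]) (use open_dom[OF c] open_dom[OF d] in auto)
        have S: "open ?S" by (rule open_chart_image[OF c]) (use open_dom[OF c] open_dom[OF d] in auto)
        have xT: "x \<in> ?T" using True q chart_map_inv[OF d x] by (metis IntI imageI)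
        have tS: "?t ` ?T \<subseteq> ?S" using chart_inv_map[OF d] by auto
        have t: "smooth_on ?T ?t" using transition_smooth[OF d c] by (simp add: comp_def)
        have "smooth_on ?T (\<lambda>y. \<psi> (?t y) *\<^sub>R frechet_derivative (chart_map d \<circ> chart_inv ?c) (at (?t y)) v)"
          by (intro smooth_on_scaleR[OF T] smooth_on_compose[OF T open_UNIV _ \<psi>(1) t]
              smooth_on_compose[OF T S tS smooth_on_deriv[OF transition_smooth[OF c d]] t]) auto
        moreover have "field_in_chart M d X y = \<psi> (?t y) *\<^sub>R frechet_derivative (chart_map d \<circ> chart_inv ?c) (at (?t y)) v"
          if "y \<in> ?T" for y
        proof -
          obtain q where q: "q \<in> chart_dom d" "q \<in> chart_dom ?c" "y = chart_map d q" using \<open>y \<in> ?T\<close> by blast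
          show ?thesis
            using q vec_in_chart_of_other[OF c q(2) d q(1)] linear_scale[OF vec_in_chart_linear[OF d q(1)]]
            by (simp add: field_in_chart_def X_def chart_inv_map[OF d])
        qed
        ultimately have "smooth_on ?T (field_in_chart M d X)"
          by (rule smooth_on_transform[OF _ T])
        then show ?thesis using T xT by blast
      next
        case False
        let ?T = "chart_map d ` (chart_dom d - K)"
        have T: "open ?T" by (rule open_chart_image[OF d]) (use open_dom[OF d] \<open>closed K\<close> in auto)
        have "?q \<notin> K" using False r(2) chart_inv_dom[OF c] by (auto simp: K_def)
        then have xT: "x \<in> ?T" using q chart_map_inv[OF d x] by (metis DiffI imageI)
        have "field_in_chart M d X y = 0" if "y \<in> ?T" for y
        proof -
          obtain q where q: "q \<in> chart_dom d" "q \<notin> K" "y = chart_map d q" using \<open>y \<in> ?T\<close> by blast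
          then show ?thesis
            using linear_0[OF vec_in_chart_linear[OF d q(1)]] X0[OF q(2)]
            by (simp add: field_in_chart_def chart_inv_map[OF d])
        qed
        then have "smooth_on ?T (field_in_chart M d X)"
          by (rule smooth_on_transform[OF smooth_on_const[OF T] T])
        then show ?thesis using T xT by blast
      qed
    qed
  qed
  moreover have "X p = v"
    using chart_at(2)[of p] \<psi>(2) vec_of_chart_at[of p v] by (simp add: X_def base_coord_def)
  ultimately show ?thesis by blast
qed

end

section \<open>Derivatives of fields pushed forward by a map\<close>

text \<open>The product rule \<open>D(Df X) u = Df(DX u) + D\<^sup>2f(u, X)\<close>. The last summand is written as the
  derivative of \<open>Df\<close> applied to the vector \<open>X x\<close> held fixed, which is the form in which the symmetry
  of second derivatives applies.\<close>

lemma frechet_derivative_deriv_field: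
  fixes f :: "'e::euclidean_space \<Rightarrow> 'b::real_normed_vector"
  assumes S: "open S" "x \<in> S" and f: "smooth_on S f" and X: "smooth_on S X"
  shows "frechet_derivative (\<lambda>y. frechet_derivative f (at y) (X y)) (at x) u =
    frechet_derivative f (at x) (frechet_derivative X (at x) u) +
    frechet_derivative (\<lambda>y. frechet_derivative f (at y) (X x)) (at x) u"
proof -
  let ?D = "\<lambda>b y. frechet_derivative f (at y) b"
  note lin = smooth_on_frechet_linear[OF f]
  have dX: "(X has_derivative frechet_derivative X (at x)) (at x)"
    by (rule smooth_on_has_derivative[OF X S(2)])
  have dD: "(?D b has_derivative frechet_derivative (?D b) (at x)) (at x)" for b
    by (rule smooth_on_has_derivative[OF smooth_on_deriv[OF f] S(2)])
  have "((\<lambda>y. \<Sum>b\<in>Basis. (X y \<bullet> b) *\<^sub>R ?D b y) has_derivative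
    (\<lambda>u. \<Sum>b\<in>Basis. (X x \<bullet> b) *\<^sub>R frechet_derivative (?D b) (at x) u + (frechet_derivative X (at x) u \<bullet> b) *\<^sub>R ?D b x)) (at x)"
    by (intro has_derivative_sum has_derivative_scaleR has_derivative_inner_left dX dD)
  then have "((\<lambda>y. frechet_derivative f (at y) (X y)) has_derivative
    (\<lambda>u. \<Sum>b\<in>Basis. (X x \<bullet> b) *\<^sub>R frechet_derivative (?D b) (at x) u + (frechet_derivative X (at x) u \<bullet> b) *\<^sub>R ?D b x)) (at x)"
    by (rule has_derivative_transform_within_open[OF _ S]) (rule linear_apply_basis[OF lin, symmetric])
  then have 1: "frechet_derivative (\<lambda>y. frechet_derivative f (at y) (X y)) (at x) u =
     (\<Sum>b\<in>Basis. (X x \<bullet> b) *\<^sub>R frechet_derivative (?D b) (at x) u) + (\<Sum>b\<in>Basis. (frechet_derivative X (at x) u \<bullet> b) *\<^sub>R ?D b x)"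
    by (simp add: frechet_derivative_at[symmetric] sum.distrib)
  have "((\<lambda>y. \<Sum>b\<in>Basis. (X x \<bullet> b) *\<^sub>R ?D b y) has_derivative
    (\<lambda>u. \<Sum>b\<in>Basis. (X x \<bullet> b) *\<^sub>R frechet_derivative (?D b) (at x) u)) (at x)"
    by (intro has_derivative_sum has_derivative_scaleR_right dD)
  then have "((\<lambda>y. frechet_derivative f (at y) (X x)) has_derivative
    (\<lambda>u. \<Sum>b\<in>Basis. (X x \<bullet> b) *\<^sub>R frechet_derivative (?D b) (at x) u)) (at x)"
    by (rule has_derivative_transform_within_open[OF _ S]) (rule linear_apply_basis[OF lin, symmetric])
  then have 2: "frechet_derivative (\<lambda>y. frechet_derivative f (at y) (X x)) (at x) u =
     (\<Sum>b\<in>Basis. (X x \<bullet> b) *\<^sub>R frechet_derivative (?D b) (at x) u)"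
    by (simp add: frechet_derivative_at[symmetric])
  show ?thesis unfolding 1 2
    using linear_apply_basis[OF lin[OF S(2)], of "frechet_derivative X (at x) u"] by simp
qed

lemma bilinear_apply_basis:
  fixes B :: "'e::euclidean_space \<Rightarrow> 'e \<Rightarrow> real"
  assumes "bilinear B"
  shows "B v w = (\<Sum>i\<in>Basis. \<Sum>j\<in>Basis. (v \<bullet> i) * ((w \<bullet> j) * B i j))"
proof -
  have "B v w = (\<Sum>i\<in>Basis. (v \<bullet> i) * B i w)"
    using linear_apply_basis[of "\<lambda>v. B v w" v] assms by (simp add: bilinear_def)
  also have "\<dots> = (\<Sum>i\<in>Basis. (v \<bullet> i) * (\<Sum>j\<in>Basis. (w \<bullet> j) * B i j))"
  proof (intro sum.cong refl)
    fix i
    show "(v \<bullet> i) * B i w = (v \<bullet> i) * (\<Sum>j\<in>Basis. (w \<bullet> j) * B i j)"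
      using linear_apply_basis[of "B i" w] assms by (simp add: bilinear_def)
  qed
  finally show ?thesis by (simp add: sum_distrib_left)
qed

text \<open>If the coefficients of a family of forms are stationary in the direction \<open>u\<close>, only the
  arguments contribute to the derivative.\<close>

lemma frechet_derivative_stationary_form:
  fixes B :: "'d::euclidean_space \<Rightarrow> 'e::euclidean_space \<Rightarrow> 'e \<Rightarrow> real"
  assumes S: "open S" "x \<in> S" and bil: "\<And>y. y \<in> S \<Longrightarrow> bilinear (B y)"
    and dB: "\<And>v w. ((\<lambda>y. B y v w) has_derivative B' v w) (at x)" and "\<And>v w. B' v w u = 0"
    and \<xi>: "(\<xi> has_derivative \<xi>') (at x)"
  shows "frechet_derivative (\<lambda>y. B y (\<xi> y) (\<xi> y)) (at x) u = B x (\<xi>' u) (\<xi> x) + B x (\<xi> x) (\<xi>' u)"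
proof -
  have "((\<lambda>y. \<Sum>i\<in>Basis. \<Sum>j\<in>Basis. (\<xi> y \<bullet> i) * ((\<xi> y \<bullet> j) * B y i j)) has_derivative
      (\<lambda>u. \<Sum>i\<in>Basis. \<Sum>j\<in>Basis. (\<xi> x \<bullet> i) * ((\<xi> x \<bullet> j) * B' i j u + (\<xi>' u \<bullet> j) * B x i j) +
        (\<xi>' u \<bullet> i) * ((\<xi> x \<bullet> j) * B x i j))) (at x)"
    by (intro has_derivative_sum has_derivative_mult has_derivative_inner_left \<xi> dB)
  then have "((\<lambda>y. B y (\<xi> y) (\<xi> y)) has_derivative
      (\<lambda>u. \<Sum>i\<in>Basis. \<Sum>j\<in>Basis. (\<xi> x \<bullet> i) * ((\<xi> x \<bullet> j) * B' i j u + (\<xi>' u \<bullet> j) * B x i j) +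
        (\<xi>' u \<bullet> i) * ((\<xi> x \<bullet> j) * B x i j))) (at x)"
    by (rule has_derivative_transform_within_open[OF _ S]) (rule bilinear_apply_basis[OF bil, symmetric])
  then have "frechet_derivative (\<lambda>y. B y (\<xi> y) (\<xi> y)) (at x) u =
      (\<Sum>i\<in>Basis. \<Sum>j\<in>Basis. (\<xi> x \<bullet> i) * ((\<xi>' u \<bullet> j) * B x i j)) +
      (\<Sum>i\<in>Basis. \<Sum>j\<in>Basis. (\<xi>' u \<bullet> i) * ((\<xi> x \<bullet> j) * B x i j))"
    using assms(5) by (simp add: frechet_derivative_at[symmetric] sum.distrib)
  then show ?thesis
    using bilinear_apply_basis[OF bil[OF S(2)], of "\<xi>' u" "\<xi> x"]
      bilinear_apply_basis[OF bil[OF S(2)], of "\<xi> x" "\<xi>' u"] by simp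
qed

section \<open>Riemannian submersions\<close>

locale riem_submersion =
  fixes M :: "('a::{t2_space,second_countable_topology}, 'e::euclidean_space) manifold"
    and N :: "('b::{t2_space,second_countable_topology}, 'f::euclidean_space) manifold"
    and g :: "'a \<Rightarrow> 'e \<Rightarrow> 'e \<Rightarrow> real" and h :: "'b \<Rightarrow> 'f \<Rightarrow> 'f \<Rightarrow> real" and F :: "'a \<Rightarrow> 'b"
  assumes submersion: "riemannian_submersion M N g h F"
begin

sublocale M: riemannian_mfd M g
  using submersion by unfold_locales (auto simp: riemannian_submersion_def)

sublocale N: riemannian_mfd N h
  using submersion by unfold_locales (auto simp: riemannian_submersion_def)

abbreviation V :: "'a \<Rightarrow> 'e set" where "V \<equiv> vertical M N F"
abbreviation H :: "'a \<Rightarrow> 'e set" where "H \<equiv> orth_compl g V"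
abbreviation T :: "'a \<Rightarrow> 'e \<Rightarrow> 'f" where "T \<equiv> tangent_map M N F"

text \<open>Coordinate expression of \<open>F\<close>, and the set on which it is meaningful.\<close>

definition coord_rep :: "('a, 'e) chart \<Rightarrow> ('b, 'f) chart \<Rightarrow> 'e \<Rightarrow> 'f" where
  "coord_rep c d = chart_map d \<circ> F \<circ> chart_inv c"

definition coord_rep_dom :: "('a, 'e) chart \<Rightarrow> ('b, 'f) chart \<Rightarrow> 'e set" where
  "coord_rep_dom c d = chart_map c ` (chart_dom c \<inter> F -` chart_dom d)"

lemma smooth_F: "smooth_map M N F"
  using submersion by (simp add: riemannian_submersion_def)

lemma coord_rep_smooth: "c \<in> charts M \<Longrightarrow> d \<in> charts N \<Longrightarrow> smooth_on (coord_rep_dom c d) (coord_rep c d)"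
  using smooth_F by (simp add: smooth_map_def coord_rep_def coord_rep_dom_def)

lemma open_F_vimage: "open U \<Longrightarrow> open (F -` U)"
  using smooth_F continuous_open_vimage[of U F] by (auto simp: smooth_map_def continuous_on_open_vimage)

lemma open_rep_dom: "c \<in> charts M \<Longrightarrow> d \<in> charts N \<Longrightarrow> open (coord_rep_dom c d)"
  unfolding coord_rep_dom_def
  by (rule M.open_chart_image) (auto intro!: open_Int M.open_dom open_F_vimage N.open_dom)

lemma coord_rep_differentiable:
  "c \<in> charts M \<Longrightarrow> d \<in> charts N \<Longrightarrow> q \<in> chart_dom c \<Longrightarrow> F q \<in> chart_dom d \<Longrightarrow>
    coord_rep c d differentiable at (chart_map c q)"
  by (rule smooth_on_differentiable[OF coord_rep_smooth]) (auto simp: coord_rep_dom_def)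

lemma coord_rep_map: "c \<in> charts M \<Longrightarrow> q \<in> chart_dom c \<Longrightarrow> coord_rep c d (chart_map c q) = chart_map d (F q)"
  by (simp add: coord_rep_def M.chart_inv_map)

lemma coord_rep_chain_domain:
  assumes c: "c \<in> charts M" "q \<in> chart_dom c" and c': "c' \<in> charts M" "q \<in> chart_dom c'"
    and d: "d \<in> charts N" "F q \<in> chart_dom d"
  shows "frechet_derivative (coord_rep c' d) (at (chart_map c' q))
      (frechet_derivative (chart_map c' \<circ> chart_inv c) (at (chart_map c q)) v) =
    frechet_derivative (coord_rep c d) (at (chart_map c q)) v"
proof -
  let ?U = "chart_dom c \<inter> chart_dom c' \<inter> F -` chart_dom d"
  have g: "(chart_map c' \<circ> chart_inv c) (chart_map c q) = chart_map c' q"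
    using c M.chart_inv_map by simp
  have "frechet_derivative (coord_rep c d) (at (chart_map c q)) v =
    frechet_derivative (coord_rep c' d) (at ((chart_map c' \<circ> chart_inv c) (chart_map c q)))
      (frechet_derivative (chart_map c' \<circ> chart_inv c) (at (chart_map c q)) v)"
  proof (rule frechet_derivative_chain_local)
    show "open (chart_map c ` ?U)"
      by (rule M.open_chart_image[OF c(1)])
        (use M.open_dom[OF c(1)] M.open_dom[OF c'(1)] open_F_vimage[OF N.open_dom[OF d(1)]] in auto)
    show "chart_map c q \<in> chart_map c ` ?U" using c c' d by blast
    show "coord_rep c' d ((chart_map c' \<circ> chart_inv c) y) = coord_rep c d y" if "y \<in> chart_map c ` ?U" for y
      using that M.chart_inv_map[OF c(1)] M.chart_inv_map[OF c'(1)] by (auto simp: coord_rep_def)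
    show "(chart_map c' \<circ> chart_inv c) differentiable at (chart_map c q)"
      by (rule M.transition_differentiable[OF c(1) c'(1) c(2) c'(2)])
    show "coord_rep c' d differentiable at ((chart_map c' \<circ> chart_inv c) (chart_map c q))"
      unfolding g by (rule coord_rep_differentiable[OF c'(1) d(1) c'(2) d(2)])
  qed
  then show ?thesis by (simp only: g)
qed

lemma coord_rep_chain_codomain:
  assumes c: "c \<in> charts M" "q \<in> chart_dom c" and d: "d \<in> charts N" "F q \<in> chart_dom d"
    and d': "d' \<in> charts N" "F q \<in> chart_dom d'"
  shows "frechet_derivative (chart_map d' \<circ> chart_inv d) (at (chart_map d (F q)))
      (frechet_derivative (coord_rep c d) (at (chart_map c q)) v) =
    frechet_derivative (coord_rep c d') (at (chart_map c q)) v"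
proof -
  let ?U = "chart_dom c \<inter> F -` (chart_dom d \<inter> chart_dom d')"
  have "frechet_derivative (coord_rep c d') (at (chart_map c q)) v =
    frechet_derivative (chart_map d' \<circ> chart_inv d) (at (coord_rep c d (chart_map c q)))
      (frechet_derivative (coord_rep c d) (at (chart_map c q)) v)"
  proof (rule frechet_derivative_chain_local)
    show "open (chart_map c ` ?U)"
      by (rule M.open_chart_image[OF c(1)])
        (auto intro!: open_Int open_F_vimage M.open_dom[OF c(1)] N.open_dom[OF d(1)] N.open_dom[OF d'(1)])
    show "chart_map c q \<in> chart_map c ` ?U" using c d d' by blast
    show "(chart_map d' \<circ> chart_inv d) (coord_rep c d y) = coord_rep c d' y" if "y \<in> chart_map c ` ?U" for y
      using that M.chart_inv_map[OF c(1)] N.chart_inv_map[OF d(1)] by (auto simp: coord_rep_def)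
    show "coord_rep c d differentiable at (chart_map c q)"
      by (rule coord_rep_differentiable[OF c(1) d(1) c(2) d(2)])
    show "(chart_map d' \<circ> chart_inv d) differentiable at (coord_rep c d (chart_map c q))"
      unfolding coord_rep_map[OF c] by (rule N.transition_differentiable[OF d(1) d'(1) d(2) d'(2)])
  qed
  then show ?thesis by (simp only: coord_rep_map[OF c])
qed

lemma tangent_map_coord_rep: "T p v = frechet_derivative (coord_rep (chart_at M p) (chart_at N (F p))) (at (base_coord M p)) v"
  by (simp add: tangent_map_def coord_rep_def)

lemma tangent_map_in_charts:
  assumes c: "c \<in> charts M" "q \<in> chart_dom c" and d: "d \<in> charts N" "F q \<in> chart_dom d"
  shows "T q (vec_of_chart M c (chart_map c q) w) =
    vec_of_chart N d (chart_map d (F q)) (frechet_derivative (coord_rep c d) (at (chart_map c q)) w)"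
  by (simp add: tangent_map_coord_rep base_coord_def M.vec_of_chart_eq[OF c] N.vec_of_chart_eq[OF d]
      coord_rep_chain_domain[OF c M.chart_at N.chart_at] coord_rep_chain_codomain[OF c d N.chart_at])

lemma tangent_map_linear: "linear (T p)"
  using linear_frechet_derivative[OF coord_rep_differentiable[OF M.chart_at(1) N.chart_at(1) M.chart_at(2) N.chart_at(2), of p]]
  by (simp add: linear_iff tangent_map_coord_rep base_coord_def)

sublocale V: distribution g V
proof (rule distribution.intro)
  show "inner_form (g p)" for p by (rule M.inner)
  show "subspace (V p)" for p
    using linear_subspace_kernel[OF tangent_map_linear] by (simp add: vertical_def)
qed

sublocale H: distribution g H
  by (rule V.orth_compl_distribution)

abbreviation hor :: "'a \<Rightarrow> 'e \<Rightarrow> 'e" where "hor \<equiv> orth_proj g H"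
abbreviation ver :: "'a \<Rightarrow> 'e \<Rightarrow> 'e" where "ver \<equiv> orth_proj g V"

lemma hor_eq: "hor p v = v - ver p v"
  by (rule V.orth_proj_compl)

lemma tangent_map_hor: "T p (hor p v) = T p v"
  using V.orth_proj_in[of p v] linear_diff[OF tangent_map_linear, of p] by (simp add: hor_eq vertical_def)

text \<open>The horizontal projection is \<open>F\<^sub>*\<close> followed by its adjoint. This is the form in which its
  smoothness is visible.\<close>

lemma pullback_metric: "h (F p) (T p v) (T p w) = g p (hor p v) w"
proof -
  have iso: "\<And>x y. x \<in> H p \<Longrightarrow> y \<in> H p \<Longrightarrow> h (F p) (T p x) (T p y) = g p x y"
    using submersion by (simp add: riemannian_submersion_def horizontal_def)
  have "h (F p) (T p v) (T p w) = h (F p) (T p (hor p v)) (T p (hor p w))"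
    by (simp add: tangent_map_hor)
  also have "\<dots> = g p (hor p v) (hor p w)" by (rule iso) (rule H.orth_proj_in)+
  also have "\<dots> = g p (hor p v) w"
    using H.g_orth_proj[OF H.orth_proj_in, of p w v] M.sym by metis
  finally show ?thesis .
qed

lemma pullback_metric_in_charts:
  assumes c: "c \<in> charts M" and d: "d \<in> charts N" and x: "x \<in> coord_rep_dom c d"
  shows "g (chart_inv c x) (hor (chart_inv c x) (vec_of_chart M c x v)) (vec_of_chart M c x w) =
    N.chart_metric d (coord_rep c d x) (frechet_derivative (coord_rep c d) (at x) v) (frechet_derivative (coord_rep c d) (at x) w)"
proof -
  obtain q where q: "q \<in> chart_dom c" "F q \<in> chart_dom d" "x = chart_map c q"
    using x by (auto simp: coord_rep_dom_def)
  show ?thesis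
    unfolding q(3) pullback_metric[symmetric] N.chart_metric_def coord_rep_map[OF c q(1)]
    by (simp add: M.chart_inv_map[OF c q(1)] N.chart_inv_map[OF d q(2)] tangent_map_in_charts[OF c q(1) d q(2)])
qed

lemma coord_rep_dom_subset: "coord_rep_dom c d \<subseteq> chart_img c"
  by (auto simp: coord_rep_dom_def)

lemma coord_rep_img: "c \<in> charts M \<Longrightarrow> coord_rep c d ` coord_rep_dom c d \<subseteq> chart_img d"
  by (auto simp: coord_rep_dom_def coord_rep_map)

lemma smooth_field_hor:
  assumes X: "smooth_field M X"
  shows "smooth_field M (\<lambda>q. hor q (X q))"
proof (rule M.smooth_field_riesz, rule smooth_on_local)
  fix c w x assume c: "c \<in> charts M" and x: "x \<in> chart_img c"
  define d where "d = chart_at N (F (chart_inv c x))"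
  have d: "d \<in> charts N" "F (chart_inv c x) \<in> chart_dom d" unfolding d_def by (rule N.chart_at)+
  let ?T = "coord_rep_dom c d" and ?D = "\<lambda>x. frechet_derivative (coord_rep c d) (at x)"
  have xT: "x \<in> ?T"
    using d(2) M.chart_inv_dom[OF c x] M.chart_map_inv[OF c x] unfolding coord_rep_dom_def by (metis IntI imageI vimageI)
  note T = open_rep_dom[OF c d(1)] and sm = coord_rep_smooth[OF c d(1)]
  have Xc: "smooth_on ?T (field_in_chart M c X)"
    by (rule smooth_on_subset[OF M.smooth_fieldD[OF X c] coord_rep_dom_subset])
  have bil: "bilinear (N.chart_metric d (coord_rep c d y))" if "y \<in> ?T" for y
    using N.chart_metric_inner[OF d(1) subsetD[OF coord_rep_img[OF c] imageI[OF that]]] by (simp add: inner_form_def)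
  have "smooth_on ?T (\<lambda>y. N.chart_metric d (coord_rep c d y) (?D y (field_in_chart M c X y)) (?D y w))"
    by (rule smooth_on_bilinear_family[OF T bil smooth_on_compose[OF T N.open_img[OF d(1)] coord_rep_img[OF c]
          N.chart_metric_smooth[OF d(1)] sm] smooth_on_deriv_field[OF T sm Xc] smooth_on_deriv[OF sm]])
  then have "smooth_on ?T (\<lambda>y. g (chart_inv c y) (hor (chart_inv c y) (X (chart_inv c y))) (vec_of_chart M c y w))"
  proof (rule smooth_on_transform[OF _ T])
    fix y assume y: "y \<in> ?T"
    then have "y \<in> chart_img c" using coord_rep_dom_subset by blast
    from M.vec_of_field_in_chart[OF c this, of X] pullback_metric_in_charts[OF c d(1) y, of "field_in_chart M c X y" w]
    show "g (chart_inv c y) (hor (chart_inv c y) (X (chart_inv c y))) (vec_of_chart M c y w) =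
      N.chart_metric d (coord_rep c d y) (?D y (field_in_chart M c X y)) (?D y w)" by simp
  qed
  then show "\<exists>T. open T \<and> x \<in> T \<and> smooth_on T (\<lambda>y. g (chart_inv c y) (hor (chart_inv c y) (X (chart_inv c y))) (vec_of_chart M c y w))"
    using T xT by blast
qed

lemma smooth_field_ver: "smooth_field M X \<Longrightarrow> smooth_field M (\<lambda>q. ver q (X q))"
  using M.smooth_field_diff[OF _ smooth_field_hor, of X X] by (simp add: hor_eq)

text \<open>A vertical flow preserves the horizontal part of the metric: \<open>(L\<^sub>U g)(X, X) = 0\<close>. In charts,
  \<open>F\<^sub>*[U, X]\<close> is the derivative of \<open>F\<^sub>*X\<close> in the direction \<open>U\<close>, because \<open>F\<^sub>*U = 0\<close> and second
  derivatives are symmetric, while the coefficients of the metric of the base do not vary along a fibre.\<close>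

lemma vertical_derivative_of_metric:
  assumes X: "smooth_field M X" "\<And>q. X q \<in> H q" and U: "smooth_field M U" "\<And>q. U q \<in> V q"
  shows "dir_deriv M U (\<lambda>q. g q (X q) (X q)) p = 2 * g p (lie_bracket M U X p) (X p)"
proof -
  define c where "c = chart_at M p"
  define d where "d = chart_at N (F p)"
  define x where "x = base_coord M p"
  have c: "c \<in> charts M" "p \<in> chart_dom c" unfolding c_def by (rule M.chart_at)+
  have d: "d \<in> charts N" "F p \<in> chart_dom d" unfolding d_def by (rule N.chart_at)+
  have xp: "x = chart_map c p" by (simp add: x_def c_def base_coord_def)
  let ?T = "coord_rep_dom c d" and ?\<phi> = "coord_rep c d"
  let ?D = "\<lambda>x. frechet_derivative ?\<phi> (at x)"
  let ?X = "field_in_chart M c X" and ?U = "field_in_chart M c U"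
  note T = open_rep_dom[OF c(1) d(1)] and sm = coord_rep_smooth[OF c(1) d(1)]
  have x: "x \<in> ?T" using c d by (auto simp: coord_rep_dom_def xp)
  have \<phi>x: "?\<phi> x = base_coord N (F p)" unfolding xp coord_rep_map[OF c] by (simp add: d_def base_coord_def)
  have Xc: "smooth_on ?T ?X" and Uc: "smooth_on ?T ?U"
    using smooth_on_subset[OF M.smooth_fieldD[OF _ c(1)] coord_rep_dom_subset] X U by blast+
  have Xx: "?X x = X p" and Ux: "?U x = U p"
    unfolding x_def c_def by (rule M.field_in_chart_at)+
  have img: "y \<in> chart_img c" if "y \<in> ?T" for y using that coord_rep_dom_subset by blast
  have DT: "?D x v = T p v" for v by (simp add: tangent_map_coord_rep c_def d_def x_def)
  have met: "N.chart_metric d (?\<phi> x) v w = h (F p) v w" for v w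
    unfolding N.chart_metric_def \<phi>x by (simp add: d_def N.chart_inv_base N.vec_of_chart_at)
  have DU0: "?D y (?U y) = 0" if y: "y \<in> ?T" for y
  proof -
    obtain q where q: "q \<in> chart_dom c" "F q \<in> chart_dom d" "y = chart_map c q"
      using y by (auto simp: coord_rep_dom_def)
    have "vec_of_chart N d (chart_map d (F q)) (?D y (?U y)) = 0"
      using tangent_map_in_charts[OF c(1) q(1) d(1) q(2), of "?U y"] M.vec_of_field_in_chart[OF c(1) img[OF y], of U]
        U(2)[of q] by (simp add: q(3) M.chart_inv_map[OF c(1) q(1)] vertical_def)
    then show ?thesis
      using N.vec_in_of_chart[OF d(1) q(2), of "?D y (?U y)"] linear_0[OF N.vec_in_chart_linear[OF d(1) q(2)]] by simp
  qed
  \<comment> \<open>in coordinates \<open>\<xi> = F\<^sub>*X\<close>, while \<open>F\<^sub>*U\<close> vanishes identically and so has derivative zero\<close>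
  let ?\<xi> = "\<lambda>y. ?D y (?X y)"
  have "frechet_derivative (\<lambda>y. ?D y (?U y)) (at x) = frechet_derivative (\<lambda>y. 0) (at x)"
    by (rule frechet_derivative_transform_within_open[OF _ T x])
      (use DU0 smooth_on_differentiable[OF smooth_on_deriv_field[OF T sm Uc] x] in auto)
  then have "?D x (frechet_derivative ?U (at x) (X p)) + frechet_derivative (\<lambda>y. ?D y (U p)) (at x) (X p) = 0"
    using frechet_derivative_deriv_field[OF T x sm Uc, of "X p"] by (simp add: Ux)
  moreover have "frechet_derivative ?\<xi> (at x) (U p) =
      ?D x (frechet_derivative ?X (at x) (U p)) + frechet_derivative (\<lambda>y. ?D y (X p)) (at x) (U p)"
    using frechet_derivative_deriv_field[OF T x sm Xc, of "U p"] by (simp add: Xx)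
  moreover have "frechet_derivative (\<lambda>y. ?D y (X p)) (at x) (U p) = frechet_derivative (\<lambda>y. ?D y (U p)) (at x) (X p)"
    by (rule second_derivative_symmetric[OF T x sm])
  ultimately have "frechet_derivative ?\<xi> (at x) (U p) =
      ?D x (frechet_derivative ?X (at x) (U p)) - ?D x (frechet_derivative ?U (at x) (X p))"
    by (simp add: algebra_simps eq_neg_iff_add_eq_0)
  also have "\<dots> = T p (lie_bracket M U X p)"
    unfolding DT lie_bracket_def c_def[symmetric] x_def[symmetric]
    using linear_diff[OF tangent_map_linear] by simp
  finally have \<xi>': "frechet_derivative ?\<xi> (at x) (U p) = T p (lie_bracket M U X p)" .

  \<comment> \<open>differentiate the squared length of \<open>\<xi>\<close> in the metric of the base along \<open>U\<close>\<close>
  have gX: "g (chart_inv c y) (X (chart_inv c y)) (X (chart_inv c y)) = N.chart_metric d (?\<phi> y) (?\<xi> y) (?\<xi> y)"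
    if y: "y \<in> ?T" for y
    using pullback_metric_in_charts[OF c(1) d(1) y, of "?X y" "?X y"]
      M.vec_of_field_in_chart[OF c(1) img[OF y], of X] X(2) H.orth_proj_fixed by simp
  let ?B = "\<lambda>y. N.chart_metric d (?\<phi> y)"
  have bil: "bilinear (?B y)" if "y \<in> ?T" for y
    using N.chart_metric_inner[OF d(1) subsetD[OF coord_rep_img[OF c(1)] imageI[OF that]]] by (simp add: inner_form_def)
  have d\<phi>: "(?\<phi> has_derivative ?D x) (at x)" by (rule smooth_on_has_derivative[OF sm x])
  have dm: "((\<lambda>y. N.chart_metric d y v w) has_derivative frechet_derivative (\<lambda>y. N.chart_metric d y v w) (at (?\<phi> x))) (at (?\<phi> x))" for v w
    by (rule smooth_on_has_derivative[OF N.chart_metric_smooth[OF d(1)]]) (use coord_rep_img[OF c(1)] x in blast)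
  have Tp0: "T p (U p) = 0" using U(2)[of p] by (simp add: vertical_def)
  have "frechet_derivative (\<lambda>y. ?B y (?\<xi> y) (?\<xi> y)) (at x) (U p) =
     ?B x (frechet_derivative ?\<xi> (at x) (U p)) (?\<xi> x) + ?B x (?\<xi> x) (frechet_derivative ?\<xi> (at x) (U p))"
  proof (rule frechet_derivative_stationary_form[OF T x bil has_derivative_compose[OF d\<phi> dm]])
    show "(?\<xi> has_derivative frechet_derivative ?\<xi> (at x)) (at x)"
      by (rule smooth_on_has_derivative[OF smooth_on_deriv_field[OF T sm Xc] x])
    show "frechet_derivative (\<lambda>y. N.chart_metric d y v w) (at (?\<phi> x)) (?D x (U p)) = 0" for v w
      using linear_0[OF has_derivative_linear[OF dm]] by (simp add: DT Tp0)
  qed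
  also have "\<dots> = 2 * h (F p) (T p (lie_bracket M U X p)) (T p (X p))"
    by (simp add: met \<xi>' DT Xx N.sym[of "F p" "T p (X p)"])
  also have "\<dots> = 2 * g p (lie_bracket M U X p) (X p)"
    using H.g_orth_proj[OF X(2)] by (simp add: pullback_metric)
  finally have "frechet_derivative (\<lambda>y. ?B y (?\<xi> y) (?\<xi> y)) (at x) (U p) = 2 * g p (lie_bracket M U X p) (X p)" .
  moreover have "frechet_derivative (\<lambda>y. ?B y (?\<xi> y) (?\<xi> y)) (at x) =
      frechet_derivative ((\<lambda>q. g q (X q) (X q)) \<circ> chart_inv c) (at x)"
  proof (rule frechet_derivative_transform_within_open[OF _ T x])
    show "(\<lambda>y. ?B y (?\<xi> y) (?\<xi> y)) differentiable at x"
      by (rule smooth_on_differentiable[OF smooth_on_bilinear_family[OF T bil smooth_on_compose[OF T N.open_img[OF d(1)] coord_rep_img[OF c(1)]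
          N.chart_metric_smooth[OF d(1)] sm] smooth_on_deriv_field[OF T sm Xc] smooth_on_deriv_field[OF T sm Xc]] x])
  qed (simp add: gX)
  ultimately show ?thesis unfolding dir_deriv_def c_def[symmetric] x_def[symmetric] by simp
qed

end

section \<open>O'Neill's tensor on horizontal vectors\<close>

lemma (in distribution) orth_proj_cong:
  assumes "\<And>u. u \<in> D p \<Longrightarrow> g p v u = g p w u"
  shows "orth_proj g D p v = orth_proj g D p w"
proof -
  have "orth_proj g D p (v - w) = 0" by (rule orth_proj_eq_0) (simp add: diff_l assms)
  then show ?thesis using linear_diff[OF orth_proj_linear, of p v w] by simp
qed

text \<open>The axioms of the connection concern globally smooth fields. Every statement on tangent vectors
  below is therefore obtained by extending the vectors to global horizontal or vertical sections.\<close>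

locale oneill = riem_submersion M N g h F
  for M :: "('a::{t2_space,second_countable_topology}, 'e::euclidean_space) manifold"
    and N :: "('b::{t2_space,second_countable_topology}, 'f::euclidean_space) manifold"
    and g :: "'a \<Rightarrow> 'e \<Rightarrow> 'e \<Rightarrow> real" and h :: "'b \<Rightarrow> 'f \<Rightarrow> 'f \<Rightarrow> real" and F :: "'a \<Rightarrow> 'b" +
  fixes nab :: "('a \<Rightarrow> 'e) \<Rightarrow> ('a \<Rightarrow> 'e) \<Rightarrow> 'a \<Rightarrow> 'e"
  assumes levi_civita: "levi_civita M g nab"
begin

lemma nab_torsion: "smooth_field M X \<Longrightarrow> smooth_field M Y \<Longrightarrow> nab X Y p - nab Y X p = lie_bracket M X Y p"
  using levi_civita by (simp add: levi_civita_def)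

lemma nab_add_l: "smooth_field M X \<Longrightarrow> smooth_field M Y \<Longrightarrow> smooth_field M Z \<Longrightarrow>
    nab (\<lambda>q. X q + Y q) Z p = nab X Z p + nab Y Z p"
  and nab_add_r: "smooth_field M X \<Longrightarrow> smooth_field M Y \<Longrightarrow> smooth_field M Z \<Longrightarrow>
    nab X (\<lambda>q. Y q + Z q) p = nab X Y p + nab X Z p"
  and nab_metric: "smooth_field M X \<Longrightarrow> smooth_field M Y \<Longrightarrow> smooth_field M Z \<Longrightarrow>
    dir_deriv M X (\<lambda>q. g q (Y q) (Z q)) p = g p (nab X Y p) (Z p) + g p (Y p) (nab X Z p)"
  using levi_civita by (simp_all add: levi_civita_def)

lemma nab_scale_l: "smooth_field M X \<Longrightarrow> smooth_field M Y \<Longrightarrow> nab (\<lambda>q. k *\<^sub>R X q) Y p = k *\<^sub>R nab X Y p"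
  using levi_civita M.smooth_fun_const[of k] unfolding levi_civita_def by blast

lemma sectionsD: "X \<in> sections M D \<Longrightarrow> smooth_field M X" "X \<in> sections M D \<Longrightarrow> X q \<in> D q"
  by (auto simp: sections_def)

lemma smooth_field_zero: "smooth_field M (\<lambda>q. 0)"
proof -
  obtain X where "smooth_field M X" using M.smooth_extension_exists by blast
  then show ?thesis using M.smooth_field_scale_const[of X 0] by simp
qed

lemma nab_zero_r: "smooth_field M X \<Longrightarrow> nab X (\<lambda>q. 0) p = 0"
  using nab_add_r[OF _ smooth_field_zero smooth_field_zero, of X p] by simp

lemma hor_section: "smooth_field M X \<Longrightarrow> (\<lambda>q. hor q (X q)) \<in> sections M H"
  by (simp add: sections_def smooth_field_hor H.orth_proj_in)

lemma ver_section: "smooth_field M X \<Longrightarrow> (\<lambda>q. ver q (X q)) \<in> sections M V"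
  by (simp add: sections_def smooth_field_ver V.orth_proj_in)

lemma horizontal_extension: "x \<in> H p \<Longrightarrow> \<exists>X\<in>sections M H. X p = x"
proof -
  assume x: "x \<in> H p"
  obtain X where "smooth_field M X" "X p = x" using M.smooth_extension_exists by blast
  then show ?thesis using hor_section[of X] H.orth_proj_fixed[OF x] by (intro bexI[of _ "\<lambda>q. hor q (X q)"]) auto
qed

lemma vertical_extension: "u \<in> V p \<Longrightarrow> \<exists>U\<in>sections M V. U p = u"
proof -
  assume u: "u \<in> V p"
  obtain X where "smooth_field M X" "X p = u" using M.smooth_extension_exists by blast
  then show ?thesis using ver_section[of X] V.orth_proj_fixed[OF u] by (intro bexI[of _ "\<lambda>q. ver q (X q)"]) auto
qed

lemma nab_orthogonal:
  assumes "smooth_field M X" "Y \<in> sections M H" "U \<in> sections M V"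
  shows "g p (nab X Y p) (U p) = - g p (Y p) (nab X U p)"
proof -
  have "(\<lambda>q. g q (Y q) (U q)) = (\<lambda>q. 0)"
    using V.in_orth_compl sectionsD(2)[OF assms(2)] sectionsD(2)[OF assms(3)] by blast
  then have "dir_deriv M X (\<lambda>q. g q (Y q) (U q)) p = 0"
    by (simp add: dir_deriv_def comp_def)
  then show ?thesis using nab_metric[of X Y U p] assms sectionsD(1) by auto
qed

text \<open>Moving \<open>\<nabla>\<^sub>X\<close> to \<open>U\<close> and using the absence of torsion, \<open>2 g(\<nabla>\<^sub>X X, U)\<close> becomes minus the Lie
  derivative \<open>(L\<^sub>U g)(X, X)\<close>, which is zero.\<close>

lemma nab_diagonal_vertical:
  assumes X: "X \<in> sections M H" and U: "U \<in> sections M V"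
  shows "g p (nab X X p) (U p) = 0"
proof -
  note sX = sectionsD(1)[OF X] and sU = sectionsD(1)[OF U]
  have "2 * g p (nab U X p) (X p) = 2 * g p (lie_bracket M U X p) (X p)"
    using vertical_derivative_of_metric[OF sX sectionsD(2)[OF X] sU sectionsD(2)[OF U], of p]
      nab_metric[OF sU sX sX, of p] by (simp add: M.sym[of p "X p"])
  then have "g p (nab X U p) (X p) = 0"
    by (simp add: nab_torsion[OF sU sX, symmetric] M.diff_l)
  then show ?thesis using nab_orthogonal[OF sX X U, of p] M.sym[of p "X p"] by simp
qed

lemma section_add_scale:
  assumes "X \<in> sections M H" "Y \<in> sections M H"
  shows "(\<lambda>q. X q + k *\<^sub>R Y q) \<in> sections M H"
  using assms unfolding sections_def
  by (auto intro!: M.smooth_field_add M.smooth_field_scale_const subspace_add[OF H.sub] subspace_scale[OF H.sub])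

lemma nab_skew_vertical:
  assumes X: "X \<in> sections M H" and Y: "Y \<in> sections M H" and U: "U \<in> sections M V"
  shows "g p (nab X Y p) (U p) = - g p (nab Y X p) (U p)"
proof -
  note s = sectionsD(1)[OF X] sectionsD(1)[OF Y]
  let ?Z = "\<lambda>q. X q + Y q"
  have Z: "?Z \<in> sections M H" using section_add_scale[OF X Y, of 1] by simp
  have "nab ?Z ?Z p = nab X X p + nab X Y p + (nab Y X p + nab Y Y p)"
    using s sectionsD(1)[OF Z] by (simp add: nab_add_l nab_add_r)
  then show ?thesis
    using nab_diagonal_vertical[OF Z U, of p] nab_diagonal_vertical[OF X U, of p] nab_diagonal_vertical[OF Y U, of p]
    by (simp add: M.add_l)
qed

text \<open>The vertical part of \<open>\<nabla>\<^sub>X Y\<close> depends on \<open>Y\<close> only through its value, because it is minus the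
  adjoint of \<open>\<nabla>\<^sub>X\<close> on vertical fields; by skew symmetry the same holds for \<open>X\<close>.\<close>

lemma nab_vertical_tensorial:
  assumes X: "X \<in> sections M H" "X' \<in> sections M H" "X p = X' p"
    and Y: "Y \<in> sections M H" "Y' \<in> sections M H" "Y p = Y' p" and U: "U \<in> sections M V"
  shows "g p (nab X Y p) (U p) = g p (nab X' Y' p) (U p)"
proof -
  have "g p (nab X Y p) (U p) = - g p (Y' p) (nab X U p)"
    using nab_orthogonal[OF sectionsD(1)[OF X(1)] Y(1) U] Y(3) by simp
  also have "\<dots> = g p (nab X Y' p) (U p)"
    using nab_orthogonal[OF sectionsD(1)[OF X(1)] Y(2) U] by simp
  also have "\<dots> = - g p (nab Y' X p) (U p)" by (rule nab_skew_vertical[OF X(1) Y(2) U])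
  also have "\<dots> = g p (X' p) (nab Y' U p)"
    using nab_orthogonal[OF sectionsD(1)[OF Y(2)] X(1) U] X(3) by simp
  also have "\<dots> = - g p (nab Y' X' p) (U p)"
    using nab_orthogonal[OF sectionsD(1)[OF Y(2)] X(2) U] by simp
  also have "\<dots> = g p (nab X' Y' p) (U p)" using nab_skew_vertical[OF X(2) Y(2) U] by simp
  finally show ?thesis .
qed

lemma oneill_A_eq:
  "oneill_A g nab V E G p = ver p (nab (\<lambda>q. hor q (E q)) (\<lambda>q. hor q (G q)) p) +
     hor p (nab (\<lambda>q. hor q (E q)) (\<lambda>q. ver q (G q)) p)"
  by (simp add: oneill_A_def Let_def)

text \<open>By this the description through arbitrary smooth extensions determines a unique value. The
  horizontal part \<open>H \<nabla>\<^sub>H\<^sub>E V G\<close> is minus the adjoint of the vertical part, so that its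
  value is determined as well.\<close>

lemma oneill_A_tensorial:
  assumes E: "smooth_field M E" "smooth_field M E'" "E p = E' p"
    and G: "smooth_field M G" "smooth_field M G'" "G p = G' p"
  shows "oneill_A g nab V E G p = oneill_A g nab V E' G' p"
proof -
  let ?hE = "\<lambda>q. hor q (E q)" and ?hE' = "\<lambda>q. hor q (E' q)"
  let ?hG = "\<lambda>q. hor q (G q)" and ?hG' = "\<lambda>q. hor q (G' q)"
  let ?vG = "\<lambda>q. ver q (G q)" and ?vG' = "\<lambda>q. ver q (G' q)"
  note h = hor_section[OF E(1)] hor_section[OF E(2)]
  have "ver p (nab ?hE ?hG p) = ver p (nab ?hE' ?hG' p)"
  proof (rule V.orth_proj_cong)
    fix u assume "u \<in> V p"
    then obtain U where U: "U \<in> sections M V" "U p = u" using vertical_extension by blast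
    show "g p (nab ?hE ?hG p) u = g p (nab ?hE' ?hG' p) u"
      using nab_vertical_tensorial[OF h _ hor_section[OF G(1)] hor_section[OF G(2)] _ U(1), of p] U(2) E(3) G(3) by simp
  qed
  moreover have "hor p (nab ?hE ?vG p) = hor p (nab ?hE' ?vG' p)"
  proof (rule H.orth_proj_cong)
    fix y assume "y \<in> H p"
    then obtain Y where Y: "Y \<in> sections M H" "Y p = y" using horizontal_extension by blast
    have "g p (nab ?hE ?vG p) y = - g p (nab ?hE Y p) (?vG p)"
      using nab_orthogonal[OF sectionsD(1)[OF h(1)] Y(1) ver_section[OF G(1)], of p] Y(2)
      by (simp add: M.sym[of p y])
    also have "\<dots> = - g p (nab ?hE Y p) (?vG' p)" using G(3) by simp
    also have "\<dots> = - g p (nab ?hE' Y p) (?vG' p)"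
      using nab_vertical_tensorial[OF h _ Y(1) Y(1) refl ver_section[OF G(2)], of p] E(3) by simp
    also have "\<dots> = g p (nab ?hE' ?vG' p) y"
      using nab_orthogonal[OF sectionsD(1)[OF h(2)] Y(1) ver_section[OF G(2)], of p] Y(2)
      by (simp add: M.sym[of p y])
    finally show "g p (nab ?hE ?vG p) y = g p (nab ?hE' ?vG' p) y" .
  qed
  ultimately show ?thesis by (simp add: oneill_A_eq)
qed

abbreviation A :: "'a \<Rightarrow> 'e \<Rightarrow> 'e \<Rightarrow> 'e" where "A \<equiv> oneill_A_at M g nab V"

lemma A_at_eq:
  assumes "smooth_field M E" "smooth_field M G"
  shows "A p (E p) (G p) = oneill_A g nab V E G p"
  unfolding oneill_A_at_def
proof (rule the_equality)
  show "\<exists>E' G'. smooth_field M E' \<and> smooth_field M G' \<and> E' p = E p \<and> G' p = G p \<and>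
      oneill_A g nab V E G p = oneill_A g nab V E' G' p"
    using assms by blast
  fix a assume "\<exists>E' G'. smooth_field M E' \<and> smooth_field M G' \<and> E' p = E p \<and> G' p = G p \<and>
      a = oneill_A g nab V E' G' p"
  then show "a = oneill_A g nab V E G p" using oneill_A_tensorial assms by blast
qed

lemma oneill_A_sections:
  assumes X: "X \<in> sections M H" and Y: "Y \<in> sections M H"
  shows "oneill_A g nab V X Y p = ver p (nab X Y p)"
proof -
  have "(\<lambda>q. hor q (X q)) = X" "(\<lambda>q. hor q (Y q)) = Y"
    using H.orth_proj_fixed sectionsD(2)[OF X] sectionsD(2)[OF Y] by auto
  moreover have "(\<lambda>q. ver q (Y q)) = (\<lambda>q. 0)"
    using V.orth_proj_eq_0 V.in_orth_compl sectionsD(2)[OF Y] by blast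
  ultimately show ?thesis
    using nab_zero_r[OF sectionsD(1)[OF X]] linear_0[OF H.orth_proj_linear] by (simp add: oneill_A_eq)
qed

lemma A_sections: "X \<in> sections M H \<Longrightarrow> Y \<in> sections M H \<Longrightarrow> A p (X p) (Y p) = ver p (nab X Y p)"
  by (simp add: A_at_eq oneill_A_sections sectionsD(1))

lemma A_vertical: "x \<in> H p \<Longrightarrow> y \<in> H p \<Longrightarrow> A p x y \<in> V p"
  using A_sections V.orth_proj_in[of p] horizontal_extension[of x p] horizontal_extension[of y p] by fastforce

lemma A_skew:
  assumes "x \<in> H p" "y \<in> H p"
  shows "A p x y = - A p y x"
proof -
  obtain X Y where X: "X \<in> sections M H" "X p = x" and Y: "Y \<in> sections M H" "Y p = y"
    using assms horizontal_extension by meson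
  have "ver p (nab X Y p) = ver p (- nab Y X p)"
  proof (rule V.orth_proj_cong)
    fix u assume "u \<in> V p"
    then obtain U where "U \<in> sections M V" "U p = u" using vertical_extension by blast
    then show "g p (nab X Y p) u = g p (- nab Y X p) u"
      using nab_skew_vertical[OF X(1) Y(1), of U p] by (simp add: M.neg_l)
  qed
  then show ?thesis
    using A_sections[OF X(1) Y(1), of p] A_sections[OF Y(1) X(1), of p] X(2) Y(2) linear_neg[OF V.orth_proj_linear]
    by simp
qed

lemma A_linear_l:
  assumes "x \<in> H p" "y \<in> H p" "z \<in> H p"
  shows "A p (x + k *\<^sub>R y) z = A p x z + k *\<^sub>R A p y z"
proof -
  obtain X Y Z where X: "X \<in> sections M H" "X p = x" and Y: "Y \<in> sections M H" "Y p = y"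
    and Z: "Z \<in> sections M H" "Z p = z"
    using assms horizontal_extension by meson
  note s = sectionsD(1)[OF X(1)] sectionsD(1)[OF Y(1)] sectionsD(1)[OF Z(1)]
  have "nab (\<lambda>q. X q + k *\<^sub>R Y q) Z p = nab X Z p + k *\<^sub>R nab Y Z p"
    using s by (simp add: nab_add_l nab_scale_l M.smooth_field_scale_const)
  then show ?thesis
    using A_sections[OF section_add_scale[OF X(1) Y(1), of k] Z(1), of p] A_sections[OF X(1) Z(1), of p]
      A_sections[OF Y(1) Z(1), of p] X(2) Y(2) Z(2)
      linear_add[OF V.orth_proj_linear, of p] linear_scale[OF V.orth_proj_linear, of p]
    by simp
qed

lemma A_diagonal: "x \<in> H p \<Longrightarrow> A p x x = 0"
  using A_skew[of x p x] by (simp add: eq_neg_iff_add_eq_0 flip: scaleR_2)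

lemma A_vanishes_iff_sections:
  "(\<forall>X\<in>sections M H. \<forall>Y\<in>sections M H. \<forall>p. oneill_A g nab V X Y p = 0) \<longleftrightarrow>
   (\<forall>p. \<forall>x\<in>H p. \<forall>y\<in>H p. A p x y = 0)"
proof
  assume L: "\<forall>X\<in>sections M H. \<forall>Y\<in>sections M H. \<forall>p. oneill_A g nab V X Y p = 0"
  show "\<forall>p. \<forall>x\<in>H p. \<forall>y\<in>H p. A p x y = 0"
  proof (intro allI ballI)
    fix p x y assume "x \<in> H p" "y \<in> H p"
    then obtain X Y where "X \<in> sections M H" "X p = x" "Y \<in> sections M H" "Y p = y"
      using horizontal_extension by meson
    then show "A p x y = 0" using L A_at_eq[of X Y p] sectionsD(1) by auto
  qed
next
  assume "\<forall>p. \<forall>x\<in>H p. \<forall>y\<in>H p. A p x y = 0"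
  then show "\<forall>X\<in>sections M H. \<forall>Y\<in>sections M H. \<forall>p. oneill_A g nab V X Y p = 0"
    by (simp add: sectionsD A_at_eq[symmetric])
qed

text \<open>By skew symmetry and absence of torsion, \<open>A\<^sub>X Y\<close> is half the vertical part of \<open>[X, Y]\<close>.\<close>

lemma ver_lie_bracket:
  assumes X: "X \<in> sections M H" and Y: "Y \<in> sections M H"
  shows "ver p (lie_bracket M X Y p) = 2 *\<^sub>R oneill_A g nab V X Y p"
proof -
  have "ver p (lie_bracket M X Y p) = ver p (nab X Y p) - ver p (nab Y X p)"
    by (simp add: nab_torsion[OF sectionsD(1)[OF X] sectionsD(1)[OF Y], symmetric] linear_diff[OF V.orth_proj_linear])
  also have "\<dots> = A p (X p) (Y p) - A p (Y p) (X p)" by (simp add: A_sections X Y)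
  also have "\<dots> = 2 *\<^sub>R A p (X p) (Y p)"
    using A_skew[OF sectionsD(2)[OF Y] sectionsD(2)[OF X], of p] by (simp add: scaleR_2)
  finally show ?thesis by (simp add: A_sections oneill_A_sections X Y)
qed

lemma horizontal_iff_ver_0: "v \<in> H p \<longleftrightarrow> ver p v = 0"
proof
  show "ver p v = 0" if "v \<in> H p" using V.orth_proj_eq_0 V.in_orth_compl that by blast
  show "v \<in> H p" if "ver p v = 0" using H.orth_proj_in[of p v] that by (simp add: hor_eq)
qed

lemma A_vanishes_iff_integrable:
  "(\<forall>X\<in>sections M H. \<forall>Y\<in>sections M H. \<forall>p. oneill_A g nab V X Y p = 0) \<longleftrightarrow> completely_integrable M H"
  by (simp add: completely_integrable_def horizontal_iff_ver_0 ver_lie_bracket)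

end

section \<open>Casorati curvatures\<close>

context oneill
begin

lemma casorati_nonneg: "0 \<le> casorati M g nab V p L"
  unfolding casorati_def by (intro mult_nonneg_nonneg sum_nonneg) auto

text \<open>Parseval's identity in the vertical space removes the vertical basis: up to the factor \<open>s\<close>,
  \<open>C\<^sup>H\<close> is the squared norm of \<open>A\<close>.\<close>

lemma casorati_horizontal:
  assumes B: "orthonormal_basis (g p) (H p) B" and B0: "B = onb (g p) (H p)" and "dim (H p) \<noteq> 0"
  shows "real (dim (H p)) * casorati M g nab V p (H p) = (\<Sum>x\<in>B. \<Sum>y\<in>B. g p (A p x y) (A p x y))"
proof -
  let ?U = "onb (g p) (V p)"
  have U: "orthonormal_basis (g p) (V p) ?U" by (rule M.onb_orthonormal[OF V.sub])
  have "real (dim (H p)) * casorati M g nab V p (H p) = (\<Sum>u\<in>?U. \<Sum>x\<in>B. \<Sum>y\<in>B. (g p (A p x y) u)\<^sup>2)"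
    using assms(3) by (simp add: casorati_def B0)
  also have "\<dots> = (\<Sum>x\<in>B. \<Sum>u\<in>?U. \<Sum>y\<in>B. (g p (A p x y) u)\<^sup>2)" by (rule sum.swap)
  also have "\<dots> = (\<Sum>x\<in>B. \<Sum>y\<in>B. \<Sum>u\<in>?U. (g p (A p x y) u)\<^sup>2)"
    by (rule sum.cong[OF refl], rule sum.swap)
  also have "\<dots> = (\<Sum>x\<in>B. \<Sum>y\<in>B. g p (A p x y) (A p x y))"
    by (intro sum.cong refl M.parseval[OF U, symmetric] A_vertical M.onb_subset[OF B])
  finally show ?thesis .
qed

lemma casorati_subspace_le:
  assumes L: "subspace L" "L \<subseteq> H p" "dim L \<noteq> 0" and "dim (H p) \<noteq> 0"
  shows "real (dim L) * casorati M g nab V p L \<le> real (dim (H p)) * casorati M g nab V p (H p)"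
proof -
  let ?C = "\<lambda>B u. \<Sum>x\<in>B. \<Sum>y\<in>B. (g p (A p x y) u)\<^sup>2"
  note B = M.onb_orthonormal[OF L(1), of p] and C = M.onb_orthonormal[OF H.sub[of p], of p]
  have "?C (onb (g p) L) u \<le> ?C (onb (g p) (H p)) u" for u
    by (rule M.bilinear_square_sum_mono[OF B C L(2)])
      (simp add: A_linear_l M.add_l M.scale_l, metis A_skew M.neg_l)
  then have "(\<Sum>u\<in>onb (g p) (V p). ?C (onb (g p) L) u) \<le> (\<Sum>u\<in>onb (g p) (V p). ?C (onb (g p) (H p)) u)"
    by (rule sum_mono)
  then show ?thesis using assms(3,4) by (simp add: casorati_def)
qed

lemma casorati_eq_0_iff:
  assumes "dim (H p) \<noteq> 0"
  shows "casorati M g nab V p (H p) = 0 \<longleftrightarrow> (\<forall>x\<in>H p. \<forall>y\<in>H p. A p x y = 0)"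
proof
  define B where "B = onb (g p) (H p)"
  have B: "orthonormal_basis (g p) (H p) B" unfolding B_def by (rule M.onb_orthonormal[OF H.sub])
  note cas = casorati_horizontal[OF B B_def assms]
  show "casorati M g nab V p (H p) = 0" if "\<forall>x\<in>H p. \<forall>y\<in>H p. A p x y = 0"
  proof -
    have "(\<Sum>x\<in>B. \<Sum>y\<in>B. g p (A p x y) (A p x y)) = 0"
      using that M.onb_subset[OF B] by (intro sum.neutral ballI) auto
    then show ?thesis using cas assms by simp
  qed
  assume "casorati M g nab V p (H p) = 0"
  then have s0: "(\<Sum>x\<in>B. \<Sum>y\<in>B. g p (A p x y) (A p x y)) = 0" using cas by simp
  have z: "A p x y = 0" if "x \<in> B" "y \<in> B" for x y
  proof -
    note fin = M.finite_onb[OF B]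
    have "(\<Sum>y\<in>B. g p (A p x y) (A p x y)) = 0"
      using s0 that fin by (subst (asm) sum_nonneg_eq_0_iff) (auto intro!: sum_nonneg M.nonneg)
    then have "g p (A p x y) (A p x y) = 0"
      using that fin by (subst (asm) sum_nonneg_eq_0_iff) (auto intro!: M.nonneg)
    then show ?thesis by (simp add: M.eq_0_iff)
  qed
  have ext: "A p x y = 0" if x: "x \<in> H p" and y: "y \<in> H p" and b: "\<And>x. x \<in> B \<Longrightarrow> A p x y = 0" for x y
  proof -
    have 0: "A p 0 y = 0"
      using A_linear_l[OF subspace_0[OF H.sub] subspace_0[OF H.sub] y, of 1] by simp
    have "x \<in> span B" using x M.span_onb[OF B] by simp
    then have "x \<in> H p \<and> A p x y = 0"
    proof (induction rule: span_induct_alt)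
      case base
      then show ?case using 0 subspace_0[OF H.sub] by simp
    next
      case (step c b' x)
      then have "b' \<in> H p" using M.onb_subset[OF B] by blast
      then show ?case
        using step A_linear_l[of x p b' y c] b[of b'] y subspace_add[OF H.sub] subspace_scale[OF H.sub]
        by (simp add: add.commute)
    qed
    then show ?thesis by simp
  qed
  show "\<forall>x\<in>H p. \<forall>y\<in>H p. A p x y = 0"
  proof (intro ballI)
    fix x y assume x: "x \<in> H p" and y: "y \<in> H p"
    have "A p b y = 0" if "b \<in> B" for b
    proof -
      have bH: "b \<in> H p" by (rule M.onb_subset[OF B that])
      have "A p y b = 0" by (rule ext[OF y bH]) (use z that in auto)
      then show ?thesis using A_skew[OF bH y] by simp
    qed
    then show "A p x y = 0" by (rule ext[OF x y])
  qed
qed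

lemma hyperplanes_nonempty:
  assumes "dim (H p) \<noteq> 0"
  shows "hyperplanes (H p) \<noteq> {}"
proof -
  obtain L where L: "subspace L" "L \<subseteq> span (H p)" "dim L = dim (H p) - 1"
    by (rule choose_subspace_of_subspace[of "dim (H p) - 1" "H p"]) simp_all
  have "span (H p) = H p" by (rule span_eq_iff[THEN iffD2, OF H.sub])
  then have "L \<subseteq> H p" using L(2) by argo
  then have "L \<in> hyperplanes (H p)" using L(1,3) assms by (simp add: hyperplanes_def del: dim_eq_0)
  then show ?thesis by blast
qed

lemma delta_C_ge:
  assumes "dim (H p) \<noteq> 0"
  shows "casorati M g nab V p (H p) / 2 \<le> delta_C M g nab V p"
proof -
  have "0 \<le> (INF L\<in>hyperplanes (H p). casorati M g nab V p L)"
    by (rule cINF_greatest[OF hyperplanes_nonempty[OF assms] casorati_nonneg])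
  then show ?thesis by (simp add: delta_C_def Let_def)
qed

text \<open>For a hyperplane \<open>L\<close> the comparison of norms reads \<open>(s - 1) C(L) \<le> s C\<^sup>H\<close>, which bounds the
  supremum.\<close>

lemma delta_hat_C_ge:
  assumes "2 \<le> dim (H p)"
  shows "(2 - (2 * real (dim (H p)) - 1) / (2 * (real (dim (H p)) - 1))) * casorati M g nab V p (H p)
    \<le> delta_hat_C M g nab V p"
proof -
  let ?s = "real (dim (H p))" and ?C = "casorati M g nab V p (H p)"
  have s: "?s \<ge> 2" using assms by simp
  have "(SUP L\<in>hyperplanes (H p). casorati M g nab V p L) \<le> ?s * ?C / (?s - 1)"
  proof (rule cSUP_least)
    show "hyperplanes (H p) \<noteq> {}" by (rule hyperplanes_nonempty) (use assms in linarith)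
    fix L assume "L \<in> hyperplanes (H p)"
    then have L: "subspace L" "L \<subseteq> H p" "dim L + 1 = dim (H p)" by (auto simp: hyperplanes_def)
    have dL: "real (dim L) = ?s - 1" using L(3) by linarith
    have "real (dim L) * casorati M g nab V p L \<le> ?s * ?C"
      by (rule casorati_subspace_le[OF L(1,2)]) (use L(3) assms in linarith)+
    then show "casorati M g nab V p L \<le> ?s * ?C / (?s - 1)"
      unfolding dL using s by (simp add: pos_le_divide_eq mult.commute)
  qed
  then have "(2 * ?s - 1) / (2 * ?s) * (SUP L\<in>hyperplanes (H p). casorati M g nab V p L)
      \<le> (2 * ?s - 1) / (2 * ?s) * (?s * ?C / (?s - 1))"
    using s by (intro mult_left_mono) auto
  also have "\<dots> = (2 * ?s - 1) / (2 * (?s - 1)) * ?C"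
  proof -
    have "(2 * a - 1) / (2 * a) * (a * w / b) = (2 * a - 1) / (2 * b) * w" if "a \<noteq> 0" for a b w :: real
      using that by simp
    then show ?thesis by this (use s in linarith)
  qed
  finally show ?thesis by (simp add: delta_hat_C_def Let_def left_diff_distrib)
qed

lemma delta_eq_0:
  assumes "\<forall>x\<in>H p. \<forall>y\<in>H p. A p x y = 0" "dim (H p) \<noteq> 0"
  shows "delta_C M g nab V p = 0" "delta_hat_C M g nab V p = 0"
proof -
  have L0: "casorati M g nab V p L = 0" if "L \<in> hyperplanes (H p)" for L
  proof -
    have L: "subspace L" "L \<subseteq> H p" using that by (auto simp: hyperplanes_def)
    have "g p (A p x y) u = 0" if "x \<in> onb (g p) L" "y \<in> onb (g p) L" for x y u
      using M.onb_subset[OF M.onb_orthonormal[OF L(1)]] that L(2) assms(1) by (simp add: subset_iff)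
    then show ?thesis by (simp add: casorati_def)
  qed
  have "casorati M g nab V p (H p) = 0" using casorati_eq_0_iff assms by blast
  then show "delta_C M g nab V p = 0" "delta_hat_C M g nab V p = 0"
    using hyperplanes_nonempty[OF assms(2)] L0
    by (simp_all add: delta_C_def delta_hat_C_def Let_def cong: INF_cong SUP_cong)
qed

end

section \<open>The horizontal scalar curvature\<close>

locale slant_space_form = oneill M N g h F nab
  for M :: "('a::{t2_space,second_countable_topology}, 'e::euclidean_space) manifold"
    and N :: "('b::{t2_space,second_countable_topology}, 'f::euclidean_space) manifold"
    and g :: "'a \<Rightarrow> 'e \<Rightarrow> 'e \<Rightarrow> real" and h :: "'b \<Rightarrow> 'f \<Rightarrow> 'f \<Rightarrow> real" and F :: "'a \<Rightarrow> 'b"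
    and nab :: "('a \<Rightarrow> 'e) \<Rightarrow> ('a \<Rightarrow> 'e) \<Rightarrow> 'a \<Rightarrow> 'e" +
  fixes J :: "'a \<Rightarrow> 'e \<Rightarrow> 'e" and c1 c2 \<theta> :: "'a \<Rightarrow> real"
  assumes space_form: "generalized_complex_space_form M g nab J c1 c2"
    and slant: "pointwise_slant g J V \<theta>"
begin

lemma J_square: "J p (J p v) = - v" and J_isometry: "g p (J p v) (J p w) = g p v w"
  using space_form unfolding generalized_complex_space_form_def almost_hermitian_def by blast+

lemma J_skew: "g p (J p v) w = - g p v (J p w)"
  using J_isometry[of p "J p v" w] by (simp add: J_square M.neg_l)

lemma J_orth: "g p v (J p v) = 0"
  using J_skew[of p v v] M.sym[of p v "J p v"] by linarith

lemma curvature_at_eq: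
  "curvature_at M nab p x y z =
    c1 p *\<^sub>R (g p y z *\<^sub>R x - g p x z *\<^sub>R y) +
    c2 p *\<^sub>R (g p x (J p z) *\<^sub>R J p y - g p y (J p z) *\<^sub>R J p x + (2 * g p x (J p y)) *\<^sub>R J p z)"
    (is "_ = ?r")
proof -
  have cur: "curvature M nab X Y Z p = ?r"
    if "smooth_field M X" "smooth_field M Y" "smooth_field M Z" "X p = x" "Y p = y" "Z p = z" for X Y Z
    using space_form that by (simp add: generalized_complex_space_form_def)
  show ?thesis unfolding curvature_at_def
  proof (rule the_equality)
    obtain X Y Z where "smooth_field M X" "X p = x" "smooth_field M Y" "Y p = y" "smooth_field M Z" "Z p = z"
      using M.smooth_extension_exists by meson
    then show "\<exists>X Y Z. smooth_field M X \<and> smooth_field M Y \<and> smooth_field M Z \<and>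
        X p = x \<and> Y p = y \<and> Z p = z \<and> ?r = curvature M nab X Y Z p"
      using cur[of X Y Z] by (intro exI[of _ X] exI[of _ Y] exI[of _ Z]) simp
  next
    fix r assume "\<exists>X Y Z. smooth_field M X \<and> smooth_field M Y \<and> smooth_field M Z \<and>
        X p = x \<and> Y p = y \<and> Z p = z \<and> r = curvature M nab X Y Z p"
    then show "r = ?r" using cur by (elim exE conjE) simp
  qed
qed

text \<open>Of the three correction terms one vanishes, as \<open>A\<^sub>x x = 0\<close>, and the others add up to
  \<open>- (2 + 1) |A\<^sub>x y|\<^sup>2\<close>.\<close>

lemma hor_curv_diagonal:
  assumes "x \<in> H p" "y \<in> H p"
  shows "hor_curv M g nab V p x y y x =
    c1 p * (g p x x * g p y y - (g p x y)\<^sup>2) + 3 * c2 p * (g p (J p y) x)\<^sup>2 - 3 * g p (A p x y) (A p x y)"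
proof -
  have "g p (curvature_at M nab p x y y) x =
      c1 p * (g p x x * g p y y - (g p x y)\<^sup>2) + 3 * c2 p * (g p (J p y) x)\<^sup>2"
    using M.sym[of p x y] M.sym[of p x "J p y"]
    by (simp add: curvature_at_eq M.add_l M.diff_l M.scale_l J_orth power2_eq_square algebra_simps)
  moreover have "A p y x = - A p x y" by (rule A_skew[OF assms(2,1)])
  ultimately show ?thesis
    using A_diagonal[OF assms(1)] A_diagonal[OF assms(2)]
    by (simp add: hor_curv_def Let_def M.neg_r)
qed

text \<open>The horizontal part \<open>P\<close> of \<open>J\<close> is skew because \<open>J\<close> is, so the sum, which is \<open>|Py|\<^sup>2\<close>, equals
  \<open>- g(P\<^sup>2y, y)\<close>.\<close>

lemma slant_square_sum:
  assumes B: "orthonormal_basis (g p) (H p) B" and y: "y \<in> B"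
  shows "(\<Sum>x\<in>B. (g p (J p y) x)\<^sup>2) = (cos (\<theta> p))\<^sup>2"
proof -
  let ?P = "\<lambda>v. hor p (J p v)"
  have yH: "y \<in> H p" by (rule M.onb_subset[OF B y])
  have P2: "?P (?P y) = - ((cos (\<theta> p))\<^sup>2 *\<^sub>R y)"
    using slant yH by (simp add: pointwise_slant_def Let_def)
  have PH: "?P v \<in> H p" for v by (rule H.orth_proj_in)
  have "(\<Sum>x\<in>B. (g p (J p y) x)\<^sup>2) = (\<Sum>x\<in>B. (g p (?P y) x)\<^sup>2)"
    using H.g_orth_proj M.onb_subset[OF B] by (intro sum.cong) auto
  also have "\<dots> = g p (?P y) (?P y)" by (rule M.parseval[OF B PH, symmetric])
  also have "\<dots> = g p (J p y) (?P y)" by (rule H.g_orth_proj[OF PH])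
  also have "\<dots> = - g p (J p (?P y)) y" using J_skew[of p y "?P y"] M.sym[of p y "J p (?P y)"] by linarith
  also have "\<dots> = - g p (?P (?P y)) y" using H.g_orth_proj[OF yH] by simp
  also have "\<dots> = (cos (\<theta> p))\<^sup>2" using M.onb_b[OF B y y] by (simp add: P2 M.neg_l M.scale_l)
  finally show ?thesis .
qed

lemma hor_scalar_eq:
  assumes s: "dim (H p) = s" "2 \<le> s"
  shows "hor_scalar M g nab V p =
    c1 p + 3 * c2 p / (real s - 1) * (cos (\<theta> p))\<^sup>2 - 3 / (real s - 1) * casorati M g nab V p (H p)"
proof -
  define B where "B = onb (g p) (H p)"
  have B: "orthonormal_basis (g p) (H p) B" unfolding B_def by (rule M.onb_orthonormal[OF H.sub])
  have card: "card B = s" using M.card_onb[OF B] s by simp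
  have fin: "finite B" by (rule M.finite_onb[OF B])
  have BH: "x \<in> H p" if "x \<in> B" for x by (rule M.onb_subset[OF B that])
  let ?C = "casorati M g nab V p (H p)" and ?k = "(cos (\<theta> p))\<^sup>2"
  have one: "(\<Sum>x\<in>B. c1 p * (g p x x * g p y y - (g p x y)\<^sup>2)) = c1 p * (real s - 1)" if y: "y \<in> B" for y
  proof -
    have "(\<Sum>x\<in>B. c1 p * (g p x x * g p y y - (g p x y)\<^sup>2)) = (\<Sum>x\<in>B. c1 p - (if x = y then c1 p else 0))"
      using M.onb_b[OF B] y by (intro sum.cong) auto
    also have "\<dots> = c1 p * (real s - 1)"
      using y fin card by (simp add: sum_subtractf algebra_simps)
    finally show ?thesis .
  qed
  have "(\<Sum>x\<in>B. \<Sum>y\<in>B. hor_curv M g nab V p x y y x) =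
      (\<Sum>x\<in>B. \<Sum>y\<in>B. c1 p * (g p x x * g p y y - (g p x y)\<^sup>2) + 3 * c2 p * (g p (J p y) x)\<^sup>2 - 3 * g p (A p x y) (A p x y))"
    by (intro sum.cong refl hor_curv_diagonal BH)
  also have "\<dots> = (\<Sum>y\<in>B. \<Sum>x\<in>B. c1 p * (g p x x * g p y y - (g p x y)\<^sup>2)) +
      (\<Sum>y\<in>B. \<Sum>x\<in>B. 3 * c2 p * (g p (J p y) x)\<^sup>2) - (\<Sum>x\<in>B. \<Sum>y\<in>B. 3 * g p (A p x y) (A p x y))"
    by (simp only: sum.distrib sum_subtractf sum.swap[of "\<lambda>x y. c1 p * (g p x x * g p y y - (g p x y)\<^sup>2)"]
        sum.swap[of "\<lambda>x y. 3 * c2 p * (g p (J p y) x)\<^sup>2"])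
  also have "\<dots> = real s * (c1 p * (real s - 1)) + real s * (3 * c2 p * ?k) - 3 * (real s * ?C)"
  proof -
    have 1: "(\<Sum>y\<in>B. \<Sum>x\<in>B. c1 p * (g p x x * g p y y - (g p x y)\<^sup>2)) = real s * (c1 p * (real s - 1))"
      using one card by simp
    have "(\<Sum>x\<in>B. 3 * c2 p * (g p (J p y) x)\<^sup>2) = 3 * c2 p * ?k" if "y \<in> B" for y
      using slant_square_sum[OF B that] by (simp flip: sum_distrib_left)
    then have 2: "(\<Sum>y\<in>B. \<Sum>x\<in>B. 3 * c2 p * (g p (J p y) x)\<^sup>2) = real s * (3 * c2 p * ?k)"
      using card by simp
    have 3: "(\<Sum>x\<in>B. \<Sum>y\<in>B. 3 * g p (A p x y) (A p x y)) = 3 * (real s * ?C)"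
      using casorati_horizontal[OF B B_def] s by (simp flip: sum_distrib_left)
    show ?thesis unfolding 1 2 3 ..
  qed
  finally have "hor_scalar M g nab V p =
      1 / (real s * (real s - 1)) * (real s * (c1 p * (real s - 1)) + real s * (3 * c2 p * ?k) - 3 * (real s * ?C))"
    by (simp add: hor_scalar_def Let_def s(1) B_def)
  also have "\<dots> = c1 p + 3 * c2 p / (real s - 1) * ?k - 3 / (real s - 1) * ?C"
  proof -
    have "1 / (a * b) * (a * (u * b) + a * v - 3 * (a * w)) = u + v / b - 3 / b * w"
      if "a \<noteq> 0" "b \<noteq> 0" for a b u v w :: real
      using that by (simp add: field_simps)
    from this[of "real s" "real s - 1"] show ?thesis using s(2) by simp
  qed
  finally show ?thesis .
qed

text \<open>Both Casorati invariants are bounded below by \<open>k C\<^sup>H\<close> with a constant \<open>k > -3 / (s - 1)\<close>, whereas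
  the scalar curvature contains the term \<open>- 3 C\<^sup>H / (s - 1)\<close>. The gap is therefore at least a
  positive multiple of \<open>C\<^sup>H\<close>, which vanishes only if \<open>A\<close> does.\<close>

lemma hor_scalar_bound:
  assumes s: "dim (H p) = s" "2 \<le> s"
    and k: "k * casorati M g nab V p (H p) \<le> \<delta>" "0 < k + 3 / (real s - 1)"
    and \<delta>0: "\<forall>x\<in>H p. \<forall>y\<in>H p. A p x y = 0 \<Longrightarrow> \<delta> = 0"
  shows "hor_scalar M g nab V p \<le> \<delta> + c1 p + 3 * c2 p / (real s - 1) * (cos (\<theta> p))\<^sup>2"
    and "hor_scalar M g nab V p = \<delta> + c1 p + 3 * c2 p / (real s - 1) * (cos (\<theta> p))\<^sup>2 \<longleftrightarrow>
      (\<forall>x\<in>H p. \<forall>y\<in>H p. A p x y = 0)"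
proof -
  let ?C = "casorati M g nab V p (H p)"
  have dim: "dim (H p) \<noteq> 0" using s by linarith
  have eq: "hor_scalar M g nab V p =
      c1 p + 3 * c2 p / (real s - 1) * (cos (\<theta> p))\<^sup>2 - 3 / (real s - 1) * ?C"
    by (rule hor_scalar_eq[OF s])
  have gap: "(k + 3 / (real s - 1)) * ?C \<le> \<delta> + 3 / (real s - 1) * ?C"
    using k(1) by (simp add: distrib_right)
  have pos: "0 \<le> (k + 3 / (real s - 1)) * ?C"
    using k(2) casorati_nonneg by simp
  show "hor_scalar M g nab V p \<le> \<delta> + c1 p + 3 * c2 p / (real s - 1) * (cos (\<theta> p))\<^sup>2"
    unfolding eq using gap pos by linarith
  show "hor_scalar M g nab V p = \<delta> + c1 p + 3 * c2 p / (real s - 1) * (cos (\<theta> p))\<^sup>2 \<longleftrightarrow>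
      (\<forall>x\<in>H p. \<forall>y\<in>H p. A p x y = 0)"
  proof
    assume "hor_scalar M g nab V p = \<delta> + c1 p + 3 * c2 p / (real s - 1) * (cos (\<theta> p))\<^sup>2"
    then have "(k + 3 / (real s - 1)) * ?C = 0" unfolding eq using gap pos by linarith
    then have "?C = 0" using k(2) by simp
    then show "\<forall>x\<in>H p. \<forall>y\<in>H p. A p x y = 0" using casorati_eq_0_iff[OF dim] by blast
  next
    assume A0: "\<forall>x\<in>H p. \<forall>y\<in>H p. A p x y = 0"
    then have "?C = 0" using casorati_eq_0_iff[OF dim] by blast
    then show "hor_scalar M g nab V p = \<delta> + c1 p + 3 * c2 p / (real s - 1) * (cos (\<theta> p))\<^sup>2"
      unfolding eq using \<delta>0[OF A0] by simp
  qed
qed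

lemma hor_scalar_delta_C:
  assumes s: "dim (H p) = s" "2 \<le> s"
  shows "hor_scalar M g nab V p \<le> delta_C M g nab V p + c1 p + 3 * c2 p / (real s - 1) * (cos (\<theta> p))\<^sup>2"
    and "hor_scalar M g nab V p = delta_C M g nab V p + c1 p + 3 * c2 p / (real s - 1) * (cos (\<theta> p))\<^sup>2 \<longleftrightarrow>
      (\<forall>x\<in>H p. \<forall>y\<in>H p. A p x y = 0)"
proof -
  have dim: "dim (H p) \<noteq> 0" using s by linarith
  have k: "1 / 2 * casorati M g nab V p (H p) \<le> delta_C M g nab V p" "0 < 1 / 2 + 3 / (real s - 1)"
    using delta_C_ge[OF dim] s(2) by (simp_all add: add_pos_nonneg)
  note b = hor_scalar_bound[OF s k delta_eq_0(1)[OF _ dim]]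
  show "hor_scalar M g nab V p \<le> delta_C M g nab V p + c1 p + 3 * c2 p / (real s - 1) * (cos (\<theta> p))\<^sup>2"
    by (rule b(1))
  show "hor_scalar M g nab V p = delta_C M g nab V p + c1 p + 3 * c2 p / (real s - 1) * (cos (\<theta> p))\<^sup>2 \<longleftrightarrow>
      (\<forall>x\<in>H p. \<forall>y\<in>H p. A p x y = 0)"
    by (rule b(2))
qed

lemma hor_scalar_delta_hat_C:
  assumes s: "dim (H p) = s" "2 \<le> s"
  shows "hor_scalar M g nab V p \<le> delta_hat_C M g nab V p + c1 p + 3 * c2 p / (real s - 1) * (cos (\<theta> p))\<^sup>2"
    and "hor_scalar M g nab V p = delta_hat_C M g nab V p + c1 p + 3 * c2 p / (real s - 1) * (cos (\<theta> p))\<^sup>2 \<longleftrightarrow>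
      (\<forall>x\<in>H p. \<forall>y\<in>H p. A p x y = 0)"
proof -
  have dim: "dim (H p) \<noteq> 0" using s by linarith
  have k: "(2 - (2 * real s - 1) / (2 * (real s - 1))) * casorati M g nab V p (H p) \<le> delta_hat_C M g nab V p"
    using delta_hat_C_ge[of p] s by simp
  have "0 < 2 - (2 * (t + 1) - 1) / (2 * t) + 3 / t" if "0 < t" for t :: real
    using that by (simp add: field_simps)
  from this[of "real s - 1"] have k': "0 < 2 - (2 * real s - 1) / (2 * (real s - 1)) + 3 / (real s - 1)"
    using s(2) by simp
  note b = hor_scalar_bound[OF s k k' delta_eq_0(2)[OF _ dim]]
  show "hor_scalar M g nab V p \<le> delta_hat_C M g nab V p + c1 p + 3 * c2 p / (real s - 1) * (cos (\<theta> p))\<^sup>2"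
    by (rule b(1))
  show "hor_scalar M g nab V p = delta_hat_C M g nab V p + c1 p + 3 * c2 p / (real s - 1) * (cos (\<theta> p))\<^sup>2 \<longleftrightarrow>
      (\<forall>x\<in>H p. \<forall>y\<in>H p. A p x y = 0)"
    by (rule b(2))
qed

end

theorem theorem5p1:
  fixes M1 :: "('a::{t2_space,second_countable_topology}, 'e::euclidean_space) manifold"
    and M2 :: "('b::{t2_space,second_countable_topology}, 'f::euclidean_space) manifold"
    and g1 :: "'a \<Rightarrow> 'e \<Rightarrow> 'e \<Rightarrow> real"
    and g2 :: "'b \<Rightarrow> 'f \<Rightarrow> 'f \<Rightarrow> real"
    and J1 :: "'a \<Rightarrow> 'e \<Rightarrow> 'e"
    and nab :: "('a \<Rightarrow> 'e) \<Rightarrow> ('a \<Rightarrow> 'e) \<Rightarrow> 'a \<Rightarrow> 'e"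
    and F :: "'a \<Rightarrow> 'b"
    and c1 c2 \<theta> :: "'a \<Rightarrow> real"
    and V H :: "'a \<Rightarrow> 'e set"
    and s :: nat
  assumes submersion: "riemannian_submersion M1 M2 g1 g2 F"
    and space_form: "generalized_complex_space_form M1 g1 nab J1 c1 c2"
    and V: "V = vertical M1 M2 F"
    and H: "H = horizontal M1 M2 g1 F"
    and slant: "pointwise_slant g1 J1 V \<theta>"
    and dim_H: "\<forall>p. dim (H p) = s"
    and s: "3 \<le> s"
  shows "(\<forall>p. hor_scalar M1 g1 nab V p
              \<le> delta_C M1 g1 nab V p + c1 p + 3 * c2 p / (real s - 1) * (cos (\<theta> p))\<^sup>2) \<and>
         (\<forall>p. hor_scalar M1 g1 nab V p
              \<le> delta_hat_C M1 g1 nab V p + c1 p + 3 * c2 p / (real s - 1) * (cos (\<theta> p))\<^sup>2) \<and>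
         ((\<forall>p. hor_scalar M1 g1 nab V p
              = delta_C M1 g1 nab V p + c1 p + 3 * c2 p / (real s - 1) * (cos (\<theta> p))\<^sup>2)
          \<longleftrightarrow> (\<forall>X\<in>sections M1 H. \<forall>Y\<in>sections M1 H. \<forall>p. oneill_A g1 nab V X Y p = 0)) \<and>
         ((\<forall>p. hor_scalar M1 g1 nab V p
              = delta_hat_C M1 g1 nab V p + c1 p + 3 * c2 p / (real s - 1) * (cos (\<theta> p))\<^sup>2)
          \<longleftrightarrow> (\<forall>X\<in>sections M1 H. \<forall>Y\<in>sections M1 H. \<forall>p. oneill_A g1 nab V X Y p = 0)) \<and>
         ((\<forall>X\<in>sections M1 H. \<forall>Y\<in>sections M1 H. \<forall>p. oneill_A g1 nab V X Y p = 0)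
          \<longleftrightarrow> completely_integrable M1 H)"
proof -
  interpret slant_space_form M1 M2 g1 g2 F nab J1 c1 c2 \<theta>
  proof
    show "riemannian_submersion M1 M2 g1 g2 F" by (rule submersion)
    show "generalized_complex_space_form M1 g1 nab J1 c1 c2" by (rule space_form)
    then show "levi_civita M1 g1 nab" by (simp add: generalized_complex_space_form_def)
    show "pointwise_slant g1 J1 (vertical M1 M2 F) \<theta>" using slant V by simp
  qed
  have H': "H = orth_compl g1 (vertical M1 M2 F)" by (simp add: H horizontal_def)
  have d: "dim (orth_compl g1 (vertical M1 M2 F) p) = s" for p using dim_H H' by simp
  have s2: "2 \<le> s" using s by simp
  note r = hor_scalar_delta_C[OF d s2] and r' = hor_scalar_delta_hat_C[OF d s2]
  show ?thesis
    unfolding V H' A_vanishes_iff_integrable[symmetric] A_vanishes_iff_sections r(2) r'(2)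
    using r(1) r'(1) by blast
qed

end
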